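(* Let $m\geq 2$ be an integer and let $K\in L^2(S^m\times S^m)$ belong to $W_2^{\infty}$. Suppose there exist constants $M>0$ and $R>1$, not depending on $r$, such that $$\|K_{0,r}\|_2\leq M R^r,\qquad r=1,2,\ldots .$$ Then, for every sequence $\{\alpha_n\}_n$ of positive numbers with $\alpha_n=o(\sqrt[m]{n})$ as $n\to\infty$, one has, as $n\to\infty$, $$s_n(\mathcal{K})=o\left(n^{-\frac{\sqrt[m]{n}}{\delta m}-\alpha_n}\right),\qquad \delta=\begin{cases}2,&\text{if } m=2,\\ 1,&\text{if } m\geq 3.\end{cases}$$
   Context: $S^m$ is the unit sphere of $\mathbb{R}^{m+1}$ centered at the origin, with surface measure $\sigma_m$ induced by Lebesgue measure and total volume $\omega_m$. $L^2(S^m)=L^2(S^m,\sigma_m)$ is the Hilbert space of square-integrable functions $f:S^m\to\mathbb{C}$ with inner product $\langle f,g\rangle_2=\frac{1}{\omega_m}\int_{S^m}f\overline{g}\,d\sigma_m$ and norm $\|\cdot\|_2$; similarly $L^2(S^m\times S^m)=L^2(S^m\times S^m,\sigma_m\otimes\sigma_m)$, whose norm is also written $\|\cdot\|_2$. A kernel $K\in L^2(S^m\times S^m)$ generates the compact operator $\mathcal{K}:L^2(S^m)\to L^2(S^m)$, $\mathcal{K}(f)=\int_{S^m}K(\cdot,y)f(y)\,d\sigma_m(y)$. Its singular values $s_1(\mathcal{K})\geq s_2(\mathcal{K})\geq\cdots\geq 0$ are the eigenvalues of $|\mathcal{K}|=(\mathcal{K}^*\mathcal{K})^{1/2}$ in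 non-increasing order, repeated according to multiplicity (with zeros appended if only finitely many are nonzero). Laplace-Beltrami derivative: for $t\in(-1,1)$ let $S_t^m(f)(x)=\frac{1}{|R_t^m|}\int_{x\cdot y=t}f(y)\,dy$, $x\in S^m$, where $dy$ is the measure element of the rim $R_t^m=\{y\in S^m: x\cdot y=t\}$ and $|R_t^m|=\omega_{m-1}(1-t^2)^{(m-1)/2}$ is its volume. A function $f\in L^2(S^m)$ is LB-differentiable if there is $\mathcal{D}f\in L^2(S^m)$ with $\lim_{t\to1^-}\left\|\frac{f-S_t^m(f)}{1-t}-\mathcal{D}f\right\|_2=0$; $\mathcal{D}f$ is the Laplace-Beltrami derivative of $f$. Put $\mathcal{D}^1=\mathcal{D}$ and $\mathcal{D}^r=\mathcal{D}\circ\mathcal{D}^{r-1}$ for $r\geq 2$. (On spherical harmonics $Y$ of degree $n$ in $m+1$ variables, $\mathcal{D}^rY=\frac{n^r(n+m-1)^r}{m^r}Y$.) $W_2^\infty$ is the space of $f\in L^2(S^m)$ such that $\mathcal{D}^rf$ exists in $L^2(S^m)$ for all $r=1,2,\ldots$. A kernel $K$ is said to belong to $W_2^\infty$ if $K(x,\cdot)\in W_2^\infty$ for almost every $x\in S^m$. $K_{0,r}:=\mathcal{D}_y^rK$ denotes the $r$-th order Laplace-Beltrami derivative of $K$ with respect to its second variable $y$. *)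

theory Defs
  imports "HOL-Analysis.Analysis" "HOL-Library.Landau_Symbols"
begin

section \<open>Square-integrable functions\<close>

text \<open>Elements of \<open>L\<^sup>2\<close> are represented by functions, which stand for their classes modulo
  equality almost everywhere.  Inner product and norm are normalised by the total mass.\<close>

definition L2 :: "'b measure \<Rightarrow> ('b \<Rightarrow> complex) set" where
  "L2 M = {f \<in> borel_measurable M. integrable M (\<lambda>x. (cmod (f x))\<^sup>2)}"

definition L2_inner :: "'b measure \<Rightarrow> ('b \<Rightarrow> complex) \<Rightarrow> ('b \<Rightarrow> complex) \<Rightarrow> complex" where
  "L2_inner M f g = complex_of_real (1 / measure M (space M)) * (LINT x|M. f x * cnj (g x))"

definition L2_norm :: "'b measure \<Rightarrow> ('b \<Rightarrow> complex) \<Rightarrow> real" where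
  "L2_norm M f = sqrt (1 / measure M (space M) * (LINT x|M. (cmod (f x))\<^sup>2))"

section \<open>Singular values\<close>

definition L2_operator :: "'b measure \<Rightarrow> (('b \<Rightarrow> complex) \<Rightarrow> ('b \<Rightarrow> complex)) \<Rightarrow> bool" where
  "L2_operator M A \<longleftrightarrow>
     (\<forall>f\<in>L2 M. A f \<in> L2 M) \<and>
     (\<forall>f\<in>L2 M. \<forall>g\<in>L2 M. \<forall>c d. AE x in M.
        A (\<lambda>x. c * f x + d * g x) x = c * A f x + d * A g x) \<and>
     (\<exists>C. \<forall>f\<in>L2 M. L2_norm M (A f) \<le> C * L2_norm M f)"

definition L2_adjoint ::
    "'b measure \<Rightarrow> (('b \<Rightarrow> complex) \<Rightarrow> ('b \<Rightarrow> complex)) \<Rightarrow> (('b \<Rightarrow> complex) \<Rightarrow> ('b \<Rightarrow> complex)) \<Rightarrow> bool" where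
  "L2_adjoint M A B \<longleftrightarrow> L2_operator M B \<and>
     (\<forall>f\<in>L2 M. \<forall>g\<in>L2 M. L2_inner M (A f) g = L2_inner M f (B g))"

definition L2_positive :: "'b measure \<Rightarrow> (('b \<Rightarrow> complex) \<Rightarrow> ('b \<Rightarrow> complex)) \<Rightarrow> bool" where
  "L2_positive M P \<longleftrightarrow> L2_adjoint M P P \<and> (\<forall>f\<in>L2 M. 0 \<le> Re (L2_inner M (P f) f))"

text \<open>\<open>P\<close> is the absolute value \<open>(A\<^sup>* A)\<^sup>1\<^sup>/\<^sup>2\<close> of \<open>A\<close>; it is unique up to equality almost everywhere.\<close>

definition L2_abs ::
    "'b measure \<Rightarrow> (('b \<Rightarrow> complex) \<Rightarrow> ('b \<Rightarrow> complex)) \<Rightarrow> (('b \<Rightarrow> complex) \<Rightarrow> ('b \<Rightarrow> complex)) \<Rightarrow> bool" where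
  "L2_abs M A P \<longleftrightarrow> L2_positive M P \<and>
     (\<exists>B. L2_adjoint M A B \<and> (\<forall>f\<in>L2 M. AE x in M. P (P f) x = B (A f) x))"

definition L2_eigenspace ::
    "'b measure \<Rightarrow> (('b \<Rightarrow> complex) \<Rightarrow> ('b \<Rightarrow> complex)) \<Rightarrow> real \<Rightarrow> ('b \<Rightarrow> complex) set" where
  "L2_eigenspace M P l = {f \<in> L2 M. AE x in M. P f x = complex_of_real l * f x}"

text \<open>Dimension \<open>d\<close> modulo equality almost everywhere: there is a basis \<open>f 0, \<dots>, f (d - 1)\<close>.\<close>

definition L2_has_dim :: "'b measure \<Rightarrow> ('b \<Rightarrow> complex) set \<Rightarrow> nat \<Rightarrow> bool" where
  "L2_has_dim M E d \<longleftrightarrow>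
     (\<exists>f :: nat \<Rightarrow> 'b \<Rightarrow> complex.
        (\<forall>i<d. f i \<in> E) \<and>
        (\<forall>c. (AE x in M. (\<Sum>i<d. c i * f i x) = 0) \<longrightarrow> (\<forall>i<d. c i = 0)) \<and>
        (\<forall>g\<in>E. \<exists>c. AE x in M. g x = (\<Sum>i<d. c i * f i x)))"

text \<open>\<open>s 1 \<ge> s 2 \<ge> \<dots> \<ge> 0\<close> are the eigenvalues of the absolute value of \<open>A\<close>, where each
  \<open>l > 0\<close> occurs as often as its multiplicity (not at all if it is no eigenvalue).
  These conditions determine \<open>s n\<close> for all \<open>n \<ge> 1\<close>: by monotonicity the value \<open>0\<close> can occur only
  after all positive eigenvalues, that is, if there are only finitely many of them.
  The value \<open>s 0\<close> is irrelevant.\<close>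

definition has_singular_values ::
    "'b measure \<Rightarrow> (('b \<Rightarrow> complex) \<Rightarrow> ('b \<Rightarrow> complex)) \<Rightarrow> (nat \<Rightarrow> real) \<Rightarrow> bool" where
  "has_singular_values M A s \<longleftrightarrow>
     (\<forall>n\<ge>1. 0 \<le> s n \<and> s (Suc n) \<le> s n) \<and>
     (\<exists>P. L2_abs M A P \<and>
       (\<forall>l>0. finite {n. n \<ge> 1 \<and> s n = l} \<and>
               L2_has_dim M (L2_eigenspace M P l) (card {n. n \<ge> 1 \<and> s n = l})))"

section \<open>Surface measures\<close>

text \<open>The surface measure of the unit sphere: the mass of \<open>A\<close> is \<open>DIM('a)\<close> times the Lebesgue
  measure of the cone \<open>{r a | a \<in> A, 0 < r \<le> 1}\<close>.  For \<open>DIM('a) = m + 1\<close> this is \<open>\<sigma>\<^sub>m\<close>.\<close>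

definition sphere_measure :: "'a::euclidean_space measure" where
  "sphere_measure =
     scale_measure (of_nat DIM('a))
       (distr (restrict_space lborel (cball 0 1 - {0})) (restrict_space borel (sphere 0 1)) sgn)"

definition rim :: "'a::euclidean_space \<Rightarrow> real \<Rightarrow> 'a set" where
  "rim x t = {y \<in> sphere 0 1. x \<bullet> y = t}"

text \<open>The rim is a sphere of radius \<open>\<rho> = sqrt (1 - t\<^sup>2)\<close> and centre \<open>t x\<close> in a hyperplane of
  dimension \<open>m = DIM('a) - 1\<close> orthogonal to \<open>x\<close>.  Its surface measure is likewise \<open>m / \<rho>\<close> times the
  \<open>m\<close>-dimensional Lebesgue measure of the cone \<open>{r (a - t x) | a \<in> A, 0 < r \<le> 1}\<close>, and the latter is
  the Lebesgue measure in \<open>'a\<close> of the right cylinder of height \<open>1\<close> over that cone.\<close>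

definition rim_measure :: "'a::euclidean_space \<Rightarrow> real \<Rightarrow> 'a measure" where
  "rim_measure x t =
     (let \<rho> = sqrt (1 - t\<^sup>2);
          p = (\<lambda>z. z - (x \<bullet> z) *\<^sub>R x)
      in scale_measure (ennreal (real (DIM('a) - 1) / \<rho>))
           (distr
             (restrict_space lborel {z. 0 \<le> x \<bullet> z \<and> x \<bullet> z \<le> 1 \<and> 0 < norm (p z) \<and> norm (p z) \<le> \<rho>})
             (restrict_space borel (rim x t))
             (\<lambda>z. t *\<^sub>R x + \<rho> *\<^sub>R sgn (p z))))"

section \<open>Laplace-Beltrami derivatives\<close>

definition rim_mean :: "real \<Rightarrow> ('a::euclidean_space \<Rightarrow> complex) \<Rightarrow> 'a \<Rightarrow> complex" where
  "rim_mean t f x =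
     complex_of_real (1 / measure (rim_measure x t) (rim x t)) * (LINT y|rim_measure x t. f y)"

definition has_LB_derivative ::
    "('a::euclidean_space \<Rightarrow> complex) \<Rightarrow> ('a \<Rightarrow> complex) \<Rightarrow> bool" where
  "has_LB_derivative f g \<longleftrightarrow>
     f \<in> L2 sphere_measure \<and> g \<in> L2 sphere_measure \<and>
     ((\<lambda>t. L2_norm sphere_measure
         (\<lambda>x. (f x - rim_mean t f x) / complex_of_real (1 - t) - g x)) \<longlongrightarrow> 0) (at_left 1)"

text \<open>\<open>(has_LB_derivative ^^ r) f g\<close> says that \<open>g\<close> represents the \<open>r\<close>-th iterated derivative of \<open>f\<close>.\<close>

definition W2_infinity :: "('a::euclidean_space \<Rightarrow> complex) set" where
  "W2_infinity = {f \<in> L2 sphere_measure. \<forall>r\<ge>1. \<exists>g. (has_LB_derivative ^^ r) f g}"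

section \<open>Kernels\<close>

definition L2_kernel :: "('a::euclidean_space \<Rightarrow> 'a \<Rightarrow> complex) \<Rightarrow> bool" where
  "L2_kernel K \<longleftrightarrow> case_prod K \<in> L2 (sphere_measure \<Otimes>\<^sub>M sphere_measure)"

definition kernel_norm :: "('a::euclidean_space \<Rightarrow> 'a \<Rightarrow> complex) \<Rightarrow> real" where
  "kernel_norm K = L2_norm (sphere_measure \<Otimes>\<^sub>M sphere_measure) (case_prod K)"

definition kernel_operator ::
    "('a::euclidean_space \<Rightarrow> 'a \<Rightarrow> complex) \<Rightarrow> ('a \<Rightarrow> complex) \<Rightarrow> 'a \<Rightarrow> complex" where
  "kernel_operator K f x = (LINT y|sphere_measure. K x y * f y)"

definition kernel_W2_infinity :: "('a::euclidean_space \<Rightarrow> 'a \<Rightarrow> complex) \<Rightarrow> bool" where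
  "kernel_W2_infinity K \<longleftrightarrow> (AE x in sphere_measure. K x \<in> W2_infinity)"

text \<open>\<open>L\<close> represents, as an element of \<open>L\<^sup>2\<close> of the product, the \<open>r\<close>-th order derivative of \<open>K\<close>
  with respect to the second variable.\<close>

definition has_LB_derivative_snd ::
    "nat \<Rightarrow> ('a::euclidean_space \<Rightarrow> 'a \<Rightarrow> complex) \<Rightarrow> ('a \<Rightarrow> 'a \<Rightarrow> complex) \<Rightarrow> bool" where
  "has_LB_derivative_snd r K L \<longleftrightarrow>
     L2_kernel L \<and> (AE x in sphere_measure. (has_LB_derivative ^^ r) (K x) (L x))"

end

theory Submission
  imports Defs
begin

text \<open>The growth condition forces almost every section \<open>K x\<close> to be a spherical polynomial of bounded
  degree, so \<open>\<K>\<close> has finite rank and \<open>s n = 0\<close> for all large \<open>n\<close>.  Spherical harmonics are avoided.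

  The rim means are averages over the unit tangent bundle with its Liouville measure, which is the
  only measure on orthonormal pairs that is invariant under the orthogonal group: measures whose
  balls have a mass independent of the centre are unique up to a factor.  Uniqueness also gives
  invariance under the geodesic flow.  Hence the rim means are symmetric, and cutting an arc into
  \<open>k\<close> pieces shows that the mean square oscillation of \<open>f\<close> at distance \<open>\<theta>\<close> is at most \<open>k\<^sup>2\<close>
  times that at distance \<open>\<theta> / k\<close>, which in the limit bounds it by \<open>\<theta>\<^sup>2 Re \<langle>D f, f\<rangle>\<close>.  By
  symmetry of \<open>D\<close>, the norms of \<open>D\<^sup>r f\<close> are logarithmically convex in \<open>r\<close>, so a bound
  \<open>\<parallel>D\<^sup>r f\<parallel> \<le> C R\<^sup>r\<close> with any \<open>C\<close> improves to \<open>\<parallel>D f\<parallel> \<le> R \<parallel>f\<parallel>\<close>.  Averaging over small caps, a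
  Hilbert-Schmidt operator, is then bounded below on all such \<open>f\<close>, which therefore form a
  finite-dimensional space.\<close>

section \<open>Uniformly distributed measures\<close>

text \<open>Spherical harmonics explain the result: the eigenvalue of \<open>D\<close> grows with
  the degree, so derivatives of order r bounded by \<open>C * R ^ r\<close> leave room for finitely
  many degrees only. Two obstacles shape the proof. The hypothesis controls the derivatives of the
  kernel only on average over x; a single section satisfies a bound with a constant that depends on
  x, and with \<open>2 * R\<close> in place of \<open>R\<close>, the price of summing over all
  orders. The dimension estimate must therefore not see the constant, and logarithmic convexity
  removes it by what amounts to taking N-th roots. Moreover \<open>D\<close> is given as a limit for
  t tending to 1, that is, at vanishing distances, while a compactness argument needs control at a
  fixed distance. Cutting arcs bridges the scales without loss, because the factor k^2 is offset by
  1 - cos (\<theta>/k), which is at most (\<theta>/k)^2/2. Uniqueness of invariant measures takes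
  the place of all Jacobians; the density of the inner product of two random points is never
  computed.\<close>

lemma AE_scale_measure_iff:
  assumes "0 < r"
  shows "(AE x in scale_measure r M. P x) \<longleftrightarrow> (AE x in M. P x)"
proof -
  have "null_sets (scale_measure r M) = null_sets M"
    using assms by (auto simp: null_sets_def)
  then show ?thesis by (simp add: eventually_ae_filter space_scale_measure)
qed

text \<open>Both sides integrate the symmetric relation \<open>dist x y < r\<close> over pairs with
  \<open>x\<close> in \<open>F\<close>. For compact \<open>F\<close> this compares \<open>F\<close>
  with its neighbourhoods, for \<open>F = UNIV\<close> it compares total masses.\<close>

lemma tonelli_balls:
  fixes \<mu> \<nu> :: "'b::euclidean_space measure"
  assumes sets: "sets \<mu> = sets borel" "sets \<nu> = sets borel"
    and sf: "sigma_finite_measure \<mu>" "sigma_finite_measure \<nu>"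
    and F: "F \<in> sets borel"
  shows "(\<integral>\<^sup>+x. indicator F x * emeasure \<nu> (ball x r) \<partial>\<mu>) = (\<integral>\<^sup>+y. emeasure \<mu> (F \<inter> ball y r) \<partial>\<nu>)"
proof -
  interpret m: sigma_finite_measure \<mu> by fact
  interpret n: sigma_finite_measure \<nu> by fact
  interpret pair_sigma_finite \<mu> \<nu> ..
  let ?h = "\<lambda>x y. indicator F x * indicator (ball x r) y :: ennreal"
  have [measurable]: "F \<in> sets borel" by fact
  have D: "{p :: 'b \<times> 'b. dist (fst p) (snd p) < r} \<in> sets borel"
    by (intro borel_open open_Collect_less continuous_intros)
  have "(\<lambda>p :: 'b \<times> 'b. indicator F (fst p) * indicator {p. dist (fst p) (snd p) < r} p :: ennreal)
      \<in> borel_measurable borel"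
    by (intro borel_measurable_times_ennreal borel_measurable_indicator D
        measurable_compose[OF _ borel_measurable_indicator[OF F]] borel_measurable_continuous_onI
            continuous_intros)
  moreover have "(\<lambda>(x, y). ?h x y) = (\<lambda>p. indicator F (fst p) * indicator {p. dist (fst p) (snd p) <
      r} p)"
    by (auto simp: fun_eq_iff indicator_def)
  moreover have "sets (\<mu> \<Otimes>\<^sub>M \<nu>) = sets (borel :: ('b \<times> 'b) measure)"
    by (metis borel_prod sets sets_pair_measure_cong)
  ultimately have meas: "(\<lambda>(x, y). ?h x y) \<in> borel_measurable (\<mu> \<Otimes>\<^sub>M \<nu>)"
    by (simp cong: measurable_cong_sets)
  have "(\<integral>\<^sup>+x. indicator F x * emeasure \<nu> (ball x r) \<partial>\<mu>) = (\<integral>\<^sup>+x. \<integral>\<^sup>+y. ?h x y \<partial>\<nu> \<partial>\<mu>)"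
    using sets by (intro nn_integral_cong, subst nn_integral_cmult) (auto intro!:
        borel_measurable_indicator)
  also have "\<dots> = (\<integral>\<^sup>+y. \<integral>\<^sup>+x. ?h x y \<partial>\<mu> \<partial>\<nu>)"
    using Fubini'[OF meas] by simp
  also have "\<dots> = (\<integral>\<^sup>+y. emeasure \<mu> (F \<inter> ball y r) \<partial>\<nu>)"
  proof (intro nn_integral_cong)
    fix y
    have "(\<integral>\<^sup>+x. ?h x y \<partial>\<mu>) = (\<integral>\<^sup>+x. indicator (F \<inter> ball y r) x \<partial>\<mu>)"
      by (intro nn_integral_cong) (auto simp: indicator_def dist_commute)
    then show "(\<integral>\<^sup>+x. ?h x y \<partial>\<mu>) = emeasure \<mu> (F \<inter> ball y r)"
      using F by (simp add: sets)
  qed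
  finally show ?thesis .
qed

lemma sigma_finite_if_finite_balls:
  fixes \<mu> :: "'b::euclidean_space measure"
  assumes "sets \<mu> = sets borel" and "\<And>p r. emeasure \<mu> (ball p r) < \<infinity>"
  shows "sigma_finite_measure \<mu>"
proof
  have "space \<mu> = UNIV" using assms(1) by (metis sets_eq_imp_space_eq space_borel)
  moreover have "(\<Union>n::nat. ball (0::'b) (real n)) = UNIV"
    by (auto simp: intro: reals_Archimedean2)
  ultimately show "\<exists>A. countable A \<and> A \<subseteq> sets \<mu> \<and> \<Union> A = space \<mu> \<and> (\<forall>a\<in>A. emeasure \<mu> a \<noteq> \<infinity>)"
    using assms by (intro exI[of _ "range (\<lambda>n::nat. ball (0::'b) (real n))"]) (auto simp: less_top)
qed

text \<open>The compact sets are exhausted from outside by their neighbourhoods of radius \<open>r\<close>, and the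
  mass of such a neighbourhood is compared by averaging over balls of radius \<open>r\<close>.\<close>

lemma uniformly_distributed_le:
  fixes \<mu> \<nu> :: "'b::euclidean_space measure"
  assumes sets: "sets \<mu> = sets borel" "sets \<nu> = sets borel"
    and fin: "\<And>p r. emeasure \<mu> (ball p r) < \<infinity>" "\<And>p r. emeasure \<nu> (ball p r) < \<infinity>"
    and C: "AE x in \<mu>. x \<in> C" "AE x in \<nu>. x \<in> C"
    and b: "\<And>p r. p \<in> C \<Longrightarrow> 0 < r \<Longrightarrow> emeasure \<mu> (ball p r) = b r"
      "\<And>p r. p \<in> C \<Longrightarrow> 0 < r \<Longrightarrow> emeasure \<nu> (ball p r) = b r"
    and pos: "\<And>r. 0 < r \<Longrightarrow> 0 < b r" "\<And>r. 0 < r \<Longrightarrow> b r < \<infinity>"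
    and F: "compact F"
  shows "emeasure \<mu> F \<le> emeasure \<nu> F"
proof -
  have sf: "sigma_finite_measure \<mu>" "sigma_finite_measure \<nu>"
    using sigma_finite_if_finite_balls sets fin by auto
  have FB: "F \<in> sets borel" using F by (simp add: compact_imp_closed)
  define U where "U r = (\<Union>x\<in>F. ball x r)" for r
  have U_open: "open (U r)" for r by (auto simp: U_def)
  have le: "emeasure \<mu> F \<le> emeasure \<nu> (U r)" if r: "0 < r" for r
  proof -
    have "b r * emeasure \<mu> F = (\<integral>\<^sup>+x. b r * indicator F x \<partial>\<mu>)"
      using FB sets by (subst nn_integral_cmult) (auto intro!: borel_measurable_indicator)
    also have "\<dots> = (\<integral>\<^sup>+x. indicator F x * emeasure \<nu> (ball x r) \<partial>\<mu>)"
      using C(1) by (intro nn_integral_cong_AE) (auto simp: b r mult.commute)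
    also have "\<dots> = (\<integral>\<^sup>+y. emeasure \<mu> (F \<inter> ball y r) \<partial>\<nu>)"
      by (rule tonelli_balls) (use sets sf FB in auto)
    \<comment> \<open>A ball about \<open>y\<close> that meets \<open>F\<close> puts
      \<open>y\<close> into \<open>U r\<close>; its mass is at most \<open>b r\<close>, because
      almost every \<open>y\<close> lies in \<open>C\<close>.\<close>
    also have "\<dots> \<le> (\<integral>\<^sup>+y. b r * indicator (U r) y \<partial>\<nu>)"
    proof (rule nn_integral_mono_AE)
      show "AE y in \<nu>. emeasure \<mu> (F \<inter> ball y r) \<le> b r * indicator (U r) y"
        using C(2)
      proof eventually_elim
        case (elim y)
        show ?case
        proof (cases "F \<inter> ball y r = {}")
          case False
          then have "y \<in> U r" by (auto simp: U_def dist_commute)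
          moreover have "emeasure \<mu> (F \<inter> ball y r) \<le> b r"
            using b(1)[OF elim r] emeasure_mono[of "F \<inter> ball y r" "ball y r" \<mu>] by (simp add: sets)
          ultimately show ?thesis by simp
        qed simp
      qed
    qed
    also have "\<dots> = b r * emeasure \<nu> (U r)"
      using U_open sets by (subst nn_integral_cmult) (auto intro!: borel_measurable_indicator)
    finally show ?thesis
      using pos[OF r] by (subst (asm) ennreal_mult_le_mult_iff) auto
  qed
  define V where "V n = U (1 / real (Suc n))" for n
  have inter: "(\<Inter>n. V n) = F"
  proof
    show "F \<subseteq> (\<Inter>n. V n)" by (force simp: V_def U_def)
    show "(\<Inter>n. V n) \<subseteq> F"
    proof
      fix y assume y: "y \<in> (\<Inter>n. V n)"
      show "y \<in> F"
      proof (rule ccontr)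
        assume "y \<notin> F"
        then obtain e where e: "e > 0" "ball y e \<subseteq> - F"
          using compact_imp_closed[OF F] by (meson ComplI open_Compl open_contains_ball)
        obtain n where n: "1 / real (Suc n) < e" using nat_approx_posE[OF e(1)] by blast
        from y have "y \<in> V n" by blast
        then obtain x where "x \<in> F" "dist x y < 1 / real (Suc n)" by (auto simp: V_def U_def)
        then show False using e n by (force simp: dist_commute)
      qed
    qed
  qed
  have dec: "decseq V"
    unfolding decseq_def V_def U_def
    by (fastforce simp: frac_le intro: less_le_trans)
  have "bounded (U 1)"
  proof -
    obtain B where "\<And>x. x \<in> F \<Longrightarrow> norm x \<le> B" using compact_imp_bounded[OF F] by (auto simp: bounded_iff)
    then have "norm y \<le> B + 1" if y: "y \<in> U 1" for y
    proof -
      obtain x where x: "x \<in> F" "dist x y < 1" using y by (auto simp: U_def)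
      have "norm y \<le> norm x + dist x y" by (metis dist_commute dist_norm norm_triangle_sub)
      then show ?thesis using x \<open>\<And>x. x \<in> F \<Longrightarrow> norm x \<le> B\<close> by force
    qed
    then show ?thesis by (auto simp: bounded_iff)
  qed
  then obtain B where "U 1 \<subseteq> ball 0 B" using bounded_subset_ballD by blast
  then have fin1: "emeasure \<nu> (U 1) < \<infinity>"
    using emeasure_mono[of "U 1" "ball 0 B" \<nu>] fin(2)[of 0 B] by (simp add: sets)
  have finV: "emeasure \<nu> (V n) \<noteq> \<infinity>" for n
  proof -
    have "V n \<subseteq> U 1" using dec by (force simp: V_def U_def intro: less_le_trans)
    then have "emeasure \<nu> (V n) \<le> emeasure \<nu> (U 1)" using U_open by (intro emeasure_mono) (auto
        simp: sets)
    then show ?thesis using fin1 by auto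
  qed
  have "(\<lambda>n. emeasure \<nu> (V n)) \<longlonglongrightarrow> emeasure \<nu> (\<Inter>n. V n)"
    using U_open finV by (intro Lim_emeasure_decseq dec) (auto simp: sets V_def[abs_def])
  then show ?thesis
    unfolding inter by (rule tendsto_lowerbound) (auto simp: V_def le)
qed

text \<open>Compact sets are stable under intersection and generate the Borel sets, so the
  inequality on compact sets, applied in both directions, is enough.\<close>

lemma uniformly_distributed_unique:
  fixes \<mu> \<nu> :: "'b::euclidean_space measure"
  assumes sets: "sets \<mu> = sets borel" "sets \<nu> = sets borel"
    and fin: "\<And>p r. emeasure \<mu> (ball p r) < \<infinity>" "\<And>p r. emeasure \<nu> (ball p r) < \<infinity>"
    and C: "AE x in \<mu>. x \<in> C" "AE x in \<nu>. x \<in> C"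
    and b: "\<And>p r. p \<in> C \<Longrightarrow> 0 < r \<Longrightarrow> emeasure \<mu> (ball p r) = b r"
      "\<And>p r. p \<in> C \<Longrightarrow> 0 < r \<Longrightarrow> emeasure \<nu> (ball p r) = b r"
    and pos: "\<And>r. 0 < r \<Longrightarrow> 0 < b r" "\<And>r. 0 < r \<Longrightarrow> b r < \<infinity>"
  shows "\<mu> = \<nu>"
proof (rule measure_eqI_generator_eq)
  show "Int_stable (Collect (compact :: 'b set \<Rightarrow> bool))" by (auto simp: Int_stable_def compact_Int)
  show "Collect (compact :: 'b set \<Rightarrow> bool) \<subseteq> Pow UNIV" by simp
  show "emeasure \<mu> X = emeasure \<nu> X" if "X \<in> Collect compact" for X
    using uniformly_distributed_le[OF sets fin C b pos, of X]
      uniformly_distributed_le[OF sets(2,1) fin(2,1) C(2,1) b(2,1) pos, of X] that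
    by (auto intro: antisym)
  have gen: "sets borel = sigma_sets UNIV (Collect (compact :: 'b set \<Rightarrow> bool))"
  proof
    show "sigma_sets UNIV (Collect compact) \<subseteq> sets (borel :: 'b measure)"
      by (rule sets.sigma_sets_subset[of _ borel, unfolded space_borel]) (auto simp: compact_imp_closed)
    have "range (\<lambda>(a, b). box a b) \<subseteq> sigma_sets UNIV (Collect (compact :: 'b set \<Rightarrow> bool))"
    proof clarify
      fix a b :: 'b
      obtain K where K: "\<And>n. compact (K n)" "(\<Union>n::nat. K n) = box a b"
        by (metis open_Union_compact_subsets open_box)
      have "(\<Union>n. K n) \<in> sigma_sets UNIV (Collect compact)"
        using K(1) by (intro sigma_sets.Union) auto
      then show "box a b \<in> sigma_sets UNIV (Collect compact)" using K by simp
    qed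
    then have "sigma_sets UNIV (range (\<lambda>(a, b). box a b)) \<subseteq> sigma_sets UNIV (Collect (compact ::
        'b set \<Rightarrow> bool))"
      by (rule sigma_sets_mono)
    then show "sets (borel :: 'b measure) \<subseteq> sigma_sets UNIV (Collect compact)"
      by (simp add: borel_eq_box)
  qed
  then show "sets \<mu> = sigma_sets UNIV (Collect compact)" "sets \<nu> = sigma_sets UNIV (Collect compact)"
    using sets by auto
  show "range (\<lambda>n::nat. cball 0 (real n)) \<subseteq> Collect (compact :: 'b set \<Rightarrow> bool)" by auto
  show "(\<Union>n. cball 0 (real n)) = (UNIV :: 'b set)"
    using real_arch_simple by (auto)
  show "emeasure \<mu> (cball 0 (real n)) \<noteq> \<infinity>" for n
    using emeasure_mono[of "cball 0 (real n)" "ball 0 (real n + 1)" \<mu>] fin(1)[of 0 "real n + 1"]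
    by (force simp: sets)
qed

text \<open>Tonelli with the whole space as \<open>F\<close> shows that the ball masses of the two
  measures are in the ratio of the total masses; after cross-scaling the ball functions agree.
  Scaling crosswise instead of dividing keeps the equation meaningful for
  \<open>\<nu> = 0\<close>.\<close>

lemma uniformly_distributed_proportional:
  fixes \<mu> \<nu> :: "'b::euclidean_space measure"
  assumes sets: "sets \<mu> = sets borel" "sets \<nu> = sets borel"
    and fin: "finite_measure \<mu>" "finite_measure \<nu>"
    and C: "AE x in \<mu>. x \<in> C" "AE x in \<nu>. x \<in> C" "compact C"
    and b: "\<And>p q r. p \<in> C \<Longrightarrow> q \<in> C \<Longrightarrow> 0 < r \<Longrightarrow> emeasure \<mu> (ball p r) = emeasure \<mu> (ball q r)"
      "\<And>p q r. p \<in> C \<Longrightarrow> q \<in> C \<Longrightarrow> 0 < r \<Longrightarrow> emeasure \<nu> (ball p r) = emeasure \<nu> (ball q r)"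
    and pos: "0 < emeasure \<mu> UNIV"
  shows "scale_measure (emeasure \<mu> UNIV) \<nu> = scale_measure (emeasure \<nu> UNIV) \<mu>"
proof (cases "emeasure \<nu> UNIV = 0")
  case True
  have sp: "space \<mu> = UNIV" "space \<nu> = UNIV" using sets by (metis sets_eq_imp_space_eq space_borel)+
  have "emeasure \<nu> A = 0" for A
    using True sp by (metis emeasure_eq_0 emeasure_notin_sets sets.top subset_UNIV)
  then show ?thesis using True by (intro measure_eqI) (auto simp: sets)
next
  case posn: False
  interpret m: finite_measure \<mu> by fact
  interpret n: finite_measure \<nu> by fact
  have sp: "space \<mu> = UNIV" "space \<nu> = UNIV" using sets by (metis sets_eq_imp_space_eq space_borel)+
  have "C \<noteq> {}"
  proof
    assume "C = {}"
    then have "AE x in \<mu>. False" using C by simp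
    then have "emeasure \<mu> UNIV = 0" using AE_iff_measurable[of UNIV \<mu> "\<lambda>_. False"] sets by (simp add: sp)
    with pos show False by simp
  qed
  then obtain p where p: "p \<in> C" by auto
  define b where "b r = emeasure \<mu> (ball p r)" for r
  define c where "c r = emeasure \<nu> (ball p r)" for r
  have mb: "emeasure \<mu> (ball x r) = b r" if "x \<in> C" "0 < r" for x r using b(1)[OF that(1) p that(2)]
      by (simp add: b_def)
  have nc: "emeasure \<nu> (ball x r) = c r" if "x \<in> C" "0 < r" for x r using b(2)[OF that(1) p that(2)]
      by (simp add: c_def)
  \<comment> \<open>If balls of radius \<open>r\<close> about points of \<open>C\<close> were null,
    finitely many of them would cover the compact set \<open>C\<close>, and \<open>\<mu>\<close>
    would vanish.\<close>
  have b_pos: "b r > 0" if r: "r > 0" for r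
  proof (rule ccontr)
    assume "\<not> b r > 0"
    then have 0: "b r = 0" by simp
    obtain T where T: "T \<subseteq> C" "finite T" "C \<subseteq> (\<Union>x\<in>T. ball x r)"
    proof (rule compactE_image[OF C(3), of C "\<lambda>x. ball x r"])
      show "C \<subseteq> (\<Union>x\<in>C. ball x r)" using r by auto
    qed auto
    have "emeasure \<mu> (\<Union>x\<in>T. ball x r) \<le> (\<Sum>x\<in>T. emeasure \<mu> (ball x r))"
      by (rule emeasure_subadditive_finite) (use T in \<open>auto simp: sets\<close>)
    also have "\<dots> = 0" using T mb r 0 by (intro sum.neutral) auto
    finally have "(\<Union>x\<in>T. ball x r) \<in> null_sets \<mu>" by (auto simp: null_sets_def sets intro!: borel_open)
    then have "AE x in \<mu>. x \<notin> (\<Union>x\<in>T. ball x r)" by (rule AE_not_in)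
    with C(1) have "AE x in \<mu>. False" by eventually_elim (use T in auto)
    then have "emeasure \<mu> UNIV = 0" using AE_iff_measurable[of UNIV \<mu> "\<lambda>_. False"] sets by (simp add: sp)
    with pos show False by simp
  qed
  have key: "c r * emeasure \<mu> UNIV = b r * emeasure \<nu> UNIV" if r: "r > 0" for r
  proof -
    have "c r * emeasure \<mu> UNIV = (\<integral>\<^sup>+x. c r \<partial>\<mu>)" by (simp add: sp)
    also have "\<dots> = (\<integral>\<^sup>+x. indicator UNIV x * emeasure \<nu> (ball x r) \<partial>\<mu>)"
      using C(1) by (intro nn_integral_cong_AE) (auto simp: nc r)
    also have "\<dots> = (\<integral>\<^sup>+y. emeasure \<mu> (UNIV \<inter> ball y r) \<partial>\<nu>)"
      by (rule tonelli_balls) (use sets in \<open>auto intro: m.sigma_finite_measure_axioms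
          n.sigma_finite_measure_axioms\<close>)
    also have "\<dots> = (\<integral>\<^sup>+x. b r \<partial>\<nu>)"
      using C(2) by (intro nn_integral_cong_AE) (auto simp: mb r)
    finally show ?thesis by (simp add: sp)
  qed
  show ?thesis
  proof (rule uniformly_distributed_unique[where C = C and b = "\<lambda>r. emeasure \<mu> UNIV * c r"])
    show "0 < emeasure \<mu> UNIV * c r" if "0 < r" for r
    proof -
      have "0 < b r * emeasure \<nu> UNIV" using b_pos[OF that] posn by (simp add:
          ennreal_zero_less_mult_iff zero_less_iff_neq_zero)
      then show ?thesis using key[OF that] by (simp add: mult.commute)
    qed
    show "AE x in scale_measure (emeasure \<mu> UNIV) \<nu>. x \<in> C" "AE x in scale_measure (emeasure \<nu> UNIV)
        \<mu>. x \<in> C"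
      using C posn pos by (simp_all add: AE_scale_measure_iff zero_less_iff_neq_zero)
    show "emeasure \<mu> UNIV * c r < \<infinity>" for r
      by (simp add: c_def less_top[symmetric] ennreal_mult_eq_top_iff)
    show "emeasure (scale_measure (emeasure \<mu> UNIV) \<nu>) (ball p r) < \<infinity>"
      "emeasure (scale_measure (emeasure \<nu> UNIV) \<mu>) (ball p r) < \<infinity>" for p r
      by (simp_all add: less_top[symmetric] ennreal_mult_eq_top_iff)
    show "emeasure (scale_measure (emeasure \<mu> UNIV) \<nu>) (ball p r) = emeasure \<mu> UNIV * c r"
      "emeasure (scale_measure (emeasure \<nu> UNIV) \<mu>) (ball p r) = emeasure \<mu> UNIV * c r"
      if "p \<in> C" "0 < r" for p r
      using that key[of r] nc[of p r] mb[of p r] by (simp_all add: mult.commute)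
  qed (simp_all add: sets)
qed

section \<open>Orthogonal transformations\<close>

lemma orthogonal_transformation_dist:
  "orthogonal_transformation T \<Longrightarrow> dist (T x) (T y) = dist x y"
  by (metis dist_norm orthogonal_transformation orthogonal_transformation_linear linear_diff)

lemma orthogonal_transformation_inner:
  "orthogonal_transformation T \<Longrightarrow> T x \<bullet> T y = x \<bullet> y"
  by (simp add: orthogonal_transformation_def)

lemma orthogonal_transformation_sgn:
  "orthogonal_transformation T \<Longrightarrow> T (sgn x) = sgn (T x)"
  by (simp add: sgn_div_norm orthogonal_transformation_scaleR orthogonal_transformation_norm)

lemma orthogonal_transformation_borel:
  fixes T :: "'a::euclidean_space \<Rightarrow> 'a"
  shows "orthogonal_transformation T \<Longrightarrow> T \<in> borel_measurable borel"
  using linear_continuous_on[OF linear_conv_bounded_linear[THEN iffD1, OF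
      orthogonal_transformation_linear]]
  by (blast intro: borel_measurable_continuous_onI)

lemma vimage_ball_orthogonal_transformation:
  fixes T :: "'a::euclidean_space \<Rightarrow> 'a"
  assumes "orthogonal_transformation T"
  shows "T -` ball (T p) r = ball p r"
  using orthogonal_transformation_dist[OF assms] by auto

text \<open>The Householder reflection in the hyperplane orthogonal to \<open>a\<close>. For
  \<open>a = 0\<close> the division by zero yields the identity, so it is an orthogonal
  transformation for every \<open>a\<close>.\<close>

definition reflect :: "'a::real_inner \<Rightarrow> 'a \<Rightarrow> 'a" where
  "reflect a z = z - (2 * (a \<bullet> z) / (a \<bullet> a)) *\<^sub>R a"

lemma orthogonal_transformation_reflect: "orthogonal_transformation (reflect a)"
proof (cases "a = 0")
  case True
  then have "reflect a = (\<lambda>z. z)" by (simp add: reflect_def fun_eq_iff)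
  then show ?thesis by simp
next
  case False
  have "linear (reflect a)"
  proof (rule linearI)
    show "reflect a (x + y) = reflect a x + reflect a y" for x y
      by (simp add: reflect_def inner_add_right distrib_left add_divide_distrib scaleR_add_left)
    show "reflect a (r *\<^sub>R x) = r *\<^sub>R reflect a x" for r x
      by (simp add: reflect_def scaleR_diff_right mult.left_commute)
  qed
  moreover have "reflect a v \<bullet> reflect a w = v \<bullet> w" for v w
  proof -
    define q s t where "q = a \<bullet> a" and "s = a \<bullet> v" and "t = a \<bullet> w"
    have "q \<noteq> 0" using False by (simp add: q_def)
    have "reflect a v \<bullet> reflect a w = v \<bullet> w - (2 * t / q) * s - (2 * s / q) * (t - (2 * t / q) * q)"
      by (simp add: reflect_def inner_diff_left inner_diff_right inner_commute[of v a] q_def s_def t_def)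
    then show ?thesis using \<open>q \<noteq> 0\<close> by simp
  qed
  ultimately show ?thesis by (simp add: orthogonal_transformation_def)
qed

text \<open>Vectors of equal length are mirror images in the hyperplane orthogonal to their
  difference.\<close>

lemma reflect_diff:
  assumes "norm x = norm y"
  shows "reflect (x - y) x = y"
proof (cases "x = y")
  case False
  have "x \<bullet> x = y \<bullet> y" using assms by (simp add: norm_eq)
  then have "2 * ((x - y) \<bullet> x) = (x - y) \<bullet> (x - y)" by (simp add: inner_simps inner_commute)
  moreover have "(x - y) \<bullet> (x - y) \<noteq> 0" using False by simp
  ultimately have "2 * ((x - y) \<bullet> x) / ((x - y) \<bullet> (x - y)) = 1"
    by (metis divide_self)
  then have "reflect (x - y) x = x - 1 *\<^sub>R (x - y)" by (simp only: reflect_def)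
  then show ?thesis by simp
qed (simp add: reflect_def)

lemma reflect_orthogonal: "a \<bullet> z = 0 \<Longrightarrow> reflect a z = z"
  by (simp add: reflect_def)

lemma orthogonal_transformation_transitive:
  fixes x y :: "'a::real_inner"
  assumes "norm x = norm y"
  obtains T where "orthogonal_transformation T" "T x = y"
  using orthogonal_transformation_reflect reflect_diff[OF assms] by blast

text \<open>The unit tangent bundle of the sphere: \<open>v\<close> is a unit tangent vector at
  \<open>x\<close>.\<close>

definition frames :: "('a::euclidean_space \<times> 'a) set" where
  "frames = {(x, v). norm x = 1 \<and> norm v = 1 \<and> x \<bullet> v = 0}"

lemma orthogonal_transformation_transitive_frames:
  fixes x v x' v' :: "'a::euclidean_space"
  assumes "(x, v) \<in> frames" "(x', v') \<in> frames"
  obtains T where "orthogonal_transformation T" "T x = x'" "T v = v'"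
proof -
  obtain T where T: "orthogonal_transformation T" "T x = x'"
    using orthogonal_transformation_transitive[of x x'] assms by (auto simp: frames_def)
  \<comment> \<open>Reflecting along \<open>T v - v'\<close> moves \<open>T v\<close> to
    \<open>v'\<close> and fixes \<open>x'\<close>, since both vectors are orthogonal to
    \<open>x'\<close>.\<close>
  define U where "U = reflect (T v - v')"
  have Tv: "x' \<bullet> T v = 0" "norm (T v) = 1"
    using assms T orthogonal_transformation_inner[OF T(1), of x v] orthogonal_transformation_norm[OF
        T(1), of v]
    by (auto simp: frames_def)
  have "U x' = x'"
    unfolding U_def using Tv assms by (intro reflect_orthogonal) (auto
        simp: frames_def inner_simps inner_commute)
  moreover have "U (T v) = v'"
    unfolding U_def using Tv assms by (intro reflect_diff) (auto simp: frames_def)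
  moreover have "orthogonal_transformation (U \<circ> T)"
    using T(1) orthogonal_transformation_reflect unfolding U_def
        by (rule orthogonal_transformation_compose[rotated])
  ultimately show ?thesis using that[of "U \<circ> T"] T by auto
qed

text \<open>The image measure gives every ball the volume of a ball of the same radius, so the
  uniqueness of uniformly distributed measures replaces a determinant computation.\<close>

lemma distr_lborel_orthogonal_transformation:
  fixes T :: "'a::euclidean_space \<Rightarrow> 'a"
  assumes T: "orthogonal_transformation T"
  shows "distr lborel borel T = lborel"
proof (rule uniformly_distributed_unique[where C = UNIV and b = "\<lambda>r. emeasure lborel (ball (0::'a) r)"])
  have [measurable]: "T \<in> borel_measurable borel" using T by (rule orthogonal_transformation_borel)
  show fin: "emeasure lborel (ball p r) < \<infinity>" for p :: 'a and r
    using emeasure_lborel_ball_finite by simp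
  show l: "emeasure lborel (ball p r) = emeasure lborel (ball (0::'a) r)" if "0 < r" for p :: 'a and r
    using that by (simp add: emeasure_ball)
  have eq: "emeasure (distr lborel borel T) (ball p r) = emeasure lborel (ball q r)" if "p =
      T q" for p q r
    using that by (simp add: emeasure_distr vimage_ball_orthogonal_transformation[OF T])
  have surj: "\<exists>q. p = T q" for p
    using orthogonal_transformation_surj[OF T] by (rule surjD)
  show "emeasure (distr lborel borel T) (ball p r) < \<infinity>" for p r
    using surj[of p] eq[of p _ r] fin by auto
  show "emeasure (distr lborel borel T) (ball p r) = emeasure lborel (ball (0::'a) r)" if "0 < r" for p r
    using surj[of p] eq[of p _ r] l[OF that] by auto
  show "0 < emeasure lborel (ball (0::'a) r)" "emeasure lborel (ball (0::'a) r) < \<infinity>" if "0 < r" for r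
    using that fin by (simp_all add: emeasure_ball)
qed auto

lemma nn_integral_lborel_orthogonal_transformation:
  fixes T :: "'a::euclidean_space \<Rightarrow> 'a"
  assumes T: "orthogonal_transformation T" and [measurable]: "h \<in> borel_measurable borel"
  shows "(\<integral>\<^sup>+x. h (T x) \<partial>lborel) = (\<integral>\<^sup>+x. h x \<partial>lborel)"
proof -
  have [measurable]: "T \<in> borel_measurable borel" using T by (rule orthogonal_transformation_borel)
  show ?thesis
    by (subst (2) distr_lborel_orthogonal_transformation[OF T, symmetric]) (simp add: nn_integral_distr)
qed

section \<open>The surface measure of the sphere\<close>

abbreviation (input) \<sigma> :: "'a::euclidean_space measure" where
  "\<sigma> \<equiv> sphere_measure"

lemma space_sphere_measure [simp]: "space \<sigma> = sphere 0 1"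
  by (simp add: sphere_measure_def space_scale_measure space_restrict_space)

lemma sets_sphere_measure [measurable_cong, simp]:
  "sets \<sigma> = sets (restrict_space borel (sphere 0 1))"
  by (simp add: sphere_measure_def)

lemma measurable_sphere_measureI:
  "f \<in> measurable borel N \<Longrightarrow> f \<in> measurable \<sigma> N"
  using measurable_restrict_space1 measurable_cong_sets[OF sets_sphere_measure refl] by blast

lemma sets_sphere_measureI: "A \<in> sets borel \<Longrightarrow> A \<inter> sphere 0 1 \<in> sets \<sigma>"
  by (auto simp: sets_restrict_space)

lemma nn_integral_sphere_measure:
  fixes h :: "'a::euclidean_space \<Rightarrow> ennreal"
  assumes [measurable]: "h \<in> borel_measurable borel"
  shows "(\<integral>\<^sup>+x. h x \<partial>\<sigma>) =
    of_nat DIM('a) * (\<integral>\<^sup>+z. h (sgn z) * indicator (cball 0 1 - {0}) z \<partial>lborel)"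
proof -
  have sgn: "sgn \<in> restrict_space lborel (cball (0::'a) 1 - {0}) \<rightarrow>\<^sub>M restrict_space borel (sphere 0 1)"
    by (intro measurable_restrict_space2 measurable_restrict_space1)
      (auto simp: space_restrict_space norm_sgn)
  have h: "h \<in> borel_measurable (restrict_space borel (sphere 0 1))"
    by (intro measurable_restrict_space1 assms)
  have "(\<integral>\<^sup>+x. h x \<partial>distr (restrict_space lborel (cball 0 1 - {0})) (restrict_space borel (sphere 0
      1)) sgn)
    = (\<integral>\<^sup>+z. h (sgn z) * indicator (cball 0 1 - {0}) z \<partial>lborel)"
    using nn_integral_distr[OF sgn, of h] h by (simp add: nn_integral_restrict_space)
  then show ?thesis
    using h unfolding sphere_measure_def by (subst nn_integral_scale_measure) auto
qed

text \<open>An orthogonal map commutes with \<open>sgn\<close> and preserves the punctured unit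
  ball, so the cone formula carries the invariance over from Lebesgue measure.\<close>

lemma nn_integral_sphere_orthogonal_transformation:
  fixes T :: "'a::euclidean_space \<Rightarrow> 'a"
  assumes T: "orthogonal_transformation T" and [measurable]: "h \<in> borel_measurable borel"
  shows "(\<integral>\<^sup>+x. h (T x) \<partial>\<sigma>) = (\<integral>\<^sup>+x. h x \<partial>\<sigma>)"
proof -
  have [measurable]: "T \<in> borel_measurable borel" using T by (rule orthogonal_transformation_borel)
  have "(\<integral>\<^sup>+x. h (T x) \<partial>\<sigma>) =
    of_nat DIM('a) * (\<integral>\<^sup>+z. h (sgn (T z)) * indicator (cball 0 1 - {0}) (T z) \<partial>lborel)"
  proof (subst nn_integral_sphere_measure)
    have "T z \<in> cball 0 1 - {0} \<longleftrightarrow> z \<in> cball 0 1 - {0}" for z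
      using orthogonal_transformation_norm[OF T, of z] norm_eq_zero[of z] norm_eq_zero[of "T z"]
      by (simp del: norm_eq_zero)
    then have "indicator (cball 0 1 - {0}) (T z) = (indicator (cball 0 1 - {0}) z :: ennreal)" for z
      by (simp only: indicator_def)
    then show "of_nat DIM('a) * (\<integral>\<^sup>+z. h (T (sgn z)) * indicator (cball 0 1 - {0}) z \<partial>lborel) =
      of_nat DIM('a) * (\<integral>\<^sup>+z. h (sgn (T z)) * indicator (cball 0 1 - {0}) (T z) \<partial>lborel)"
      by (simp only: orthogonal_transformation_sgn[OF T])
  qed measurable
  also have "\<dots> = (\<integral>\<^sup>+x. h x \<partial>\<sigma>)"
  proof -
    have [measurable]: "cball 0 1 - {0::'a} \<in> sets borel" by (intro sets.Diff borel_closed) auto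
    have "(\<lambda>z. h (sgn z) * indicator (cball 0 1 - {0}) z) \<in> borel_measurable borel" by measurable
    then show ?thesis
    using nn_integral_lborel_orthogonal_transformation[OF T,
          of "\<lambda>z. h (sgn z) * indicator (cball 0 1 - {0}) z"] nn_integral_sphere_measure[of h] assms(2)
    by simp
  qed
  finally show ?thesis .
qed

lemma emeasure_sphere_measure_space:
  "emeasure (\<sigma> :: 'a::euclidean_space measure) (sphere 0 1) =
    of_nat DIM('a) * emeasure lborel (cball (0::'a) 1 - {0})"
  using nn_integral_sphere_measure[of "\<lambda>_::'a. 1"] by simp

lemma finite_sphere_measure: "finite_measure (\<sigma> :: 'a::euclidean_space measure)"
proof
  have "emeasure lborel (cball (0::'a) 1 - {0}) \<le> emeasure lborel (cball (0::'a) 1)"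
    by (intro emeasure_mono) auto
  then have "emeasure lborel (cball (0::'a) 1 - {0}) < \<infinity>"
    using emeasure_lborel_cball_finite le_less_trans by blast
  then show "emeasure (\<sigma> :: 'a measure) (space \<sigma>) \<noteq> \<infinity>"
    by (auto simp: emeasure_sphere_measure_space ennreal_mult_eq_top_iff)
qed

interpretation sphere: finite_measure "\<sigma> :: 'a::euclidean_space measure"
  by (rule finite_sphere_measure)

lemma measure_sphere_pos: "0 < measure (\<sigma> :: 'a::euclidean_space measure) (sphere 0 1)"
proof -
  have "emeasure lborel (cball (0::'a) 1) = emeasure lborel (cball (0::'a) 1 - {0})"
    by (rule emeasure_Diff_null_set[symmetric]) auto
  then have "0 < emeasure lborel (cball (0::'a) 1 - {0})"
    using content_cball_pos[of 1 "0::'a"] by (simp add: measure_def enn2real_positive_iff)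
  then have "emeasure (\<sigma> :: 'a measure) (sphere 0 1) \<noteq> 0"
    by (simp add: emeasure_sphere_measure_space)
  then show ?thesis by (simp add: sphere.emeasure_eq_measure zero_less_measure_iff)
qed

section \<open>Invariant measures on orthonormal pairs\<close>

lemma measurable_pair_borelI:
  fixes M1 :: "'a::second_countable_topology measure" and M2 :: "'b::second_countable_topology measure"
  assumes "(\<lambda>x. x) \<in> M1 \<rightarrow>\<^sub>M borel" "(\<lambda>x. x) \<in> M2 \<rightarrow>\<^sub>M borel" "f \<in> borel \<rightarrow>\<^sub>M N"
  shows "f \<in> M1 \<Otimes>\<^sub>M M2 \<rightarrow>\<^sub>M N"
proof -
  have "(\<lambda>p. (fst p, snd p)) \<in> M1 \<Otimes>\<^sub>M M2 \<rightarrow>\<^sub>M borel \<Otimes>\<^sub>M borel"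
    using assms(1,2) by (intro measurable_Pair measurable_compose[OF measurable_fst]
        measurable_compose[OF measurable_snd])
  then have "(\<lambda>p. (fst p, snd p)) \<in> M1 \<Otimes>\<^sub>M M2 \<rightarrow>\<^sub>M (borel :: ('a \<times> 'b) measure)"
    by (simp only: borel_prod)
  from measurable_compose[OF this assms(3)] show ?thesis by simp
qed

lemma measurable_pair_orthogonal_transformation:
  fixes T :: "'a::euclidean_space \<Rightarrow> 'a"
  assumes "orthogonal_transformation T"
  shows "(\<lambda>p. (T (fst p), T (snd p))) \<in> borel_measurable borel"
  unfolding borel_prod[symmetric]
  by (intro measurable_Pair measurable_compose[OF measurable_fst] measurable_compose[OF measurable_snd]
      orthogonal_transformation_borel assms)

lemma id_sphere_borel: "(\<lambda>x. x) \<in> \<sigma> \<rightarrow>\<^sub>M borel"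
  by (rule measurable_sphere_measureI) simp

lemma borel_fst: "fst \<in> borel_measurable (borel :: ('a \<times> 'a::euclidean_space) measure)"
  and borel_snd: "snd \<in> borel_measurable (borel :: ('a \<times> 'a::euclidean_space) measure)"
  by (intro borel_measurable_continuous_onI continuous_intros)+

text \<open>The measure lives on the ambient product and merely charges nothing outside
  \<open>frames\<close>. Invariance then means equal masses of ambient balls about points of
  \<open>frames\<close>, the form in which uniqueness is available.\<close>

definition frame_invariant :: "('a::euclidean_space \<times> 'a) measure \<Rightarrow> bool" where
  "frame_invariant \<mu> \<longleftrightarrow> sets \<mu> = sets borel \<and> finite_measure \<mu> \<and> (AE p in \<mu>. p \<in> frames) \<and>
    (\<forall>T h. orthogonal_transformation T \<longrightarrow> h \<in> borel_measurable borel \<longrightarrow>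
      (\<integral>\<^sup>+p. h (T (fst p), T (snd p)) \<partial>\<mu>) = (\<integral>\<^sup>+p. h p \<partial>\<mu>))"

lemma frame_invariant_integral:
  "frame_invariant \<mu> \<Longrightarrow> orthogonal_transformation T \<Longrightarrow> h \<in> borel_measurable borel \<Longrightarrow>
    (\<integral>\<^sup>+p. h (T (fst p), T (snd p)) \<partial>\<mu>) = (\<integral>\<^sup>+p. h p \<partial>\<mu>)"
  by (simp add: frame_invariant_def)

lemma compact_frames: "compact (frames :: ('a::euclidean_space \<times> 'a) set)"
proof -
  have eq: "frames = (sphere 0 1 \<times> sphere 0 1) \<inter> {p :: 'a \<times> 'a. fst p \<bullet> snd p = 0}"
    by (auto simp: frames_def)
  have "closed {p :: 'a \<times> 'a. fst p \<bullet> snd p = 0}"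
    by (intro closed_Collect_eq continuous_intros)
  then show ?thesis unfolding eq by (intro compact_Int_closed compact_Times) auto
qed

text \<open>The group acts transitively on \<open>frames\<close> and by isometries of the product,
  so some \<open>T\<close> carries one ball onto the other.\<close>

lemma frame_invariant_ball:
  assumes \<mu>: "frame_invariant \<mu>" and p: "p \<in> frames" and q: "q \<in> frames"
  shows "emeasure \<mu> (ball p r) = emeasure \<mu> (ball q r)"
proof -
  have sets: "sets \<mu> = sets borel" using \<mu> by (simp add: frame_invariant_def)
  obtain x v x' v' where [simp]: "p = (x, v)" "q = (x', v')" by (metis surj_pair)
  obtain T where T: "orthogonal_transformation T" "T x = x'" "T v = v'"
    using orthogonal_transformation_transitive_frames[of x v x' v'] p q by auto
  have "indicator (ball q r) (T (fst z), T (snd z)) = (indicator (ball p r) z :: ennreal)" for z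
    using T(2,3)[symmetric]
    by (cases z) (simp add: indicator_def dist_Pair_Pair orthogonal_transformation_dist[OF T(1)])
  then have "(\<integral>\<^sup>+z. indicator (ball p r) z \<partial>\<mu>) = (\<integral>\<^sup>+z. indicator (ball q r) (T (fst z), T (snd z)) \<partial>\<mu>)"
    by simp
  also have "\<dots> = (\<integral>\<^sup>+z. indicator (ball q r) z \<partial>\<mu>)"
    by (intro frame_invariant_integral[OF \<mu> T(1)] borel_measurable_indicator borel_open open_ball)
  finally show ?thesis by (simp add: sets)
qed

text \<open>Uniqueness up to a factor, multiplied out crosswise so that vanishing total masses are
  included.\<close>

lemma frame_invariant_unique:
  assumes \<mu>: "frame_invariant \<mu>" and \<nu>: "frame_invariant \<nu>" and h: "h \<in> borel_measurable borel"
  shows "emeasure \<mu> UNIV * (\<integral>\<^sup>+p. h p \<partial>\<nu>) = emeasure \<nu> UNIV * (\<integral>\<^sup>+p. h p \<partial>\<mu>)"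
proof (cases "emeasure \<mu> UNIV = 0")
  case True
  have sets: "sets \<mu> = sets borel" using \<mu> by (simp add: frame_invariant_def)
  then have "space \<mu> = UNIV" by (metis sets_eq_imp_space_eq space_borel)
  then have "AE p in \<mu>. h p = 0"
    using True sets by (intro AE_I[of _ _ UNIV]) auto
  then have "(\<integral>\<^sup>+p. h p \<partial>\<mu>) = 0" by (subst nn_integral_cong_AE[of h "\<lambda>_. 0"]) auto
  with True show ?thesis by simp
next
  case False
  have sets: "sets \<mu> = sets borel" "sets \<nu> = sets borel" using \<mu> \<nu> by (simp_all add: frame_invariant_def)
  have "scale_measure (emeasure \<mu> UNIV) \<nu> = scale_measure (emeasure \<nu> UNIV) \<mu>"
    using \<mu> \<nu> False compact_frames
    by (intro uniformly_distributed_proportional[where C = frames] frame_invariant_ball)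
      (auto simp: frame_invariant_def zero_less_iff_neq_zero)
  then have "integral\<^sup>N (scale_measure (emeasure \<mu> UNIV) \<nu>) h = integral\<^sup>N (scale_measure (emeasure \<nu>
      UNIV) \<mu>) h"
    by simp
  moreover have "h \<in> borel_measurable \<mu>" "h \<in> borel_measurable \<nu>"
    using h sets by (simp_all cong: measurable_cong_sets)
  ultimately show ?thesis by (simp add: nn_integral_scale_measure)
qed

text \<open>The image of an invariant measure under a map that commutes with the group is again
  invariant and has the same total mass, hence is the measure itself. No Jacobian of
  \<open>\<phi>\<close> enters.\<close>

lemma frame_invariant_map:
  fixes \<phi> :: "'a::euclidean_space \<times> 'a \<Rightarrow> 'a \<times> 'a"
  assumes \<mu>: "frame_invariant \<mu>" and \<phi>: "\<phi> \<in> borel_measurable borel"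
    and frames: "\<And>p. p \<in> frames \<Longrightarrow> \<phi> p \<in> frames"
    and equiv: "\<And>T p. orthogonal_transformation T \<Longrightarrow> \<phi> (T (fst p), T (snd p)) =
        (T (fst (\<phi> p)), T (snd (\<phi> p)))"
    and h: "h \<in> borel_measurable borel"
  shows "(\<integral>\<^sup>+p. h (\<phi> p) \<partial>\<mu>) = (\<integral>\<^sup>+p. h p \<partial>\<mu>)"
proof -
  have sets: "sets \<mu> = sets borel" using \<mu> by (simp add: frame_invariant_def)
  interpret finite_measure \<mu> using \<mu> by (simp add: frame_invariant_def)
  have space: "space \<mu> = UNIV" using sets by (metis sets_eq_imp_space_eq space_borel)
  have \<phi>\<mu>: "\<phi> \<in> \<mu> \<rightarrow>\<^sub>M borel" using \<phi> sets by (simp cong: measurable_cong_sets)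
  define \<nu> where "\<nu> = distr \<mu> borel \<phi>"
  have \<nu>: "(\<integral>\<^sup>+p. g p \<partial>\<nu>) = (\<integral>\<^sup>+p. g (\<phi> p) \<partial>\<mu>)" if "g \<in> borel_measurable borel" for g
    using \<phi>\<mu> that by (simp add: \<nu>_def nn_integral_distr)
  have "frame_invariant \<nu>"
    unfolding frame_invariant_def
  proof (intro conjI allI impI)
    show "sets \<nu> = sets borel" by (simp add: \<nu>_def)
    show "finite_measure \<nu>" unfolding \<nu>_def by (rule finite_measure_distr[OF \<phi>\<mu>])
    have "frames \<in> sets (borel :: ('a \<times> 'a) measure)" using compact_frames compact_imp_closed
        borel_closed by blast
    then show "AE p in \<nu>. p \<in> frames"
      unfolding \<nu>_def using \<mu> frames \<phi>\<mu>
      by (subst AE_distr_iff) (auto simp: frame_invariant_def)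
    fix T :: "'a \<Rightarrow> 'a" and g :: "'a \<times> 'a \<Rightarrow> ennreal"
    assume T: "orthogonal_transformation T" and g: "g \<in> borel_measurable borel"
    have gT: "(\<lambda>p. g (T (fst p), T (snd p))) \<in> borel_measurable borel"
      by (rule measurable_compose[OF measurable_pair_orthogonal_transformation[OF T] g])
    have g\<phi>: "(\<lambda>p. g (\<phi> p)) \<in> borel_measurable borel"
      by (rule measurable_compose[OF \<phi> g])
    show "(\<integral>\<^sup>+p. g (T (fst p), T (snd p)) \<partial>\<nu>) = (\<integral>\<^sup>+p. g p \<partial>\<nu>)"
      using frame_invariant_integral[OF \<mu> T g\<phi>]
      by (simp add: \<nu>[OF g] \<nu>[OF gT] equiv[OF T, symmetric])
  qed
  from frame_invariant_unique[OF \<mu> this h]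
  have *: "emeasure \<mu> UNIV * (\<integral>\<^sup>+p. h (\<phi> p) \<partial>\<mu>) = emeasure \<nu> UNIV * (\<integral>\<^sup>+p. h p \<partial>\<mu>)"
    by (simp add: \<nu>[OF h])
  have "emeasure \<nu> UNIV = emeasure \<mu> UNIV"
    unfolding \<nu>_def using \<phi>\<mu> space by (simp add: emeasure_distr)
  with * have *: "emeasure \<mu> UNIV * (\<integral>\<^sup>+p. h (\<phi> p) \<partial>\<mu>) = emeasure \<mu> UNIV * (\<integral>\<^sup>+p. h p \<partial>\<mu>)" by simp
  show ?thesis
  proof (cases "emeasure \<mu> UNIV = 0")
    case True
    then have "AE p in \<mu>. h p = 0 \<and> h (\<phi> p) = 0"
      using sets by (intro AE_I[of _ _ UNIV]) (auto simp: space)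
    then show ?thesis by (intro nn_integral_cong_AE) auto
  next
    case False
    then show ?thesis using * emeasure_finite[of UNIV] by (simp add: ennreal_mult_cancel_left)
  qed
qed

section \<open>Orthonormal pairs obtained from random vectors\<close>

definition perp :: "'a::real_inner \<Rightarrow> 'a \<Rightarrow> 'a" where
  "perp x z = z - (x \<bullet> z) *\<^sub>R x"

lemma orthogonal_transformation_perp:
  assumes "orthogonal_transformation T"
  shows "perp (T x) (T z) = T (perp x z)"
  using orthogonal_transformation_linear[OF assms] orthogonal_transformation_inner[OF assms]
  by (simp add: perp_def linear_diff linear_scale)

lemma inner_perp: "norm x = 1 \<Longrightarrow> x \<bullet> perp x z = 0"
  by (simp add: perp_def inner_diff_right norm_eq_1)

lemma norm_perp_sq: "norm x = 1 \<Longrightarrow> (norm (perp x z))\<^sup>2 = (norm z)\<^sup>2 - (x \<bullet> z)\<^sup>2"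
  by (simp add: perp_def power2_norm_eq_inner inner_diff_left inner_diff_right inner_commute
      norm_eq_1 power2_eq_square[of "x \<bullet> z"])

lemma borel_measurable_perp:
  "(\<lambda>p :: 'a \<times> 'a::euclidean_space. perp (fst p) (snd p)) \<in> borel_measurable borel"
  unfolding perp_def by (intro borel_measurable_continuous_onI continuous_intros)

text \<open>If the vector is parallel to the point, the second component is 0 and the result lies
  outside \<open>frames\<close>; the sets of admissible pairs used below exclude this.\<close>

definition gram_schmidt :: "'a::real_inner \<times> 'a \<Rightarrow> 'a \<times> 'a" where
  "gram_schmidt p = (fst p, sgn (perp (fst p) (snd p)))"

lemma borel_measurable_gram_schmidt:
  "gram_schmidt \<in> borel_measurable (borel :: ('a \<times> 'a::euclidean_space) measure)"
proof -
  have "gram_schmidt \<in> (borel :: ('a \<times> 'a) measure) \<rightarrow>\<^sub>M borel \<Otimes>\<^sub>M borel"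
    unfolding gram_schmidt_def
    by (intro measurable_Pair measurable_compose[OF borel_measurable_perp borel_measurable_sgn]
        borel_measurable_continuous_onI continuous_intros)
  then show ?thesis by (simp only: borel_prod)
qed

text \<open>The law of the orthonormal pair spanned by a random point \<open>x\<close> of the sphere and a random
  vector \<open>z\<close>.\<close>

definition frame_law :: "'a::euclidean_space measure \<Rightarrow> ('a \<times> 'a) set \<Rightarrow> ('a \<times> 'a) measure" where
  "frame_law N D = distr (density (\<sigma> \<Otimes>\<^sub>M N) (indicator D)) borel gram_schmidt"

text \<open>Covers two sources of vectors: Lebesgue measure on the cylinders behind the rim
  measures, and the surface measure itself with a prescribed set of inner products. Both lead to
  invariant measures on \<open>frames\<close>, which by uniqueness are multiples of a single
  one.\<close>

locale frame_source =
  fixes N :: "'a::euclidean_space measure" and D :: "('a \<times> 'a) set"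
  assumes sigma_finite_N: "sigma_finite_measure N"
    and id_N: "(\<lambda>x. x) \<in> N \<rightarrow>\<^sub>M borel"
    and N_invariant: "\<And>T h. orthogonal_transformation T \<Longrightarrow> h \<in> borel_measurable borel \<Longrightarrow>
      (\<integral>\<^sup>+x. h (T x) \<partial>N) = (\<integral>\<^sup>+x. h x \<partial>N)"
    and D_borel: "D \<in> sets borel"
    and D_invariant: "\<And>T x z. orthogonal_transformation T \<Longrightarrow> (T x, T z) \<in> D \<longleftrightarrow> (x, z) \<in> D"
    and D_perp: "\<And>x z. (x, z) \<in> D \<Longrightarrow> norm x = 1 \<Longrightarrow> perp x z \<noteq> 0"
    and D_finite: "(\<integral>\<^sup>+x. \<integral>\<^sup>+z. indicator D (x, z) \<partial>N \<partial>\<sigma>) < \<infinity>"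
begin

lemma measurable_pair: "f \<in> borel \<rightarrow>\<^sub>M K \<Longrightarrow> f \<in> \<sigma> \<Otimes>\<^sub>M N \<rightarrow>\<^sub>M K"
  by (rule measurable_pair_borelI[OF id_sphere_borel id_N])

lemma indicator_D: "(indicator D :: _ \<Rightarrow> ennreal) \<in> borel_measurable (\<sigma> \<Otimes>\<^sub>M N)"
  using D_borel by (intro measurable_pair borel_measurable_indicator)

lemma nn_integral_pair:
  assumes "f \<in> borel_measurable borel"
  shows "(\<integral>\<^sup>+p. f p \<partial>(\<sigma> \<Otimes>\<^sub>M N)) = (\<integral>\<^sup>+x. \<integral>\<^sup>+z. f (x, z) \<partial>N \<partial>\<sigma>)"
proof -
  interpret sigma_finite_measure N by (rule sigma_finite_N)
  show ?thesis using nn_integral_fst[OF measurable_pair[OF assms]] by simp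
qed

lemma nn_integral_frame_law_pair:
  assumes h: "h \<in> borel_measurable borel"
  shows "(\<integral>\<^sup>+p. h p \<partial>frame_law N D) = (\<integral>\<^sup>+p. indicator D p * h (gram_schmidt p) \<partial>(\<sigma> \<Otimes>\<^sub>M N))"
proof -
  have hg: "(\<lambda>p. h (gram_schmidt p)) \<in> borel_measurable borel"
    by (rule measurable_compose[OF borel_measurable_gram_schmidt h])
  have "gram_schmidt \<in> density (\<sigma> \<Otimes>\<^sub>M N) (indicator D) \<rightarrow>\<^sub>M borel"
    using measurable_pair[OF borel_measurable_gram_schmidt] by simp
  then show ?thesis
    unfolding frame_law_def using h hg
    by (simp add: nn_integral_distr nn_integral_density[OF indicator_D measurable_pair])
qed

lemma nn_integral_frame_law:
  assumes h: "h \<in> borel_measurable borel"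
  shows "(\<integral>\<^sup>+p. h p \<partial>frame_law N D) =
    (\<integral>\<^sup>+x. \<integral>\<^sup>+z. indicator D (x, z) * h (x, sgn (perp x z)) \<partial>N \<partial>\<sigma>)"
proof -
  have "(\<lambda>p. indicator D p * h (gram_schmidt p)) \<in> borel_measurable borel"
    using D_borel by (intro borel_measurable_times_ennreal borel_measurable_indicator
        measurable_compose[OF borel_measurable_gram_schmidt h])
  from nn_integral_pair[OF this] show ?thesis
    by (simp add: nn_integral_frame_law_pair[OF h] gram_schmidt_def)
qed

lemma emeasure_frame_law:
  "emeasure (frame_law N D) UNIV = (\<integral>\<^sup>+x. \<integral>\<^sup>+z. indicator D (x, z) \<partial>N \<partial>\<sigma>)"
  using nn_integral_frame_law[of "\<lambda>_. 1"] by (simp add: frame_law_def)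

lemma frame_invariant: "frame_invariant (frame_law N D)"
  unfolding frame_invariant_def
proof (intro conjI allI impI)
  show "sets (frame_law N D) = sets borel" by (simp add: frame_law_def)
  show "finite_measure (frame_law N D)"
    using D_finite emeasure_frame_law by (intro finite_measureI) (auto simp: frame_law_def)
  have F: "frames \<in> sets (borel :: ('a \<times> 'a) measure)" using compact_frames compact_imp_closed
      borel_closed by blast
  have g: "gram_schmidt \<in> density (\<sigma> \<Otimes>\<^sub>M N) (indicator D) \<rightarrow>\<^sub>M borel"
    using measurable_pair[OF borel_measurable_gram_schmidt] by simp
  show "AE p in frame_law N D. p \<in> frames"
    unfolding frame_law_def
    using F g indicator_D
    by (subst AE_distr_iff)
      (auto simp: AE_density frames_def gram_schmidt_def norm_sgn sgn_div_norm inner_perp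
          space_pair_measure
        indicator_eq_0_iff zero_less_iff_neq_zero D_perp intro!: AE_I2)
  fix T :: "'a \<Rightarrow> 'a" and h :: "'a \<times> 'a \<Rightarrow> ennreal"
  assume T: "orthogonal_transformation T" and h: "h \<in> borel_measurable borel"
  have hT: "(\<lambda>p. h (T (fst p), T (snd p))) \<in> borel_measurable borel"
    by (rule measurable_compose[OF measurable_pair_orthogonal_transformation[OF T] h])
  define k where "k p = indicator D p * h (gram_schmidt p)" for p
  have k: "k \<in> borel_measurable borel"
    using D_borel unfolding k_def by (intro borel_measurable_times_ennreal borel_measurable_indicator
        measurable_compose[OF borel_measurable_gram_schmidt h])
  define l where "l x = (\<integral>\<^sup>+z. k (x, z) \<partial>N)" for x
  interpret sigma_finite_measure N by (rule sigma_finite_N)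
  have kx: "(\<lambda>z. k (x, z)) \<in> borel_measurable borel" for x
    using k by (rule measurable_compose[rotated]) (simp add: borel_prod[symmetric])
  have l: "l \<in> borel_measurable borel"
    unfolding l_def
    using borel_measurable_nn_integral[of "\<lambda>x z. k (x, z)" borel] measurable_pair_borelI[OF _ id_N
        k, of borel]
    by simp
  \<comment> \<open>\<open>T\<close> passes through \<open>gram_schmidt\<close> and preserves
    \<open>D\<close>. The variable is then changed in \<open>z\<close> for fixed \<open>x\<close>,
    and afterwards in \<open>x\<close>.\<close>
  have "(\<integral>\<^sup>+p. h (T (fst p), T (snd p)) \<partial>frame_law N D) = (\<integral>\<^sup>+x. \<integral>\<^sup>+z. k (T x, T z) \<partial>N \<partial>\<sigma>)"
    using D_invariant[OF T]
    by (simp add: nn_integral_frame_law[OF hT] k_def gram_schmidt_def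
        orthogonal_transformation_perp[OF T]
        orthogonal_transformation_sgn[OF T] indicator_def)
  also have "\<dots> = (\<integral>\<^sup>+x. l (T x) \<partial>\<sigma>)"
    by (simp add: N_invariant[OF T kx] l_def)
  also have "\<dots> = (\<integral>\<^sup>+x. l x \<partial>\<sigma>)"
    by (rule nn_integral_sphere_orthogonal_transformation[OF T l])
  also have "\<dots> = (\<integral>\<^sup>+p. h p \<partial>frame_law N D)"
    by (simp add: nn_integral_frame_law[OF h] l_def k_def gram_schmidt_def)
  finally show "(\<integral>\<^sup>+p. h (T (fst p), T (snd p)) \<partial>frame_law N D) = (\<integral>\<^sup>+p. h p \<partial>frame_law N D)" .
qed

end

section \<open>Integration with respect to scaled measures\<close>

lemma scale_measure_eq_density: "scale_measure r M = density M (\<lambda>_. r)"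
  by (rule measure_eqI) (auto simp: emeasure_density nn_integral_cmult)

lemma integral_scale_measure:
  fixes f :: "'b \<Rightarrow> 'c::{banach, second_countable_topology}"
  assumes "f \<in> borel_measurable M" "0 < r"
  shows "integral\<^sup>L (scale_measure (ennreal r) M) f = r *\<^sub>R integral\<^sup>L M f"
  using assms unfolding scale_measure_eq_density by (subst integral_density) simp_all

lemma integrable_scale_measure:
  fixes f :: "'b \<Rightarrow> 'c::{banach, second_countable_topology}"
  assumes f: "f \<in> borel_measurable M" and r: "0 < r" and int: "integrable M f"
  shows "integrable (scale_measure (ennreal r) M) f"
  using assms unfolding scale_measure_eq_density by (subst integrable_density) simp_all

lemma frames_exist:
  fixes x :: "'a::euclidean_space"
  assumes "2 \<le> DIM('a)" "norm x = 1"
  obtains v where "(x, v) \<in> frames"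
proof -
  obtain y where "y \<noteq> 0" "orthogonal x y" using orthogonal_to_vector_exists[OF assms(1)] .
  then show ?thesis
    using assms(2) by (intro that[of "sgn y"]) (auto simp: frames_def norm_sgn sgn_div_norm
        orthogonal_def)
qed

section \<open>Rim means and the geodesic flow\<close>

text \<open>The region of integration in \<open>rim_measure\<close>, with the base point as a
  variable, so that it can serve as the set \<open>D\<close> of a
  \<open>frame_source\<close>.\<close>

definition cylinder :: "real \<Rightarrow> ('a::euclidean_space \<times> 'a) set" where
  "cylinder \<rho> = {(x, z). 0 \<le> x \<bullet> z \<and> x \<bullet> z \<le> 1 \<and> 0 < norm (perp x z) \<and> norm (perp x z) \<le> \<rho>}"

lemma borel_cylinder: "cylinder \<rho> \<in> sets borel"
proof -
  have perp: "continuous_on UNIV (\<lambda>p :: 'a \<times> 'a. perp (fst p) (snd p))"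
    unfolding perp_def by (intro continuous_intros)
  have eq: "cylinder \<rho> = {p :: 'a \<times> 'a. 0 \<le> fst p \<bullet> snd p} \<inter> {p. fst p \<bullet> snd p \<le> 1} \<inter>
    {p. 0 < norm (perp (fst p) (snd p))} \<inter> {p. norm (perp (fst p) (snd p)) \<le> \<rho>}"
    by (auto simp: cylinder_def)
  show ?thesis unfolding eq
    by (intro sets.Int borel_closed borel_open closed_Collect_le open_Collect_less continuous_intros
        continuous_on_norm perp)
qed

lemma cylinder_orthogonal_transformation:
  "orthogonal_transformation T \<Longrightarrow> (T x, T z) \<in> cylinder \<rho> \<longleftrightarrow> (x, z) \<in> cylinder \<rho>"
  by (simp add: cylinder_def orthogonal_transformation_perp orthogonal_transformation_norm
      orthogonal_transformation_inner del: zero_less_norm_iff)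

lemma borel_cylinder_section: "{z. (x, z) \<in> cylinder \<rho>} \<in> sets borel"
proof -
  have "(\<lambda>z. (x, z)) -` cylinder \<rho> \<inter> space borel \<in> sets borel"
    by (rule measurable_sets[OF _ borel_cylinder]) (simp add: borel_prod[symmetric])
  then show ?thesis by (simp add: vimage_def)
qed

text \<open>Taken at an arbitrary basis vector; rotation invariance makes the volume the same at
  every unit vector.\<close>

definition cylinder_volume :: "'a::euclidean_space itself \<Rightarrow> real \<Rightarrow> real" where
  "cylinder_volume _ \<rho> = measure lborel {z :: 'a. (SOME b. b \<in> Basis, z) \<in> cylinder \<rho>}"

text \<open>A rotation of \<open>x\<close> to the chosen basis vector carries one section onto the
  other, and sections are bounded, hence of finite volume. Positivity rests on a direction
  orthogonal to \<open>x\<close>, that is, on dimension at least 2: on a line,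
  \<open>perp x z\<close> is always 0.\<close>

lemma
  fixes x :: "'a::euclidean_space"
  assumes x: "norm x = 1"
  shows emeasure_cylinder_section:
      "emeasure lborel {z. (x, z) \<in> cylinder \<rho>} = ennreal (cylinder_volume TYPE('a) \<rho>)"
    and cylinder_volume_pos: "2 \<le> DIM('a) \<Longrightarrow> 0 < \<rho> \<Longrightarrow> 0 < cylinder_volume TYPE('a) \<rho>"
proof -
  define b :: 'a where "b = (SOME b. b \<in> Basis)"
  have "b \<in> Basis" unfolding b_def by (rule someI_ex) (use nonempty_Basis in blast)
  then have b: "norm b = 1" by simp
  have fin: "emeasure lborel {z. (y, z) \<in> cylinder \<rho>} < \<infinity>" if "norm y = 1" for y :: 'a
  proof -
    have "{z. (y, z) \<in> cylinder \<rho>} \<subseteq> cball 0 (1 + \<rho>)"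
    proof clarify
      fix z assume z: "(y, z) \<in> cylinder \<rho>"
      have "norm z = norm ((y \<bullet> z) *\<^sub>R y + perp y z)" by (simp add: perp_def)
      also have "\<dots> \<le> norm ((y \<bullet> z) *\<^sub>R y) + norm (perp y z)" by (rule norm_triangle_ineq)
      also have "\<dots> \<le> 1 + \<rho>" using z that by (auto simp: cylinder_def)
      finally show "z \<in> cball 0 (1 + \<rho>)" by simp
    qed
    then have "emeasure lborel {z. (y, z) \<in> cylinder \<rho>} \<le> emeasure lborel (cball (0::'a) (1 + \<rho>))"
      by (intro emeasure_mono) auto
    then show ?thesis using emeasure_lborel_cball_finite le_less_trans by blast
  qed
  obtain T :: "'a \<Rightarrow> 'a" where T: "orthogonal_transformation T" "T x = b"
    using orthogonal_transformation_transitive[of x b] x b by auto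
  have "emeasure lborel {z. (x, z) \<in> cylinder \<rho>} = (\<integral>\<^sup>+z. indicator {z. (b, z)
      \<in> cylinder \<rho>} (T z) \<partial>lborel)"
    using cylinder_orthogonal_transformation[OF T(1), of x _ \<rho>] T(2) borel_cylinder_section[of x \<rho>]
    by (simp add: nn_integral_indicator[symmetric] indicator_def del: nn_integral_indicator)
  also have "\<dots> = emeasure lborel {z. (b, z) \<in> cylinder \<rho>}"
    using nn_integral_lborel_orthogonal_transformation[OF T(1), of "indicator {z. (b, z) \<in> cylinder \<rho>}"]
      borel_cylinder_section[of b \<rho>] by (simp add: borel_measurable_indicator)
  also have "\<dots> = ennreal (cylinder_volume TYPE('a) \<rho>)"
    unfolding cylinder_volume_def b_def[symmetric]
    using fin[OF b] by (intro emeasure_eq_ennreal_measure) auto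
  finally show eq: "emeasure lborel {z. (x, z) \<in> cylinder \<rho>} = ennreal (cylinder_volume TYPE('a) \<rho>)" .
  assume dim: "2 \<le> DIM('a)" and \<rho>: "0 < \<rho>"
  obtain v where v: "(x, v) \<in> frames" using frames_exist[OF dim x] .
  define U where "U = {z. 0 < x \<bullet> z} \<inter> {z. x \<bullet> z < 1} \<inter> {z. 0 < norm (perp x z)} \<inter> {z. norm (perp x
      z) < \<rho>}"
  have "open U" unfolding U_def perp_def
    by (intro open_Int open_Collect_less continuous_intros)
  \<comment> \<open>The midpoint of the axis, moved by half the radius in an orthogonal direction,
    is an interior point of the section.\<close>
  moreover have "(1/2) *\<^sub>R x + (\<rho>/2) *\<^sub>R v \<in> U"
  proof -
    have "x \<bullet> ((1/2) *\<^sub>R x + (\<rho>/2) *\<^sub>R v) = 1/2"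
      using v by (simp add: frames_def inner_add_right norm_eq_1)
    moreover from this have "perp x ((1/2) *\<^sub>R x + (\<rho>/2) *\<^sub>R v) = (\<rho>/2) *\<^sub>R v"
      by (simp add: perp_def)
    ultimately show ?thesis using v \<rho> by (auto simp: U_def frames_def)
  qed
  ultimately obtain e where e: "0 < e" "ball ((1/2) *\<^sub>R x + (\<rho>/2) *\<^sub>R v) e \<subseteq> U"
    by (meson open_contains_ball)
  have "U \<subseteq> {z. (x, z) \<in> cylinder \<rho>}" by (auto simp: U_def cylinder_def)
  with e have "emeasure lborel (ball ((1/2) *\<^sub>R x + (\<rho>/2) *\<^sub>R v) e) \<le> emeasure lborel {z. (x, z)
      \<in> cylinder \<rho>}"
    using borel_cylinder_section[of x \<rho>] by (intro emeasure_mono) auto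
  moreover have "0 < emeasure lborel (ball ((1/2) *\<^sub>R x + (\<rho>/2) *\<^sub>R v) e)"
    using e by (simp add: emeasure_ball)
  ultimately have "0 < ennreal (cylinder_volume TYPE('a) \<rho>)" unfolding eq
      by (rule less_le_trans[rotated])
  then show "0 < cylinder_volume TYPE('a) \<rho>" by simp
qed

abbreviation sphere_area :: "'a::euclidean_space itself \<Rightarrow> real" where
  "sphere_area _ \<equiv> measure (\<sigma> :: 'a measure) (sphere 0 1)"

lemma cylinder_volume_pos':
  "2 \<le> DIM('a::euclidean_space) \<Longrightarrow> 0 < \<rho> \<Longrightarrow> 0 < cylinder_volume TYPE('a) \<rho>"
  using cylinder_volume_pos[of "SOME b :: 'a. b \<in> Basis"] by (simp add: some_in_eq norm_Basis)

lemma nn_integral_cylinder: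
  fixes x :: "'a::euclidean_space"
  assumes x: "norm x = 1"
  shows "(\<integral>\<^sup>+z. indicator (cylinder \<rho>) (x, z) \<partial>lborel) = ennreal (cylinder_volume TYPE('a) \<rho>)"
proof -
  have "(\<integral>\<^sup>+z. indicator (cylinder \<rho>) (x, z) \<partial>lborel) = (\<integral>\<^sup>+z. indicator {z. (x, z)
      \<in> cylinder \<rho>} z \<partial>lborel)"
    by (intro nn_integral_cong) (simp add: indicator_def)
  then show ?thesis
    using borel_cylinder_section[of x \<rho>] emeasure_cylinder_section[OF x] by simp
qed

lemma nn_integral_cylinder_sphere:
  "(\<integral>\<^sup>+x. \<integral>\<^sup>+z. indicator (cylinder \<rho>) (x :: 'a::euclidean_space, z) \<partial>lborel \<partial>\<sigma>) =
    ennreal (cylinder_volume TYPE('a) \<rho> * sphere_area TYPE('a))"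
proof -
  have "(\<integral>\<^sup>+x. \<integral>\<^sup>+z. indicator (cylinder \<rho>) (x :: 'a, z) \<partial>lborel \<partial>\<sigma>) =
    (\<integral>\<^sup>+x. ennreal (cylinder_volume TYPE('a) \<rho>) \<partial>(\<sigma> :: 'a measure))"
    by (intro nn_integral_cong) (simp add: nn_integral_cylinder)
  also have "\<dots> = ennreal (cylinder_volume TYPE('a) \<rho> * sphere_area TYPE('a))"
    by (simp add: sphere.emeasure_eq_measure ennreal_mult cylinder_volume_def)
  finally show ?thesis .
qed

interpretation cyl: frame_source "lborel :: 'a::euclidean_space measure" "cylinder \<rho>" for \<rho>
proof (rule frame_source.intro)
  show "sigma_finite_measure (lborel :: 'a measure)" by (rule lborel.sigma_finite_measure_axioms)
  show "perp x z \<noteq> 0" if "(x, z) \<in> cylinder \<rho>" "norm x = 1" for x z :: 'a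
    using that by (auto simp: cylinder_def)
qed (simp_all add: nn_integral_lborel_orthogonal_transformation borel_cylinder
    cylinder_orthogonal_transformation nn_integral_cylinder_sphere)

text \<open>The Liouville measure on the unit tangent bundle of the sphere, normalised to total mass one.\<close>

definition liouville :: "('a::euclidean_space \<times> 'a) measure" where
  "liouville = scale_measure (ennreal (1 / (cylinder_volume TYPE('a) 1 * sphere_area TYPE('a))))
    (frame_law lborel (cylinder 1))"

lemma sets_liouville [simp, measurable_cong]: "sets liouville = sets borel"
  by (simp add: liouville_def frame_law_def)

lemma space_liouville [simp]: "space liouville = UNIV"
  by (simp add: liouville_def frame_law_def space_scale_measure)

lemma emeasure_frame_law_cylinder:
  "emeasure (frame_law lborel (cylinder \<rho>) :: ('a::euclidean_space \<times> 'a) measure) UNIV =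
    ennreal (cylinder_volume TYPE('a) \<rho> * sphere_area TYPE('a))"
  by (simp add: cyl.emeasure_frame_law nn_integral_cylinder_sphere)

lemma emeasure_liouville:
  assumes "2 \<le> DIM('a::euclidean_space)"
  shows "emeasure (liouville :: ('a \<times> 'a) measure) UNIV = 1"
proof -
  have "0 < cylinder_volume TYPE('a) 1 * sphere_area TYPE('a)"
    using cylinder_volume_pos'[OF assms] measure_sphere_pos[where 'a = 'a] by simp
  then show ?thesis
    by (auto simp: liouville_def emeasure_frame_law_cylinder ennreal_mult[symmetric] zero_less_mult_iff)
qed

lemma frame_invariant_scale_measure:
  fixes \<mu> :: "('a::euclidean_space \<times> 'a) measure"
  assumes "frame_invariant \<mu>" "r \<noteq> \<infinity>"
  shows "frame_invariant (scale_measure r \<mu>)"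
proof (cases "r = 0")
  case True
  then show ?thesis using assms
    by (auto simp: frame_invariant_def intro!: finite_measureI AE_I[of _ _ UNIV])
next
  case False
  interpret finite_measure \<mu> using assms by (simp add: frame_invariant_def)
  have s: "sets \<mu> = sets borel" using assms by (simp add: frame_invariant_def)
  have "finite_measure (scale_measure r \<mu>)"
    using assms(2) by (intro finite_measureI) (simp add: space_scale_measure ennreal_mult_eq_top_iff)
  moreover have "integral\<^sup>N (scale_measure r \<mu>) h = r * integral\<^sup>N \<mu> h" if "h \<in> borel_measurable borel"
    for h :: "_ \<Rightarrow> ennreal"
    using that s by (intro nn_integral_scale_measure) (simp cong: measurable_cong_sets)
  moreover have "(\<lambda>p. h (T (fst p), T (snd p))) \<in> borel_measurable borel"
    if "orthogonal_transformation T" "h \<in> borel_measurable borel" for T :: "'a \<Rightarrow> 'a" and h ::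
        "_ \<Rightarrow> ennreal"
    using measurable_compose[OF measurable_pair_orthogonal_transformation that(2)] that(1) by blast
  moreover have "AE p in scale_measure r \<mu>. p \<in> frames"
    using assms(1) False by (simp add: AE_scale_measure_iff frame_invariant_def zero_less_iff_neq_zero)
  ultimately show ?thesis
    using assms(1) s by (simp add: frame_invariant_def)
qed

lemma frame_invariant_liouville: "frame_invariant liouville"
  unfolding liouville_def by (intro frame_invariant_scale_measure cyl.frame_invariant) simp

text \<open>As \<open>liouville\<close> has total mass one, the factor in the uniqueness statement
  is the total mass of \<open>\<mu>\<close>. All averages over orthonormal pairs are thus referred
  to one measure.\<close>

lemma frame_invariant_eq_liouville:
  fixes \<mu> :: "('a::euclidean_space \<times> 'a) measure"
  assumes "2 \<le> DIM('a)" "frame_invariant \<mu>"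
  shows "\<mu> = scale_measure (emeasure \<mu> UNIV) liouville"
proof (rule measure_eqI)
  show "sets \<mu> = sets (scale_measure (emeasure \<mu> UNIV) liouville)"
    using assms(2) by (simp add: frame_invariant_def)
  fix A assume "A \<in> sets \<mu>"
  then show "emeasure \<mu> A = emeasure (scale_measure (emeasure \<mu> UNIV) liouville) A"
    using frame_invariant_unique[OF assms(2) frame_invariant_liouville, of "indicator A"] assms(2)
    by (simp add: emeasure_liouville[OF assms(1)] frame_invariant_def)
qed

lemma distr_liouville:
  fixes \<phi> :: "'a::euclidean_space \<times> 'a \<Rightarrow> 'a \<times> 'a"
  assumes \<phi>: "\<phi> \<in> borel_measurable borel"
    and "\<And>p. p \<in> frames \<Longrightarrow> \<phi> p \<in> frames"
    and "\<And>T p. orthogonal_transformation T \<Longrightarrow> \<phi> (T (fst p), T (snd p)) = (T (fst (\<phi> p)), T (snd (\<phi> p)))"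
  shows "distr liouville borel \<phi> = liouville"
proof (rule measure_eqI)
  fix A assume "A \<in> sets (distr liouville borel \<phi>)"
  then have A: "A \<in> sets borel" by simp
  have m: "\<phi> \<in> liouville \<rightarrow>\<^sub>M borel" using \<phi> by (simp cong: measurable_cong_sets)
  have "emeasure (distr liouville borel \<phi>) A = (\<integral>\<^sup>+p. indicator A (\<phi> p) \<partial>liouville)"
    using A m by (simp add: nn_integral_indicator[symmetric] nn_integral_distr del:
        nn_integral_indicator)
  also have "\<dots> = (\<integral>\<^sup>+p. indicator A p \<partial>liouville)"
    by (rule frame_invariant_map[OF frame_invariant_liouville assms borel_measurable_indicator[OF A]])
  finally show "emeasure (distr liouville borel \<phi>) A = emeasure liouville A" using A by simp
qed simp

text \<open>The geodesic flow: position and velocity after an arc whose cosine is \<open>c\<close>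
  and whose sine is \<open>s\<close>. Keeping both as arguments allows
  \<open>c = cos \<theta>\<close> as well as \<open>c = t\<close>,
  \<open>s = sqrt (1 - t\<^sup>2)\<close>.\<close>

definition geodesic :: "real \<Rightarrow> real \<Rightarrow> 'a::real_vector \<times> 'a \<Rightarrow> 'a \<times> 'a" where
  "geodesic c s p = (c *\<^sub>R fst p + s *\<^sub>R snd p, (- s) *\<^sub>R fst p + c *\<^sub>R snd p)"

definition flip :: "'a::real_vector \<times> 'a \<Rightarrow> 'a \<times> 'a" where
  "flip p = (fst p, - snd p)"

lemma borel_geodesic: "geodesic c s \<in> borel_measurable (borel :: ('a::euclidean_space \<times> 'a) measure)"
  unfolding geodesic_def by (intro borel_measurable_continuous_onI continuous_intros)

lemma borel_flip: "flip \<in> borel_measurable (borel :: ('a::euclidean_space \<times> 'a) measure)"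
  unfolding flip_def by (intro borel_measurable_continuous_onI continuous_intros)

lemma geodesic_frames:
  assumes cs: "c\<^sup>2 + s\<^sup>2 = 1" and p: "p \<in> frames"
  shows "geodesic c s p \<in> frames"
proof -
  obtain x v where xv: "p = (x, v)" by (metis surj_pair)
  then have xv': "x \<bullet> x = 1" "v \<bullet> v = 1" "x \<bullet> v = 0" "v \<bullet> x = 0"
    using p by (auto simp: frames_def norm_eq_1 inner_commute)
  show ?thesis
    using cs by (simp add: xv geodesic_def frames_def norm_eq_1 inner_add_left inner_add_right
        inner_diff_left inner_diff_right xv' power2_eq_square)
qed

text \<open>Liouville's theorem. The flow forms linear combinations of the two entries of a pair, so
  it commutes with every linear map that acts on both entries at once.\<close>

lemma distr_liouville_geodesic: "c\<^sup>2 + s\<^sup>2 = 1 \<Longrightarrow> distr liouville borel (geodesic c s) = liouville"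
  by (intro distr_liouville borel_geodesic geodesic_frames)
    (simp_all add: geodesic_def orthogonal_transformation_linear linear_add linear_scale linear_diff)

lemma distr_liouville_flip: "distr liouville borel flip = liouville"
  by (intro distr_liouville borel_flip)
    (auto simp: flip_def frames_def orthogonal_transformation_linear linear_neg)

lemma geodesic_add:
  "geodesic c s (geodesic c' s' p) = geodesic (c * c' - s * s') (s * c' + c * s') p"
  by (simp add: geodesic_def algebra_simps)

section \<open>Square-integrable functions\<close>

text \<open>Unlike \<open>L2_inner\<close> and \<open>L2_norm\<close>, these are not normalised by the total mass.\<close>

definition L2_dot :: "'b measure \<Rightarrow> ('b \<Rightarrow> complex) \<Rightarrow> ('b \<Rightarrow> complex) \<Rightarrow> complex" where
  "L2_dot M f g = (LINT x|M. f x * cnj (g x))"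

definition L2_sq :: "'b measure \<Rightarrow> ('b \<Rightarrow> complex) \<Rightarrow> real" where
  "L2_sq M f = (LINT x|M. (cmod (f x))\<^sup>2)"

lemma L2_measurable: "f \<in> L2 M \<Longrightarrow> f \<in> borel_measurable M"
  by (simp add: L2_def)

lemma L2_integrable_sq: "f \<in> L2 M \<Longrightarrow> integrable M (\<lambda>x. (cmod (f x))\<^sup>2)"
  by (simp add: L2_def)

lemma L2_iff_nn: "f \<in> L2 M \<longleftrightarrow> f \<in> borel_measurable M \<and> (\<integral>\<^sup>+x. ennreal ((cmod (f x))\<^sup>2) \<partial>M) < \<infinity>"
  by (auto simp: L2_def integrable_iff_bounded)

lemma nn_integral_L2_sq:
  "f \<in> L2 M \<Longrightarrow> (\<integral>\<^sup>+x. ennreal ((cmod (f x))\<^sup>2) \<partial>M) = ennreal (L2_sq M f)"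
  unfolding L2_sq_def by (rule nn_integral_eq_integral[OF L2_integrable_sq]) auto

lemma norm_add_sq_le: "(norm (a + b))\<^sup>2 \<le> 2 * (norm a)\<^sup>2 + 2 * (norm b)\<^sup>2"
  for a b :: "'b::real_normed_vector"
proof -
  have "(norm (a + b))\<^sup>2 \<le> (norm a + norm b)\<^sup>2" by (intro power_mono norm_triangle_ineq) auto
  also have "\<dots> \<le> 2 * (norm a)\<^sup>2 + 2 * (norm b)\<^sup>2"
    using sum_squares_bound[of "norm a" "norm b"] by (simp add: power2_sum)
  finally show ?thesis .
qed

lemma L2_zero [simp]: "(\<lambda>_. 0) \<in> L2 M"
  by (simp add: L2_def)

lemma L2_add: "f \<in> L2 M \<Longrightarrow> g \<in> L2 M \<Longrightarrow> (\<lambda>x. f x + g x) \<in> L2 M"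
proof -
  assume fg: "f \<in> L2 M" "g \<in> L2 M"
  have "integrable M (\<lambda>x. 2 * (cmod (f x))\<^sup>2 + 2 * (cmod (g x))\<^sup>2)"
    using fg by (auto simp: L2_def)
  then have "integrable M (\<lambda>x. (cmod (f x + g x))\<^sup>2)"
  proof (rule Bochner_Integration.integrable_bound)
    show "(\<lambda>x. (cmod (f x + g x))\<^sup>2) \<in> borel_measurable M" using fg by (auto simp: L2_def)
    show "AE x in M. norm ((cmod (f x + g x))\<^sup>2) \<le> norm (2 * (cmod (f x))\<^sup>2 + 2 * (cmod (g x))\<^sup>2)"
      using norm_add_sq_le[of "f x" "g x" for x] by (intro AE_I2) simp
  qed
  with fg show ?thesis by (auto simp: L2_def)
qed

lemma L2_scale: "f \<in> L2 M \<Longrightarrow> (\<lambda>x. c * f x) \<in> L2 M"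
  by (auto simp: L2_def norm_mult power_mult_distrib)

lemma L2_diff: "f \<in> L2 M \<Longrightarrow> g \<in> L2 M \<Longrightarrow> (\<lambda>x. f x - g x) \<in> L2 M"
  using L2_add[of f M "\<lambda>x. (-1) * g x"] L2_scale[of g M "-1"] by simp

lemma borel_measurable_cnj: "f \<in> borel_measurable M \<Longrightarrow> (\<lambda>x. cnj (f x)) \<in> borel_measurable M"
  by (rule measurable_compose[of f M borel cnj]) (auto intro!: borel_measurable_continuous_onI
      continuous_intros)

lemma L2_cnj: "f \<in> L2 M \<Longrightarrow> (\<lambda>x. cnj (f x)) \<in> L2 M"
  by (auto simp: L2_def borel_measurable_cnj)

lemma L2_sum: "(\<And>i. i \<in> I \<Longrightarrow> f i \<in> L2 M) \<Longrightarrow> (\<lambda>x. \<Sum>i\<in>I. f i x) \<in> L2 M"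
  by (induction I rule: infinite_finite_induct) (auto intro!: L2_add)

lemma L2_integrable_mult:
  assumes "f \<in> L2 M" "g \<in> L2 M"
  shows "integrable M (\<lambda>x. f x * g x)"
proof (rule Bochner_Integration.integrable_bound)
  show "integrable M (\<lambda>x. (cmod (f x))\<^sup>2 + (cmod (g x))\<^sup>2)"
    using assms by (auto simp: L2_def)
  show "(\<lambda>x. f x * g x) \<in> borel_measurable M" using assms by (auto simp: L2_def)
  have "cmod (f x) * cmod (g x) \<le> (cmod (f x))\<^sup>2 + (cmod (g x))\<^sup>2" for x
  proof -
    have "0 \<le> cmod (f x) * cmod (g x)" by simp
    then show ?thesis using sum_squares_bound[of "cmod (f x)" "cmod (g x)"] by linarith
  qed
  then show "AE x in M. norm (f x * g x) \<le> norm ((cmod (f x))\<^sup>2 + (cmod (g x))\<^sup>2)"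
    by (auto simp: norm_mult)
qed

lemma L2_integrable_dot: "f \<in> L2 M \<Longrightarrow> g \<in> L2 M \<Longrightarrow> integrable M (\<lambda>x. f x * cnj (g x))"
  by (intro L2_integrable_mult L2_cnj)

lemma L2_sq_nonneg [simp]: "0 \<le> L2_sq M f"
  by (simp add: L2_sq_def)

lemma L2_dot_self: "L2_dot M f f = complex_of_real (L2_sq M f)"
  unfolding L2_dot_def L2_sq_def by (simp add: complex_norm_square[symmetric] flip: of_real_power)

lemma L2_dot_commute: "L2_dot M g f = cnj (L2_dot M f g)"
  by (simp add: L2_dot_def mult.commute flip: Bochner_Integration.integral_cnj)

lemma L2_dot_add: "f \<in> L2 M \<Longrightarrow> g \<in> L2 M \<Longrightarrow> h \<in> L2 M \<Longrightarrow>
    L2_dot M (\<lambda>x. f x + g x) h = L2_dot M f h + L2_dot M g h"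
  by (simp add: L2_dot_def distrib_right L2_integrable_dot)

lemma L2_dot_diff: "f \<in> L2 M \<Longrightarrow> g \<in> L2 M \<Longrightarrow> h \<in> L2 M \<Longrightarrow>
    L2_dot M (\<lambda>x. f x - g x) h = L2_dot M f h - L2_dot M g h"
  by (simp add: L2_dot_def left_diff_distrib L2_integrable_dot)

lemma L2_dot_scale: "L2_dot M (\<lambda>x. c * f x) h = c * L2_dot M f h"
  by (simp add: L2_dot_def mult.assoc)

lemma L2_dot_sum: "(\<And>i. i \<in> I \<Longrightarrow> f i \<in> L2 M) \<Longrightarrow> h \<in> L2 M \<Longrightarrow>
    L2_dot M (\<lambda>x. \<Sum>i\<in>I. c i * f i x) h = (\<Sum>i\<in>I. c i * L2_dot M (f i) h)"
proof (induction I rule: infinite_finite_induct)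
  case (insert i I)
  have "L2_dot M (\<lambda>x. c i * f i x + (\<Sum>i\<in>I. c i * f i x)) h =
      L2_dot M (\<lambda>x. c i * f i x) h + L2_dot M (\<lambda>x. \<Sum>i\<in>I. c i * f i x) h"
    using insert by (intro L2_dot_add L2_scale L2_sum) auto
  with insert show ?case by (simp add: L2_dot_scale)
qed (auto simp: L2_dot_def)

lemma L2_dot_cong_AE:
  assumes "f \<in> borel_measurable M" "f' \<in> borel_measurable M" "h \<in> borel_measurable M" "AE x in M. f
      x = f' x"
  shows "L2_dot M f h = L2_dot M f' h"
  unfolding L2_dot_def using assms by (intro integral_cong_AE borel_measurable_times
      borel_measurable_cnj) auto

lemma L2_sq_eq_0: "f \<in> L2 M \<Longrightarrow> L2_sq M f = 0 \<longleftrightarrow> (AE x in M. f x = 0)"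
  unfolding L2_sq_def by (subst integral_nonneg_eq_0_iff_AE) (auto simp: L2_integrable_sq)

lemma L2_cauchy_schwarz:
  assumes f: "f \<in> L2 M" and g: "g \<in> L2 M"
  shows "(cmod (L2_dot M f g))\<^sup>2 \<le> L2_sq M f * L2_sq M g"
proof -
  have [measurable]: "f \<in> borel_measurable M" "g \<in> borel_measurable M" using f g by (auto simp: L2_def)
  have "ennreal (cmod (L2_dot M f g)) \<le> (\<integral>\<^sup>+x. norm (f x * cnj (g x)) \<partial>M)"
    unfolding L2_dot_def by (rule integral_norm_bound_ennreal[OF L2_integrable_dot[OF f g]])
  also have "\<dots> = (\<integral>\<^sup>+x. ennreal (cmod (f x)) * ennreal (cmod (g x)) \<partial>M)"
    by (simp add: norm_mult ennreal_mult)
  finally have "(ennreal (cmod (L2_dot M f g)))\<^sup>2 \<le> (\<integral>\<^sup>+x. ennreal (cmod (f x)) * ennreal (cmod (g x))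
      \<partial>M)\<^sup>2"
    by (rule power_mono) simp
  also have "\<dots> \<le> (\<integral>\<^sup>+x. (ennreal (cmod (f x)))\<^sup>2 \<partial>M) * (\<integral>\<^sup>+x. (ennreal (cmod (g x)))\<^sup>2 \<partial>M)"
    by (rule Cauchy_Schwarz_nn_integral) measurable
  also have "\<dots> = ennreal (L2_sq M f * L2_sq M g)"
    by (simp add: ennreal_power nn_integral_L2_sq f g ennreal_mult)
  finally show ?thesis by (simp add: ennreal_power)
qed

lemma L2_dot_le: "f \<in> L2 M \<Longrightarrow> g \<in> L2 M \<Longrightarrow> cmod (L2_dot M f g) \<le> sqrt (L2_sq M f) * sqrt (L2_sq M g)"
  using L2_cauchy_schwarz[of f M g] by (metis real_le_rsqrt real_sqrt_mult)

lemma L2_sq_scale: "L2_sq M (\<lambda>x. c * f x) = (cmod c)\<^sup>2 * L2_sq M f"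
  by (simp add: L2_sq_def norm_mult power_mult_distrib)

lemma L2_sq_diff:
  assumes f: "f \<in> L2 M" and g: "g \<in> L2 M"
  shows "L2_sq M (\<lambda>x. f x - g x) = L2_sq M f + L2_sq M g - 2 * Re (L2_dot M f g)"
proof -
  have fg: "(\<lambda>x. f x - g x) \<in> L2 M" by (rule L2_diff[OF f g])
  have 1: "L2_dot M h (\<lambda>x. f x - g x) = L2_dot M h f - L2_dot M h g" if "h \<in> L2 M" for h
    using L2_dot_diff[OF f g that] by (metis L2_dot_commute complex_cnj_diff)
  have "complex_of_real (L2_sq M (\<lambda>x. f x - g x)) = L2_dot M f f - L2_dot M f g - (L2_dot M g f -
      L2_dot M g g)"
    by (simp only: L2_dot_self[symmetric] L2_dot_diff[OF f g fg] 1 f g)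
  also have "\<dots> = complex_of_real (L2_sq M f + L2_sq M g - 2 * Re (L2_dot M f g))"
    by (simp add: L2_dot_commute[of M g f] L2_dot_self complex_eq_iff)
  finally show ?thesis by (simp only: of_real_eq_iff)
qed

section \<open>Orthonormal families and Bessel's inequality\<close>

definition orthonormal_family :: "'b measure \<Rightarrow> nat \<Rightarrow> (nat \<Rightarrow> 'b \<Rightarrow> complex) \<Rightarrow> bool" where
  "orthonormal_family M d e \<longleftrightarrow> (\<forall>i<d. e i \<in> L2 M) \<and>
    (\<forall>i<d. \<forall>j<d. L2_dot M (e i) (e j) = (if i = j then 1 else 0))"

text \<open>Partial sums make the induction possible: \<open>e k\<close> is orthogonal to the part
  already subtracted, so removing its component lowers the square norm by the squared modulus of the
  coefficient.\<close>

lemma bessel_identity: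
  assumes e: "orthonormal_family M d e" and g: "g \<in> L2 M" and "k \<le> d"
  shows "L2_sq M (\<lambda>x. g x - (\<Sum>i<k. L2_dot M g (e i) * e i x)) = L2_sq M g - (\<Sum>i<k. (cmod (L2_dot M g
      (e i)))\<^sup>2)"
  using \<open>k \<le> d\<close>
proof (induction k)
  case (Suc k)
  define S where "S = (\<lambda>x. \<Sum>i<k. L2_dot M g (e i) * e i x)"
  define c where "c = L2_dot M g (e k)"
  have e_L2: "e i \<in> L2 M" if "i < d" for i using e that by (auto simp: orthonormal_family_def)
  have S: "S \<in> L2 M" unfolding S_def using Suc.prems by (intro L2_sum L2_scale e_L2) auto
  have ek: "e k \<in> L2 M" using Suc.prems by (intro e_L2) auto
  have "L2_dot M S (e k) = (\<Sum>i<k. L2_dot M g (e i) * L2_dot M (e i) (e k))"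
    unfolding S_def using Suc.prems by (intro L2_dot_sum e_L2) auto
  also have "\<dots> = 0" using e Suc.prems by (intro sum.neutral) (auto simp: orthonormal_family_def)
  finally have Sk: "L2_dot M (\<lambda>x. g x - S x) (e k) = c"
    by (simp add: L2_dot_diff g S ek c_def)
  have "L2_dot M (\<lambda>x. g x - S x) (\<lambda>x. c * e k x) = cnj c * c"
    using Sk by (metis L2_dot_commute L2_dot_scale complex_cnj_mult)
  then have "Re (L2_dot M (\<lambda>x. g x - S x) (\<lambda>x. c * e k x)) = (cmod c)\<^sup>2"
    by (metis Re_complex_of_real complex_norm_square mult.commute)
  moreover have "L2_sq M (e k) = 1"
    using e Suc.prems L2_dot_self[of M "e k"] by (simp add: orthonormal_family_def)
  ultimately have "L2_sq M (\<lambda>x. (g x - S x) - c * e k x) = L2_sq M (\<lambda>x. g x - S x) - (cmod c)\<^sup>2"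
    by (simp add: L2_sq_diff L2_diff g S L2_scale ek L2_sq_scale)
  with Suc show ?case by (simp add: S_def c_def algebra_simps)
qed simp

lemma bessel:
  assumes "orthonormal_family M d e" "g \<in> L2 M"
  shows "(\<Sum>i<d. (cmod (L2_dot M g (e i)))\<^sup>2) \<le> L2_sq M g"
  using bessel_identity[OF assms order_refl] L2_sq_nonneg[of M "\<lambda>x. g x - (\<Sum>i<d. L2_dot M g (e i) *
      e i x)"]
  by simp

section \<open>Rim means as integrals over the unit tangent bundle\<close>

text \<open>A function in \<open>L2\<close> of the sphere is measurable only relative to the sphere.
  The extension is Borel on the whole space and can be composed with maps on the ambient product
  such as \<open>geodesic_point\<close>.\<close>

definition zero_extension :: "('a::real_normed_vector \<Rightarrow> complex) \<Rightarrow> 'a \<Rightarrow> complex" where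
  "zero_extension f x = (if x \<in> sphere 0 1 then f x else 0)"

lemma zero_extension_eq [simp]: "norm x = 1 \<Longrightarrow> zero_extension f x = f x"
  by (simp add: zero_extension_def)

lemma borel_zero_extension:
  fixes f :: "'a::euclidean_space \<Rightarrow> complex"
  assumes "f \<in> borel_measurable \<sigma>"
  shows "zero_extension f \<in> borel_measurable borel"
proof -
  have "f \<in> borel_measurable (restrict_space borel (sphere 0 1))"
    using assms by (simp cong: measurable_cong_sets)
  then have "(\<lambda>x. if x \<in> sphere 0 1 then f x else 0) \<in> borel_measurable borel"
    by (subst (asm) measurable_restrict_space_iff) auto
  then show ?thesis by (simp add: zero_extension_def[abs_def])
qed

lemma L2_sphere_borel:
  fixes f :: "'a::euclidean_space \<Rightarrow> complex"
  assumes "f \<in> L2 \<sigma>"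
  shows "zero_extension f \<in> borel_measurable borel"
  using assms by (intro borel_zero_extension L2_measurable)

text \<open>For a pair in \<open>frames\<close>, the end of the arc along which the inner product
  with the starting point has dropped to \<open>t\<close>.\<close>

definition geodesic_point :: "real \<Rightarrow> 'a::real_vector \<times> 'a \<Rightarrow> 'a" where
  "geodesic_point t p = t *\<^sub>R fst p + sqrt (1 - t\<^sup>2) *\<^sub>R snd p"

lemma geodesic_point_eq: "geodesic_point t p = fst (geodesic t (sqrt (1 - t\<^sup>2)) p)"
  by (simp add: geodesic_point_def geodesic_def)

lemma borel_geodesic_point: "geodesic_point t \<in> borel_measurable (borel ::
    ('a::euclidean_space \<times> 'a) measure)"
  unfolding geodesic_point_def by (intro borel_measurable_continuous_onI continuous_intros)

lemma sq_le_1_if_abs_less: "\<bar>t\<bar> < 1 \<Longrightarrow> t\<^sup>2 < 1" for t :: real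
  by (simp add: abs_square_less_1)

text \<open>Ensures that the map by which \<open>rim_measure\<close> is defined takes its values in
  the rim.\<close>

lemma geodesic_point_gram_schmidt:
  fixes x :: "'a::euclidean_space"
  assumes t: "\<bar>t\<bar> < 1" and x: "norm x = 1" and z: "perp x z \<noteq> 0"
  shows "geodesic_point t (gram_schmidt (x, z)) \<in> rim x t"
proof -
  define v where "v = sgn (perp x z)"
  have v: "x \<bullet> v = 0" "norm v = 1"
    using z x by (simp_all add: v_def norm_sgn sgn_div_norm inner_perp)
  have "(x, v) \<in> frames" using x v by (simp add: frames_def)
  moreover have "t\<^sup>2 + (sqrt (1 - t\<^sup>2))\<^sup>2 = 1" using sq_le_1_if_abs_less[OF t] by simp
  ultimately have "norm (geodesic_point t (x, v)) = 1"
    using geodesic_frames[of t "sqrt (1 - t\<^sup>2)" "(x, v)"] by (auto simp: geodesic_point_eq frames_def)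
  moreover have "x \<bullet> geodesic_point t (x, v) = t"
    using x v by (simp add: geodesic_point_def inner_add_right norm_eq_1)
  ultimately show ?thesis by (simp add: rim_def gram_schmidt_def v_def)
qed

abbreviation rad :: "real \<Rightarrow> real" where
  "rad t \<equiv> sqrt (1 - t\<^sup>2)"

abbreviation rim_cylinder_volume :: "'a::euclidean_space itself \<Rightarrow> real \<Rightarrow> real" where
  "rim_cylinder_volume a t \<equiv> cylinder_volume a (rad t)"

abbreviation section_map :: "real \<Rightarrow> 'a::euclidean_space \<Rightarrow> 'a \<Rightarrow> 'a" where
  "section_map t x z \<equiv> geodesic_point t (gram_schmidt (x, z))"

context
  fixes t :: real
  assumes t: "\<bar>t\<bar> < 1" and dim: "2 \<le> DIM('a::euclidean_space)"
begin

lemma rad_pos: "0 < rad t"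
  using sq_le_1_if_abs_less[OF t] by simp

lemma rad_sq: "t\<^sup>2 + (rad t)\<^sup>2 = 1"
  using sq_le_1_if_abs_less[OF t] by simp

lemma cylinder_volume_rad_pos: "0 < rim_cylinder_volume TYPE('a) t"
  by (rule cylinder_volume_pos'[OF dim rad_pos])

context
  fixes x :: 'a
  assumes x: "norm x = 1"
begin

lemma rim_measure_eq:
  "rim_measure x t = scale_measure (ennreal (real (DIM('a) - 1) / rad t))
    (distr (restrict_space lborel {z. (x, z) \<in> cylinder (rad t)}) (restrict_space borel (rim x t))
        (section_map t x))"
  unfolding rim_measure_def Let_def
  by (simp add: cylinder_def perp_def gram_schmidt_def geodesic_point_def)

lemma section_map_borel: "section_map t x \<in> borel_measurable borel"
proof -
  have "(\<lambda>z. (x, z)) \<in> borel \<rightarrow>\<^sub>M (borel :: ('a \<times> 'a) measure)" by (simp add: borel_prod[symmetric])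
  from measurable_compose[OF measurable_compose[OF this borel_measurable_gram_schmidt]
      borel_geodesic_point]
  show ?thesis .
qed

lemma section_map_measurable:
  "section_map t x \<in> restrict_space lborel {z. (x, z) \<in> cylinder (rad t)} \<rightarrow>\<^sub>M restrict_space borel
      (rim x t)"
  using section_map_borel geodesic_point_gram_schmidt[OF t x]
  by (intro measurable_restrict_space2 measurable_restrict_space1)
    (auto simp: space_restrict_space cylinder_def)

lemma integral_rim_measure:
  assumes f: "f \<in> borel_measurable borel"
  shows "(LINT y|rim_measure x t. f y) = (real (DIM('a) - 1) / rad t) *\<^sub>R
    (LINT z|lborel. indicator (cylinder (rad t)) (x, z) *\<^sub>R (f (section_map t x z) :: complex))"
proof -
  have f': "f \<in> borel_measurable (restrict_space borel (rim x t))" using f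
      by (rule measurable_restrict_space1)
  have "(LINT y|rim_measure x t. f y) = (real (DIM('a) - 1) / rad t) *\<^sub>R
    (LINT z|restrict_space lborel {z. (x, z) \<in> cylinder (rad t)}. f (section_map t x z))"
    unfolding rim_measure_eq using f' dim rad_pos
    by (subst integral_scale_measure) (auto simp: integral_distr[OF section_map_measurable])
  also have "(LINT z|restrict_space lborel {z. (x, z) \<in> cylinder (rad t)}. f (section_map t x z)) =
      (LINT z|lborel. indicator (cylinder (rad t)) (x, z) *\<^sub>R f (section_map t x z))"
    using borel_cylinder_section[of x "rad t"]
    by (subst integral_restrict_space) (auto simp: indicator_def intro!:
        Bochner_Integration.integral_cong)
  finally show ?thesis .
qed

lemma measure_rim_measure: "measure (rim_measure x t) (rim x t) = real (DIM('a) - 1) / rad t *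
    (rim_cylinder_volume TYPE('a) t)"
proof -
  have rim: "rim x t \<in> sets (restrict_space borel (rim x t))"
    using sets.top[of "restrict_space borel (rim x t)"] by (simp add: space_restrict_space)
  have "emeasure (distr (restrict_space lborel {z. (x, z) \<in> cylinder (rad t)}) (restrict_space borel
      (rim x t)) (section_map t x)) (rim x t)
      = emeasure (restrict_space lborel {z. (x, z) \<in> cylinder (rad t)}) {z. (x, z) \<in> cylinder (rad t)}"
    using geodesic_point_gram_schmidt[OF t x]
    by (subst emeasure_distr[OF section_map_measurable rim])
      (auto intro!: arg_cong2[where f = emeasure] simp: space_restrict_space cylinder_def)
  also have "\<dots> = ennreal (rim_cylinder_volume TYPE('a) t)"
    using borel_cylinder_section[of x "rad t"] emeasure_cylinder_section[OF x]
    by (simp add: emeasure_restrict_space)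
  finally have "emeasure (rim_measure x t) (rim x t) = ennreal (real (DIM('a) - 1) / rad t *
      (rim_cylinder_volume TYPE('a) t))"
    unfolding rim_measure_eq emeasure_scale_measure using rad_pos cylinder_volume_rad_pos
    by (subst ennreal_mult) (auto simp del: emeasure_distr)
  then show ?thesis using rad_pos cylinder_volume_rad_pos by (simp add: measure_def)
qed

text \<open>The factor in front of the rim measure cancels against its total mass; what remains is
  an average over the cylinder section.\<close>

lemma rim_mean_eq:
  assumes f: "zero_extension f \<in> borel_measurable borel"
  shows "rim_mean t f x = (1 / rim_cylinder_volume TYPE('a) t) *\<^sub>R
    (LINT z|lborel. indicator (cylinder (rad t)) (x, z) *\<^sub>R zero_extension f (section_map t x z))"
proof -
  have "(LINT y|rim_measure x t. f y) = (LINT y|rim_measure x t. zero_extension f y)"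
    by (intro Bochner_Integration.integral_cong)
      (auto simp: rim_measure_eq space_scale_measure space_restrict_space rim_def)
  then show ?thesis
    using dim rad_pos cylinder_volume_rad_pos
    by (simp add: rim_mean_def integral_rim_measure[OF f] measure_rim_measure scaleR_conv_of_real)
qed

end

text \<open>Cylinders of different radii yield multiples of one measure, which puts the rim means
  for all \<open>t\<close> on a common footing.\<close>

lemma frame_law_cylinder_eq:
  "frame_law lborel (cylinder (rad t)) = scale_measure (ennreal (rim_cylinder_volume TYPE('a) t * sphere_area
      TYPE('a))) (liouville :: ('a \<times> 'a) measure)"
  using frame_invariant_eq_liouville[OF dim cyl.frame_invariant] by (simp add:
      emeasure_frame_law_cylinder)

text \<open>Unfolds \<open>frame_law\<close> as the image of a density and so supplies the
  integrability over the product that Fubini's theorem requires.\<close>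

lemma integrable_liouville_imp_pair:
  fixes H :: "'a \<times> 'a \<Rightarrow> complex"
  assumes H: "H \<in> borel_measurable borel" and int: "integrable liouville H"
  shows "integrable (\<sigma> \<Otimes>\<^sub>M lborel) (\<lambda>p. indicator (cylinder (rad t)) p *\<^sub>R H (gram_schmidt p))" (is
      "integrable ?P ?h")
    and "(LINT p|(\<sigma> \<Otimes>\<^sub>M lborel). indicator (cylinder (rad t)) p *\<^sub>R H (gram_schmidt p)) =
      (rim_cylinder_volume TYPE('a) t * sphere_area TYPE('a)) *\<^sub>R (LINT p|liouville. H p)"
proof -
  have pos: "0 < rim_cylinder_volume TYPE('a) t * sphere_area TYPE('a)" using cylinder_volume_rad_pos measure_sphere_pos[where
      'a = 'a] by simp
  have HL: "H \<in> borel_measurable liouville" using H by (simp cong: measurable_cong_sets)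
  define Q where "Q = density ?P (\<lambda>p. ennreal (indicator (cylinder (rad t)) p))"
  have Q: "frame_law lborel (cylinder (rad t)) = distr Q borel gram_schmidt"
    by (simp add: frame_law_def Q_def ennreal_indicator)
  have ind: "(indicator (cylinder (rad t)) :: _ \<Rightarrow> real) \<in> borel_measurable ?P"
    using borel_cylinder by (intro cyl.measurable_pair borel_measurable_indicator)
  have gs: "gram_schmidt \<in> Q \<rightarrow>\<^sub>M borel"
    using cyl.measurable_pair[OF borel_measurable_gram_schmidt] by (simp add: Q_def)
  have Hgs: "(\<lambda>p. H (gram_schmidt p)) \<in> borel_measurable ?P"
    by (intro cyl.measurable_pair measurable_compose[OF borel_measurable_gram_schmidt H])
  have "integrable (distr Q borel gram_schmidt) H"
    unfolding Q[symmetric] frame_law_cylinder_eq by (rule integrable_scale_measure[OF HL pos int])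
  then have "integrable Q (\<lambda>p. H (gram_schmidt p))" by (rule integrable_distr[OF gs])
  then show "integrable ?P ?h"
    unfolding Q_def by (subst (asm) integrable_density[OF Hgs ind]) auto
  have "(rim_cylinder_volume TYPE('a) t * sphere_area TYPE('a)) *\<^sub>R (LINT p|liouville. H p) =
      integral\<^sup>L (distr Q borel gram_schmidt) H"
    unfolding Q[symmetric] frame_law_cylinder_eq by (rule integral_scale_measure[OF HL pos, symmetric])
  also have "\<dots> = integral\<^sup>L Q (\<lambda>p. H (gram_schmidt p))" by (rule integral_distr[OF gs H])
  also have "\<dots> = integral\<^sup>L ?P ?h" unfolding Q_def by (rule integral_density[OF Hgs ind]) auto
  finally show "integral\<^sup>L ?P ?h = (rim_cylinder_volume TYPE('a) t * sphere_area TYPE('a)) *\<^sub>R (LINT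
      p|liouville. H p)" by simp
qed

text \<open>Fubini's theorem in \<open>x\<close> and \<open>z\<close>. For fixed \<open>x\<close>
  the inner integral is the rim mean times the volume of the cylinder section; up to the area of the
  sphere, that volume is also the factor between the frame law and the Liouville measure.\<close>

lemma rim_mean_integral:
  fixes f g :: "'a \<Rightarrow> complex"
  assumes f: "zero_extension f \<in> borel_measurable borel" and g: "g \<in> borel_measurable borel"
    and int: "integrable liouville (\<lambda>p. zero_extension f (geodesic_point t p) * g (fst p))"
  shows "(LINT x|sphere_measure. rim_mean t f x * g x) =
    sphere_area TYPE('a) *\<^sub>R (LINT p|liouville. zero_extension f (geodesic_point t p) * g (fst p))"
proof -
  define H where "H p = zero_extension f (geodesic_point t p) * g (fst p)" for p
  have H: "H \<in> borel_measurable borel"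
    unfolding H_def by (intro borel_measurable_times measurable_compose[OF borel_geodesic_point f]
        measurable_compose[OF borel_fst g])
  interpret pair_sigma_finite "\<sigma> :: 'a measure" "lborel :: 'a measure" ..
  have int: "integrable liouville H" using int by (simp add: H_def[abs_def])
  have sect: "(LINT z|lborel. indicator (cylinder (rad t)) (x, z) *\<^sub>R H (gram_schmidt (x, z))) =
      rim_cylinder_volume TYPE('a) t *\<^sub>R (rim_mean t f x * g x)"
    if x: "norm x = 1" for x
  proof -
    have "(LINT z|lborel. indicator (cylinder (rad t)) (x, z) *\<^sub>R H (gram_schmidt (x, z))) =
      (LINT z|lborel. (indicator (cylinder (rad t)) (x, z) *\<^sub>R zero_extension f (geodesic_point t
          (gram_schmidt (x, z)))) * g x)"
      by (intro Bochner_Integration.integral_cong) (auto simp: H_def gram_schmidt_def)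
    also have "\<dots> = (LINT z|lborel. indicator (cylinder (rad t)) (x, z) *\<^sub>R zero_extension f
        (geodesic_point t (gram_schmidt (x, z)))) * g x"
      by (rule integral_mult_left_zero)
    finally show ?thesis
      using cylinder_volume_rad_pos by (simp add: rim_mean_eq[OF x f])
  qed
  have "(LINT p|(\<sigma> \<Otimes>\<^sub>M lborel). indicator (cylinder (rad t)) p *\<^sub>R H (gram_schmidt p)) =
      (LINT x|sphere_measure. LINT z|lborel. indicator (cylinder (rad t)) (x, z) *\<^sub>R H (gram_schmidt
          (x, z)))"
    using integral_fst'[OF integrable_liouville_imp_pair(1)[OF H int]] by simp
  also have "\<dots> = (LINT x|sphere_measure. rim_cylinder_volume TYPE('a) t *\<^sub>R (rim_mean t f x * g x))"
    by (intro Bochner_Integration.integral_cong) (auto simp: sect)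
  finally have "rim_cylinder_volume TYPE('a) t *\<^sub>R (LINT x|sphere_measure. rim_mean t f x * g x) =
      rim_cylinder_volume TYPE('a) t *\<^sub>R (sphere_area TYPE('a) *\<^sub>R (LINT p|liouville. H p))"
    using integrable_liouville_imp_pair(2)[OF H int] by (auto simp flip: scaleR_scaleR)
  then show ?thesis using cylinder_volume_rad_pos by (simp add: H_def flip: scaleR_scaleR)
qed

end

text \<open>The vectors \<open>z\<close> admissible for a base point fill a section of volume
  \<open>c\<close>, whatever the base point; so the base point is uniformly distributed.\<close>

lemma distr_liouville_fst:
  assumes dim: "2 \<le> DIM('a::euclidean_space)"
  shows "distr liouville borel fst = scale_measure (ennreal (1 / sphere_area TYPE('a)))
    (distr (\<sigma> :: 'a measure) borel (\<lambda>x. x))"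
proof (rule measure_eqI)
  fix A assume "A \<in> sets (distr liouville borel (fst :: 'a \<times> 'a \<Rightarrow> 'a))"
  then have A: "A \<in> sets (borel :: 'a measure)" by simp
  have id_sphere_borel: "(\<lambda>x. x) \<in> \<sigma> \<rightarrow>\<^sub>M (borel :: 'a measure)" by (rule measurable_sphere_measureI) simp
  define c where "c = cylinder_volume TYPE('a) 1"
  have c: "0 < c" unfolding c_def by (rule cylinder_volume_pos'[OF dim]) simp
  have iA: "(\<lambda>p. indicator A (fst p) :: ennreal) \<in> borel_measurable (borel :: ('a \<times> 'a) measure)"
    by (rule measurable_compose[OF borel_fst borel_measurable_indicator[OF A]])
  have fl: "fst \<in> liouville \<rightarrow>\<^sub>M (borel :: 'a measure)" using borel_fst by (simp cong:
      measurable_cong_sets)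
  have "emeasure (distr liouville borel fst) A = (\<integral>\<^sup>+p. indicator A (fst p) \<partial>liouville)"
    using A fl by (simp add: nn_integral_indicator[symmetric] nn_integral_distr del:
        nn_integral_indicator)
  also have "\<dots> = ennreal (1 / (c * sphere_area TYPE('a))) * (\<integral>\<^sup>+p. indicator A (fst p) \<partial>frame_law
      lborel (cylinder 1))"
    unfolding liouville_def c_def using iA by (subst nn_integral_scale_measure) (auto
        simp: frame_law_def)
  also have "(\<integral>\<^sup>+p. indicator A (fst p) \<partial>frame_law lborel (cylinder 1)) =
      (\<integral>\<^sup>+x. \<integral>\<^sup>+z. indicator (cylinder 1) (x, z) * indicator A x \<partial>lborel \<partial>\<sigma>)"
    by (subst cyl.nn_integral_frame_law[OF iA]) simp
  also have "\<dots> = (\<integral>\<^sup>+x. ennreal c * indicator A x \<partial>\<sigma>)"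
  proof (rule nn_integral_cong)
    fix x :: 'a assume "x \<in> space \<sigma>"
    then have x: "norm x = 1" by simp
    have "(\<lambda>z. indicator (cylinder 1) (x, z) :: ennreal) = indicator {z. (x, z) \<in> cylinder 1}"
      by (auto simp: indicator_def fun_eq_iff)
    then have "(\<lambda>z. indicator (cylinder 1) (x, z) :: ennreal) \<in> borel_measurable lborel"
      using borel_cylinder_section[of x 1] by simp
    then show "(\<integral>\<^sup>+z. indicator (cylinder 1) (x, z) * indicator A x \<partial>lborel) = ennreal c * indicator A x"
      by (simp add: nn_integral_multc nn_integral_cylinder[OF x] c_def)
  qed
  also have "\<dots> = ennreal c * emeasure (distr \<sigma> borel (\<lambda>x. x)) A"
    using A id_sphere_borel by (simp add: nn_integral_cmult nn_integral_distr[OF id_sphere_borel, of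
        "indicator A", symmetric] measurable_sphere_measureI borel_measurable_indicator)
  finally show "emeasure (distr liouville borel fst) A =
    emeasure (scale_measure (ennreal (1 / sphere_area TYPE('a))) (distr \<sigma> borel (\<lambda>x. x))) A"
    using c measure_sphere_pos[where 'a = 'a]
    by (simp add: mult.assoc[symmetric] ennreal_mult[symmetric] del: emeasure_distr)
qed simp

lemma geodesic_marginal:
  assumes cs: "c\<^sup>2 + s\<^sup>2 = 1"
  shows "distr liouville borel (\<lambda>p. fst (geodesic c s p)) = distr liouville borel (fst ::
      'a \<times> 'a \<Rightarrow> 'a::euclidean_space)"
proof -
  have "geodesic c s \<in> liouville \<rightarrow>\<^sub>M (borel :: ('a \<times> 'a) measure)" using borel_geodesic
      by (simp cong: measurable_cong_sets)
  from distr_distr[OF borel_fst this] show ?thesis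
    by (simp add: distr_liouville_geodesic[OF cs] comp_def)
qed

lemma borel_fst_geodesic: "(\<lambda>p. fst (geodesic c s p)) \<in> borel_measurable (borel ::
    ('a \<times> 'a::euclidean_space) measure)"
  by (rule measurable_compose[OF borel_geodesic borel_fst])

text \<open>The mean square difference of \<open>f\<close> between the ends of a random arc of
  length \<open>\<theta>\<close>. Defining it by the flow makes sense for every real
  \<open>\<theta>\<close> and lets arcs be concatenated; its expression by rim means is available
  for \<open>\<theta>\<close> strictly between 0 and \<open>pi\<close>.\<close>

definition energy :: "('a::euclidean_space \<Rightarrow> complex) \<Rightarrow> real \<Rightarrow> real" where
  "energy f \<theta> = L2_sq liouville (\<lambda>p. zero_extension f (fst p) - zero_extension f (fst (geodesic (cos
      \<theta>) (sin \<theta>) p)))"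

context
  assumes dim: "2 \<le> DIM('a::euclidean_space)"
begin

lemma nn_integral_liouville_marginal:
  fixes q :: "'a \<times> 'a \<Rightarrow> 'a"
  assumes q: "q \<in> borel_measurable borel" and marg: "distr liouville borel q = distr liouville borel fst"
    and h: "h \<in> borel_measurable borel"
  shows "(\<integral>\<^sup>+p. h (q p) \<partial>liouville) = ennreal (1 / sphere_area TYPE('a)) * (\<integral>\<^sup>+x. h x \<partial>\<sigma>)"
proof -
  have q': "q \<in> liouville \<rightarrow>\<^sub>M borel" using q by (simp cong: measurable_cong_sets)
  have id_sphere_borel: "(\<lambda>x. x) \<in> \<sigma> \<rightarrow>\<^sub>M (borel :: 'a measure)" by (rule measurable_sphere_measureI) simp
  have "(\<integral>\<^sup>+p. h (q p) \<partial>liouville) = (\<integral>\<^sup>+x. h x \<partial>distr liouville borel q)"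
    using q' h by (subst nn_integral_distr) auto
  also have "\<dots> = ennreal (1 / sphere_area TYPE('a)) * (\<integral>\<^sup>+x. h x \<partial>distr \<sigma> borel (\<lambda>x. x))"
    unfolding marg distr_liouville_fst[OF dim] using h by (subst nn_integral_scale_measure) auto
  also have "(\<integral>\<^sup>+x. h x \<partial>distr \<sigma> borel (\<lambda>x. x)) = (\<integral>\<^sup>+x. h x \<partial>\<sigma>)"
    using id_sphere_borel h by (subst nn_integral_distr) auto
  finally show ?thesis .
qed

text \<open>Used with either end of an arc as \<open>q\<close>: both ends have the same marginal, so
  the norm of \<open>f\<close> may be computed at each of them.\<close>

lemma
  fixes q :: "'a \<times> 'a \<Rightarrow> 'a"
  assumes q: "q \<in> borel_measurable borel" and marg: "distr liouville borel q = distr liouville borel fst"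
    and f: "f \<in> L2 \<sigma>"
  shows L2_liouville: "(\<lambda>p. zero_extension f (q p)) \<in> L2 liouville"
    and L2_sq_liouville: "L2_sq liouville (\<lambda>p. zero_extension f (q p)) =
        L2_sq \<sigma> f / sphere_area TYPE('a)"
proof -
  have F: "zero_extension f \<in> borel_measurable borel" by (rule L2_sphere_borel[OF f])
  have "(\<integral>\<^sup>+p. ennreal ((cmod (zero_extension f (q p)))\<^sup>2) \<partial>liouville) =
      ennreal (1 / sphere_area TYPE('a)) * (\<integral>\<^sup>+x. ennreal ((cmod (zero_extension f x))\<^sup>2) \<partial>\<sigma>)"
    using F by (intro nn_integral_liouville_marginal q marg) auto
  also have "(\<integral>\<^sup>+x. ennreal ((cmod (zero_extension f x))\<^sup>2) \<partial>\<sigma>) = (\<integral>\<^sup>+x. ennreal ((cmod (f x))\<^sup>2) \<partial>\<sigma>)"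
    by (intro nn_integral_cong) simp
  also have "ennreal (1 / sphere_area TYPE('a)) * \<dots> = ennreal (L2_sq \<sigma> f / sphere_area TYPE('a))"
    by (simp add: nn_integral_L2_sq[OF f] ennreal_mult[symmetric])
  finally have nn: "(\<integral>\<^sup>+p. ennreal ((cmod (zero_extension f (q p)))\<^sup>2) \<partial>liouville) =
    ennreal (L2_sq \<sigma> f / sphere_area TYPE('a))" .
  have "(\<lambda>p. zero_extension f (q p)) \<in> borel_measurable liouville"
    using measurable_compose[OF q F] by (simp cong: measurable_cong_sets)
  with nn show L: "(\<lambda>p. zero_extension f (q p)) \<in> L2 liouville" by (simp add: L2_iff_nn)
  have "ennreal (L2_sq liouville (\<lambda>p. zero_extension f (q p))) = ennreal (L2_sq \<sigma> f / sphere_area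
      TYPE('a))"
    using nn nn_integral_L2_sq[OF L] by simp
  then show "L2_sq liouville (\<lambda>p. zero_extension f (q p)) = L2_sq \<sigma> f / sphere_area TYPE('a)"
    by simp
qed

lemma L2_liouville_fst: "f \<in> L2 (\<sigma> :: 'a measure) \<Longrightarrow> (\<lambda>p. zero_extension f (fst p)) \<in> L2 liouville"
  by (rule L2_liouville[OF borel_fst refl])

lemma L2_liouville_geodesic:
  "c\<^sup>2 + s\<^sup>2 = 1 \<Longrightarrow> f \<in> L2 (\<sigma> :: 'a measure) \<Longrightarrow> (\<lambda>p. zero_extension f (fst (geodesic c s p))) \<in> L2 liouville"
  by (rule L2_liouville[OF borel_fst_geodesic geodesic_marginal])

lemma L2_liouville_geodesic_point:
  "\<bar>t\<bar> < 1 \<Longrightarrow> f \<in> L2 (\<sigma> :: 'a measure) \<Longrightarrow> (\<lambda>p. zero_extension f (geodesic_point t p)) \<in> L2 liouville"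
  unfolding geodesic_point_eq by (rule L2_liouville_geodesic[OF rad_sq[OF _ dim]])

lemma borel_measurable_rim_mean:
  fixes f :: "'a \<Rightarrow> complex"
  assumes t: "\<bar>t\<bar> < 1" and f: "f \<in> L2 \<sigma>"
  shows "rim_mean t f \<in> borel_measurable \<sigma>"
proof -
  have F: "zero_extension f \<in> borel_measurable borel" by (rule L2_sphere_borel[OF f])
  have "(\<lambda>p. indicator (cylinder (rad t)) p *\<^sub>R zero_extension f (geodesic_point t (gram_schmidt p)))
      \<in> borel_measurable (\<sigma> \<Otimes>\<^sub>M lborel)"
    using borel_cylinder by (intro cyl.measurable_pair borel_measurable_scaleR borel_measurable_indicator
        measurable_compose[OF borel_measurable_gram_schmidt] measurable_compose[OF
            borel_geodesic_point] F)
  then have "(\<lambda>x. LINT z|lborel. indicator (cylinder (rad t)) (x, z) *\<^sub>R zero_extension f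
      (section_map t x z)) \<in> borel_measurable \<sigma>"
    by (intro lborel.borel_measurable_lebesgue_integral) (simp add: case_prod_unfold)
  then have "(\<lambda>x. (1 / rim_cylinder_volume TYPE('a) t) *\<^sub>R (LINT z|lborel. indicator (cylinder (rad t)) (x, z)
      *\<^sub>R zero_extension f (section_map t x z)))
      \<in> borel_measurable \<sigma>"
    by (intro borel_measurable_scaleR) auto
  then show ?thesis
    by (rule measurable_cong[THEN iffD2, rotated]) (simp add: rim_mean_eq[OF t dim _ F])
qed

text \<open>Jensen's inequality for the average over the cylinder section, derived from
  Cauchy-Schwarz.\<close>

lemma cmod_rim_mean_sq_le:
  fixes f :: "'a \<Rightarrow> complex"
  assumes t: "\<bar>t\<bar> < 1" and f: "f \<in> L2 \<sigma>" and x: "norm x = 1"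
  shows "ennreal ((cmod (rim_mean t f x))\<^sup>2) \<le> ennreal (1 / rim_cylinder_volume TYPE('a) t) *
    (\<integral>\<^sup>+z. indicator (cylinder (rad t)) (x, z) * ennreal ((cmod (zero_extension f (section_map t x
        z)))\<^sup>2) \<partial>lborel)"
proof -
  have F: "zero_extension f \<in> borel_measurable borel" by (rule L2_sphere_borel[OF f])
  define c where "c = rim_cylinder_volume TYPE('a) t"
  have c: "0 < c" unfolding c_def by (rule cylinder_volume_rad_pos[OF t dim])
  define I where "I z = (indicator {z. (x, z) \<in> cylinder (rad t)} z :: real)" for z
  define G where "G z = zero_extension f (section_map t x z)" for z
  have I: "I \<in> borel_measurable lborel" unfolding I_def using borel_cylinder_section[of x "rad t"]
      by simp
  have G: "G \<in> borel_measurable lborel"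
    using measurable_compose[OF section_map_borel[OF t dim x] F] by (simp add: G_def[abs_def])
  have eq: "rim_mean t f x = (1 / c) *\<^sub>R (LINT z|lborel. I z *\<^sub>R G z)"
    unfolding rim_mean_eq[OF t dim x F] c_def I_def G_def by (simp add: indicator_def)
  have int_I: "(\<integral>\<^sup>+z. ennreal (I z) \<partial>lborel) = ennreal c"
    using emeasure_cylinder_section[OF x, of "rad t"] borel_cylinder_section[of x "rad t"]
    by (simp add: I_def c_def ennreal_indicator)
  \<comment> \<open>\<open>I\<close> is idempotent, which gives each half of Cauchy-Schwarz its own
    factor \<open>I\<close>. If the integrand is not integrable, the Bochner integral is 0 and the
    bound is trivial.\<close>
  have "ennreal (cmod (LINT z|lborel. I z *\<^sub>R G z)) \<le> (\<integral>\<^sup>+z. ennreal (I z) * ennreal (I z * cmod (G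
      z)) \<partial>lborel)"
  proof (cases "integrable lborel (\<lambda>z. I z *\<^sub>R G z)")
    case True
    have "ennreal (norm (I z *\<^sub>R G z)) = ennreal (I z) * ennreal (I z * cmod (G z))" for z
      by (simp add: I_def indicator_def)
    then show ?thesis using integral_norm_bound_ennreal[OF True] by simp
  qed (simp add: not_integrable_integral_eq)
  then have "(ennreal (cmod (LINT z|lborel. I z *\<^sub>R G z)))\<^sup>2 \<le> (\<integral>\<^sup>+z. ennreal (I z) * ennreal (I z *
      cmod (G z)) \<partial>lborel)\<^sup>2"
    by (rule power_mono) simp
  also have "\<dots> \<le> (\<integral>\<^sup>+z. (ennreal (I z))\<^sup>2 \<partial>lborel) * (\<integral>\<^sup>+z. (ennreal (I z * cmod (G z)))\<^sup>2 \<partial>lborel)"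
    using I G by (intro Cauchy_Schwarz_nn_integral) auto
  also have "(\<lambda>z. (ennreal (I z))\<^sup>2) = (\<lambda>z. ennreal (I z))" by (auto simp: I_def indicator_def)
  also have "(\<lambda>z. (ennreal (I z * cmod (G z)))\<^sup>2) =
      (\<lambda>z. indicator (cylinder (rad t)) (x, z) * ennreal ((cmod (zero_extension f (section_map t x
          z)))\<^sup>2))"
    by (auto simp: I_def G_def indicator_def ennreal_power)
  finally have le: "ennreal ((cmod (LINT z|lborel. I z *\<^sub>R G z))\<^sup>2) \<le> ennreal c *
      (\<integral>\<^sup>+z. indicator (cylinder (rad t)) (x, z) * ennreal ((cmod (zero_extension f (section_map t x
          z)))\<^sup>2) \<partial>lborel)"
    unfolding int_I by (simp add: ennreal_power)
  have "ennreal ((cmod (rim_mean t f x))\<^sup>2) = ennreal ((1 / c)\<^sup>2) * ennreal ((cmod (LINT z|lborel. I z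
      *\<^sub>R G z))\<^sup>2)"
    using c by (simp add: eq power_mult_distrib power_divide flip: ennreal_mult)
  also have "\<dots> \<le> ennreal ((1 / c)\<^sup>2) * (ennreal c *
      (\<integral>\<^sup>+z. indicator (cylinder (rad t)) (x, z) * ennreal ((cmod (zero_extension f (section_map t x
          z)))\<^sup>2) \<partial>lborel))"
    by (intro mult_left_mono le) simp
  also have "\<dots> = ennreal (1 / c) *
      (\<integral>\<^sup>+z. indicator (cylinder (rad t)) (x, z) * ennreal ((cmod (zero_extension f (section_map t x
          z)))\<^sup>2) \<partial>lborel)"
    using c by (simp add: mult.assoc[symmetric] power2_eq_square flip: ennreal_mult)
  finally show ?thesis unfolding c_def .
qed

text \<open>Integrating the pointwise bound over \<open>x\<close> produces an integral over the
  frame law, hence the square integral of \<open>f\<close> at the end of a random arc.\<close>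

lemma L2_rim_mean:
  fixes f :: "'a \<Rightarrow> complex"
  assumes t: "\<bar>t\<bar> < 1" and f: "f \<in> L2 \<sigma>"
  shows "rim_mean t f \<in> L2 \<sigma>"
proof -
  have F: "zero_extension f \<in> borel_measurable borel" by (rule L2_sphere_borel[OF f])
  define h where "h p = ennreal ((cmod (zero_extension f (geodesic_point t p)))\<^sup>2)" for p
  have h: "h \<in> borel_measurable borel"
    unfolding h_def by (rule measurable_compose[OF borel_geodesic_point]) (use F in simp)
  define c where "c = rim_cylinder_volume TYPE('a) t"
  have "(\<integral>\<^sup>+x. ennreal ((cmod (rim_mean t f x))\<^sup>2) \<partial>\<sigma>) \<le>
      (\<integral>\<^sup>+x. ennreal (1 / c) * (\<integral>\<^sup>+z. indicator (cylinder (rad t)) (x, z) * h (x, sgn (perp x z))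
          \<partial>lborel) \<partial>\<sigma>)"
    using cmod_rim_mean_sq_le[OF t f]
    by (intro nn_integral_mono) (simp add: c_def h_def gram_schmidt_def)
  also have "\<dots> = ennreal (1 / c) * (\<integral>\<^sup>+p. h p \<partial>frame_law lborel (cylinder (rad t)))"
  proof -
    have "(\<lambda>p. indicator (cylinder (rad t)) p * h (gram_schmidt p)) \<in> borel_measurable (\<sigma> \<Otimes>\<^sub>M lborel)"
      using borel_cylinder h by (intro cyl.measurable_pair borel_measurable_times_ennreal
          borel_measurable_indicator measurable_compose[OF borel_measurable_gram_schmidt])
    then have "(\<lambda>x. \<integral>\<^sup>+z. indicator (cylinder (rad t)) (x, z) * h (x, sgn (perp x z)) \<partial>lborel)
        \<in> borel_measurable \<sigma>"
      by (intro lborel.borel_measurable_nn_integral) (simp add: case_prod_unfold gram_schmidt_def)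
    then show ?thesis by (simp add: cyl.nn_integral_frame_law[OF h] nn_integral_cmult)
  qed
  also have "\<dots> = ennreal (1 / c) * (ennreal (c * sphere_area TYPE('a)) * (\<integral>\<^sup>+p. h p \<partial>liouville))"
    unfolding frame_law_cylinder_eq[OF t dim] c_def using h
    by (subst nn_integral_scale_measure) (simp_all cong: measurable_cong_sets)
  also have "(\<integral>\<^sup>+p. h p \<partial>liouville) = ennreal (L2_sq liouville (\<lambda>p. zero_extension f (geodesic_point
      t p)))"
    unfolding h_def by (rule nn_integral_L2_sq[OF L2_liouville_geodesic_point[OF t f]])
  also have "ennreal (1 / c) * (ennreal (c * sphere_area TYPE('a)) * \<dots>) < \<infinity>"
    by (simp add: ennreal_mult_less_top)
  finally show ?thesis
    using borel_measurable_rim_mean[OF t f] by (simp add: L2_iff_nn)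
qed

lemma L2_dot_rim_mean:
  fixes f g :: "'a \<Rightarrow> complex"
  assumes t: "\<bar>t\<bar> < 1" and f: "f \<in> L2 \<sigma>" and g: "g \<in> L2 \<sigma>"
  shows "L2_dot \<sigma> (rim_mean t f) g = complex_of_real (sphere_area TYPE('a)) *
    L2_dot liouville (\<lambda>p. zero_extension f (geodesic_point t p)) (\<lambda>p. zero_extension g (fst p))"
proof -
  have "L2_dot \<sigma> (rim_mean t f) g = (LINT x|sphere_measure. rim_mean t f x * cnj (zero_extension g x))"
    unfolding L2_dot_def by (intro Bochner_Integration.integral_cong) auto
  also have "\<dots> = sphere_area TYPE('a) *\<^sub>R
      (LINT p|liouville. zero_extension f (geodesic_point t p) * cnj (zero_extension g (fst p)))"
    by (intro rim_mean_integral[OF t dim, where g = "\<lambda>x. cnj (zero_extension g x)"]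
        borel_measurable_cnj L2_sphere_borel f g L2_integrable_dot
        L2_liouville_geodesic_point t L2_liouville_fst)
  finally show ?thesis by (simp add: L2_dot_def scaleR_conv_of_real)
qed

text \<open>The map \<open>(x, v) \<mapsto> (y, - w)\<close>, where \<open>(y, w)\<close> is the image of \<open>(x, v)\<close> under the geodesic flow,
  is an involution that exchanges the two end points.\<close>

lemma rim_mean_symmetric:
  fixes f g :: "'a \<Rightarrow> complex"
  assumes t: "\<bar>t\<bar> < 1" and f: "f \<in> L2 \<sigma>" and g: "g \<in> L2 \<sigma>"
  shows "L2_dot \<sigma> (rim_mean t f) g = L2_dot \<sigma> f (rim_mean t g)"
proof -
  define \<iota> :: "'a \<times> 'a \<Rightarrow> 'a \<times> 'a" where "\<iota> p = flip (geodesic t (rad t) p)" for p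
  have \<iota>: "\<iota> \<in> liouville \<rightarrow>\<^sub>M borel"
    using measurable_compose[OF borel_geodesic borel_flip] by (simp add: \<iota>_def[abs_def] cong:
        measurable_cong_sets)
  have "geodesic t (rad t) \<in> liouville \<rightarrow>\<^sub>M (borel :: ('a \<times> 'a) measure)" using borel_geodesic
      by (simp cong: measurable_cong_sets)
  from distr_distr[OF borel_flip this] have inv: "distr liouville borel \<iota> = liouville"
    by (simp add: \<iota>_def[abs_def] comp_def distr_liouville_geodesic[OF rad_sq[OF t dim]]
        distr_liouville_flip)
  have fst_\<iota>: "fst (\<iota> p) = geodesic_point t p" for p
    by (simp add: \<iota>_def flip_def geodesic_point_eq)
  have point_\<iota>: "geodesic_point t (\<iota> p) = fst p" for p
  proof -
    have "geodesic_point t (\<iota> p) = (t * t + rad t * rad t) *\<^sub>R fst p"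
      by (simp add: geodesic_point_def \<iota>_def flip_def geodesic_def algebra_simps)
    then show ?thesis using rad_sq[OF t dim] by (simp add: power2_eq_square)
  qed
  define F G where "F = zero_extension f" and "G = zero_extension g"
  have FG: "F \<in> borel_measurable borel" "G \<in> borel_measurable borel"
    unfolding F_def G_def by (intro L2_sphere_borel f g)+
  have m: "(\<lambda>p. F (geodesic_point t p) * cnj (G (fst p))) \<in> borel_measurable borel"
    by (intro borel_measurable_times borel_measurable_cnj measurable_compose[OF borel_geodesic_point]
        measurable_compose[OF borel_fst] FG)
  have "L2_dot liouville (\<lambda>p. F (geodesic_point t p)) (\<lambda>p. G (fst p)) =
      (LINT p|distr liouville borel \<iota>. F (geodesic_point t p) * cnj (G (fst p)))"
    by (simp add: inv L2_dot_def)
  also have "\<dots> = L2_dot liouville (\<lambda>p. F (fst p)) (\<lambda>p. G (geodesic_point t p))"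
    by (subst integral_distr[OF \<iota> m]) (simp add: L2_dot_def fst_\<iota> point_\<iota>)
  finally have "L2_dot \<sigma> (rim_mean t f) g = complex_of_real (sphere_area TYPE('a)) *
      L2_dot liouville (\<lambda>p. F (fst p)) (\<lambda>p. G (geodesic_point t p))"
    by (simp add: L2_dot_rim_mean[OF t f g] F_def G_def)
  also have "\<dots> = cnj (L2_dot \<sigma> (rim_mean t g) f)"
    unfolding F_def G_def by (subst L2_dot_commute) (simp add: L2_dot_rim_mean[OF t g f])
  also have "\<dots> = L2_dot \<sigma> f (rim_mean t g)"
    by (rule L2_dot_commute[symmetric])
  finally show ?thesis .
qed

text \<open>Expand the square. Both ends contribute the square norm of \<open>f\<close> divided by
  the area, and the mixed term is the pairing of the rim mean with \<open>f\<close>.\<close>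

lemma energy_eq_rim_mean:
  fixes f :: "'a \<Rightarrow> complex"
  assumes \<theta>: "0 < \<theta>" "\<theta> < pi" and f: "f \<in> L2 \<sigma>"
  shows "energy f \<theta> = 2 / sphere_area TYPE('a) *
    Re (L2_dot \<sigma> f f - L2_dot \<sigma> (rim_mean (cos \<theta>) f) f)"
proof -
  have t: "\<bar>cos \<theta>\<bar> < 1"
    using \<theta> cos_monotone_0_pi[of 0 \<theta>] cos_monotone_0_pi[of \<theta> pi] by (simp add: abs_less_iff)
  have "sin \<theta> = sqrt (1 - (cos \<theta>)\<^sup>2)"
    using sin_gt_zero[OF \<theta>] by (simp add: sin_squared_eq[symmetric])
  then have gp: "fst (geodesic (cos \<theta>) (sin \<theta>) p) = geodesic_point (cos \<theta>) p" for p :: "'a \<times> 'a"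
    by (simp add: geodesic_point_eq)
  define U where "U = (\<lambda>p :: 'a \<times> 'a. zero_extension f (fst p))"
  define W where "W = (\<lambda>p :: 'a \<times> 'a. zero_extension f (geodesic_point (cos \<theta>) p))"
  define w where "w = sphere_area TYPE('a)"
  have w: "w \<noteq> 0" using measure_sphere_pos[where 'a = 'a] by (simp add: w_def)
  have UW: "U \<in> L2 liouville" "W \<in> L2 liouville"
    unfolding U_def W_def by (intro L2_liouville_fst L2_liouville_geodesic_point t f)+
  have "energy f \<theta> = L2_sq liouville U + L2_sq liouville W - 2 * Re (L2_dot liouville U W)"
    by (simp add: energy_def gp L2_sq_diff[OF UW, unfolded U_def W_def] U_def W_def)
  moreover have "L2_sq liouville U = L2_sq \<sigma> f / w"
    unfolding U_def w_def by (rule L2_sq_liouville[OF borel_fst refl f])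
  moreover have "L2_sq liouville W = L2_sq \<sigma> f / w"
    unfolding W_def w_def gp[symmetric]
    by (intro L2_sq_liouville[OF borel_fst_geodesic geodesic_marginal f]) simp
  moreover have "Re (L2_dot liouville U W) = Re (L2_dot \<sigma> (rim_mean (cos \<theta>) f) f) / w"
  proof -
    have "Re (L2_dot liouville U W) = Re (L2_dot liouville W U)" by (subst L2_dot_commute) simp
    then show ?thesis using w by (simp add: L2_dot_rim_mean[OF t f f] U_def W_def w_def)
  qed
  ultimately show ?thesis
    using w by (simp add: L2_dot_self w_def diff_divide_distrib)
qed

lemma norm_sum_sq_le:
  fixes a :: "nat \<Rightarrow> 'c::real_normed_vector"
  shows "(norm (\<Sum>i<k. a i))\<^sup>2 \<le> real k * (\<Sum>i<k. (norm (a i))\<^sup>2)"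
proof -
  have "(norm (\<Sum>i<k. a i))\<^sup>2 \<le> (\<Sum>i<k. 1 * norm (a i))\<^sup>2"
    by (intro power_mono) (auto intro: norm_sum)
  also have "\<dots> \<le> (\<Sum>i<k. 1\<^sup>2) * (\<Sum>i<k. (norm (a i))\<^sup>2)"
    by (rule Cauchy_Schwarz_ineq_sum)
  finally show ?thesis by simp
qed

text \<open>Cutting a geodesic arc into \<open>k\<close> equal pieces; the pieces are equidistributed by the
  invariance of the Liouville measure.\<close>

lemma energy_mult_le:
  fixes f :: "'a \<Rightarrow> complex"
  assumes f: "f \<in> L2 \<sigma>"
  shows "energy f (real k * \<theta>) \<le> (real k)\<^sup>2 * energy f \<theta>"
proof -
  define F where "F = zero_extension f"
  define geo :: "real \<Rightarrow> 'a \<times> 'a \<Rightarrow> 'a \<times> 'a" where "geo \<theta> = geodesic (cos \<theta>) (sin \<theta>)" for \<theta>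
  have geo_add: "geo \<theta> (geo \<phi> p) = geo (\<theta> + \<phi>) p" for \<theta> \<phi> and p :: "'a \<times> 'a"
    by (simp add: geo_def geodesic_add cos_add sin_add)
  have geo_0: "geo 0 p = p" for p :: "'a \<times> 'a" by (simp add: geo_def geodesic_def)
  have FL: "(\<lambda>p. F (fst (geo \<theta> p))) \<in> L2 liouville" for \<theta>
    unfolding F_def geo_def by (intro L2_liouville_geodesic f) simp
  define D where "D i p = F (fst (geo (real i * \<theta>) p)) - F (fst (geo (real (Suc i) * \<theta>) p))" for i p
  have DL: "D i \<in> L2 liouville" for i unfolding D_def by (intro L2_diff FL)
  have D_sq: "L2_sq liouville (D i) = energy f \<theta>" for i
  proof -
    let ?h = "\<lambda>p. (cmod (F (fst p) - F (fst (geo \<theta> p))))\<^sup>2"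
    have g: "geo (real i * \<theta>) \<in> liouville \<rightarrow>\<^sub>M (borel :: ('a \<times> 'a) measure)"
      unfolding geo_def using borel_geodesic by (simp cong: measurable_cong_sets)
    have Fb: "F \<in> borel_measurable borel" unfolding F_def by (rule L2_sphere_borel[OF f])
    have h: "?h \<in> borel_measurable borel"
      unfolding geo_def
      by (intro borel_measurable_power borel_measurable_norm[THEN measurable_compose[rotated]]
          borel_measurable_diff
          measurable_compose[OF borel_fst Fb] measurable_compose[OF borel_fst_geodesic Fb])
    have "L2_sq liouville (D i) = (LINT p|liouville. ?h (geo (real i * \<theta>) p))"
      unfolding L2_sq_def D_def by (simp add: geo_add algebra_simps)
    also have "\<dots> = (LINT p|distr liouville borel (geo (real i * \<theta>)). ?h p)"
      by (rule integral_distr[OF g h, symmetric])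
    also have "distr liouville borel (geo (real i * \<theta>)) = (liouville :: ('a \<times> 'a) measure)"
      unfolding geo_def by (rule distr_liouville_geodesic) simp
    finally show ?thesis by (simp add: energy_def L2_sq_def F_def geo_def)
  qed
  have "energy f (real k * \<theta>) = (LINT p|liouville. (cmod (F (fst p) - F (fst (geo (real k * \<theta>) p))))\<^sup>2)"
    by (simp add: energy_def L2_sq_def F_def geo_def)
  also have "\<dots> = (LINT p|liouville. (cmod (\<Sum>i<k. D i p))\<^sup>2)"
    using sum_lessThan_telescope'[of "\<lambda>i. F (fst (geo (real i * \<theta>) p))" k for p]
    by (simp add: D_def geo_0 del: of_nat_Suc)
  \<comment> \<open>Cauchy-Schwarz costs one factor \<open>k\<close>; the other comes from the
    number of pieces.\<close>
  also have "\<dots> \<le> (LINT p|liouville. real k * (\<Sum>i<k. (cmod (D i p))\<^sup>2))"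
    using L2_integrable_sq[OF L2_sum[of "{..<k}" D, OF DL]] L2_integrable_sq[OF DL]
    by (intro integral_mono norm_sum_sq_le) auto
  also have "\<dots> = real k * (\<Sum>i<k. L2_sq liouville (D i))"
    by (simp add: L2_sq_def L2_integrable_sq[OF DL])
  also have "\<dots> = (real k)\<^sup>2 * energy f \<theta>" by (simp add: D_sq power2_eq_square)
  finally show ?thesis .
qed

end

section \<open>The Laplace-Beltrami derivative as a symmetric operator\<close>

lemma L2_norm_sphere: "L2_norm (\<sigma> :: 'a::euclidean_space measure) f = sqrt (L2_sq \<sigma> f / sphere_area
    TYPE('a))"
  by (simp add: L2_norm_def L2_sq_def)

lemma has_LB_derivativeD:
  assumes "has_LB_derivative f g"
  shows "f \<in> L2 \<sigma>" "g \<in> L2 \<sigma>"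
  using assms by (auto simp: has_LB_derivative_def)

lemma eventually_at_left_1: "\<forall>\<^sub>F t :: real in at_left 1. \<bar>t\<bar> < 1"
  using eventually_at_left_real[of 0 1] by (auto elim: eventually_mono)

text \<open>The square-integrable functions of exponential type: in terms of spherical harmonics, those
  whose expansion is restricted to eigenvalues at most \<open>R\<close>.\<close>

definition LB_bounded :: "real \<Rightarrow> ('a::euclidean_space \<Rightarrow> complex) set" where
  "LB_bounded R = {f \<in> L2 sphere_measure. \<exists>C. \<forall>N. \<exists>g. (has_LB_derivative ^^ N) f g \<and> sqrt (L2_sq \<sigma>
      g) \<le> C * R ^ N}"

context
  assumes dim: "2 \<le> DIM('a::euclidean_space)"
begin

text \<open>By Cauchy-Schwarz, norm convergence of the difference quotients implies weak
  convergence. Symmetry and the energy estimate use the limit in this form.\<close>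

lemma has_LB_derivative_dot:
  fixes f g h :: "'a \<Rightarrow> complex"
  assumes fg: "has_LB_derivative f g" and h: "h \<in> L2 \<sigma>"
  shows "((\<lambda>t. (L2_dot \<sigma> f h - L2_dot \<sigma> (rim_mean t f) h) / complex_of_real (1 - t))
    \<longlongrightarrow> L2_dot \<sigma> g h) (at_left 1)"
proof -
  define w where "w = sphere_area TYPE('a)"
  have w: "0 < w" using measure_sphere_pos[where 'a = 'a] by (simp add: w_def)
  have f: "f \<in> L2 \<sigma>" and g: "g \<in> L2 \<sigma>" using has_LB_derivativeD[OF fg] .
  define Q where "Q t x = (f x - rim_mean t f x) / complex_of_real (1 - t) - g x" for t x
  have lim: "((\<lambda>t. L2_norm \<sigma> (Q t)) \<longlongrightarrow> 0) (at_left 1)"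
    using fg by (simp add: has_LB_derivative_def Q_def[abs_def])
  have bound: "norm ((L2_dot \<sigma> f h - L2_dot \<sigma> (rim_mean t f) h) / complex_of_real (1 - t)
      - L2_dot \<sigma> g h) \<le> L2_norm \<sigma> (Q t) * (sqrt w * sqrt (L2_sq \<sigma> h))"
    if t: "\<bar>t\<bar> < 1" for t
  proof -
    have S: "rim_mean t f \<in> L2 \<sigma>" by (rule L2_rim_mean[OF dim t f])
    have q: "(\<lambda>x. inverse (complex_of_real (1 - t)) * (f x - rim_mean t f x)) \<in> L2 \<sigma>"
      by (intro L2_scale L2_diff f S)
    have Q_eq: "Q t = (\<lambda>x. inverse (complex_of_real (1 - t)) * (f x - rim_mean t f x) - g x)"
      by (simp add: Q_def fun_eq_iff field_class.field_divide_inverse mult.commute)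
    have QL: "Q t \<in> L2 \<sigma>" unfolding Q_eq by (intro L2_diff q g)
    have "L2_dot \<sigma> (Q t) h = inverse (complex_of_real (1 - t)) *
        (L2_dot \<sigma> f h - L2_dot \<sigma> (rim_mean t f) h) - L2_dot \<sigma> g h"
      unfolding Q_eq by (subst L2_dot_diff[OF q g h]) (simp only: L2_dot_scale L2_dot_diff[OF f S h])
    also have "\<dots> = (L2_dot \<sigma> f h - L2_dot \<sigma> (rim_mean t f) h) / complex_of_real (1 - t)
      - L2_dot \<sigma> g h" by (simp add: field_class.field_divide_inverse mult.commute)
    finally have "norm ((L2_dot \<sigma> f h - L2_dot \<sigma> (rim_mean t f) h) / complex_of_real (1 - t)
      - L2_dot \<sigma> g h) = cmod (L2_dot \<sigma> (Q t) h)" by simp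
    also have "\<dots> \<le> sqrt (L2_sq \<sigma> (Q t)) * sqrt (L2_sq \<sigma> h)"
      by (rule L2_dot_le[OF QL h])
    also have "\<dots> = L2_norm \<sigma> (Q t) * (sqrt w * sqrt (L2_sq \<sigma> h))"
      using w by (simp add: L2_norm_sphere w_def real_sqrt_divide)
    finally show ?thesis .
  qed
  have "((\<lambda>t. L2_norm \<sigma> (Q t) * (sqrt w * sqrt (L2_sq \<sigma> h))) \<longlongrightarrow> 0) (at_left 1)"
    using tendsto_mult_right[OF lim, of "sqrt w * sqrt (L2_sq \<sigma> h)"] by simp
  then have "((\<lambda>t. (L2_dot \<sigma> f h - L2_dot \<sigma> (rim_mean t f) h) / complex_of_real (1 - t)
      - L2_dot \<sigma> g h) \<longlongrightarrow> 0) (at_left 1)"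
    by (rule Lim_null_comparison[rotated]) (use eventually_at_left_1 in eventually_elim, rule bound)
  then show ?thesis by (simp add: LIM_zero_iff)
qed

text \<open>The difference quotients inherit symmetry from the rim means, and symmetry survives the
  weak limit.\<close>

lemma has_LB_derivative_symmetric:
  fixes f g f' g' :: "'a \<Rightarrow> complex"
  assumes fg: "has_LB_derivative f g" and fg': "has_LB_derivative f' g'"
  shows "L2_dot \<sigma> g f' = L2_dot \<sigma> f g'"
proof -
  have f: "f \<in> L2 \<sigma>" and f': "f' \<in> L2 \<sigma>"
    using has_LB_derivativeD[OF fg] has_LB_derivativeD[OF fg'] by auto
  define q where "q t = (L2_dot \<sigma> f f' - L2_dot \<sigma> (rim_mean t f) f') / complex_of_real (1 - t)" for t
  define q' where "q' t = (L2_dot \<sigma> f' f - L2_dot \<sigma> (rim_mean t f') f) / complex_of_real (1 - t)" for t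
  have 1: "(q \<longlongrightarrow> L2_dot \<sigma> g f') (at_left 1)"
    unfolding q_def by (rule has_LB_derivative_dot[OF fg f'])
  have "(q' \<longlongrightarrow> L2_dot \<sigma> g' f) (at_left 1)"
    unfolding q'_def by (rule has_LB_derivative_dot[OF fg' f])
  then have 2: "((\<lambda>t. cnj (q' t)) \<longlongrightarrow> cnj (L2_dot \<sigma> g' f)) (at_left 1)"
    by (rule tendsto_cnj)
  have "\<forall>\<^sub>F t in at_left 1. cnj (q' t) = q t"
    using eventually_at_left_1
  proof eventually_elim
    case (elim t)
    have "cnj (q' t) = (L2_dot \<sigma> f f' - L2_dot \<sigma> f (rim_mean t f')) / complex_of_real (1 - t)"
      by (simp add: q'_def L2_dot_commute[of _ f f'] L2_dot_commute[of _ f "rim_mean t f'"])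
    then show ?case by (simp add: q_def rim_mean_symmetric[OF dim elim f f'])
  qed
  then have "(q \<longlongrightarrow> cnj (L2_dot \<sigma> g' f)) (at_left 1)"
    using 2 by (simp add: tendsto_cong)
  then have "L2_dot \<sigma> g f' = cnj (L2_dot \<sigma> g' f)"
    using 1 by (intro tendsto_unique[of "at_left (1::real)"]) auto
  then show ?thesis by (simp add: L2_dot_commute[of _ f g'])
qed

section \<open>Oscillation bounds in terms of the derivative\<close>

lemma one_minus_cos_le: "1 - cos x \<le> x\<^sup>2 / 2" for x :: real
proof -
  have "1 - cos x = 2 * (sin (x / 2))\<^sup>2" using cos_double_sin[of "x / 2"] by simp
  also have "(sin (x / 2))\<^sup>2 \<le> (x / 2)\<^sup>2"
    using abs_sin_x_le_abs_x[of "x / 2"] by (simp only: abs_le_square_iff)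
  finally show ?thesis by (simp add: power_divide)
qed

text \<open>Cut the arc into \<open>Suc k\<close> pieces of length \<open>\<phi> k\<close>. The
  energy of one piece is \<open>2 / w * (1 - cos (\<phi> k))\<close> times the real part of the
  difference quotient paired with \<open>f\<close>. As \<open>1 - cos\<close> is at most half the
  square, the square of the number of pieces cancels, and only the limit of the quotients
  remains.\<close>

lemma energy_le:
  fixes f g :: "'a \<Rightarrow> complex"
  assumes fg: "has_LB_derivative f g" and \<theta>: "0 < \<theta>" "\<theta> < pi"
  shows "energy f \<theta> \<le> \<theta>\<^sup>2 / sphere_area TYPE('a) * Re (L2_dot \<sigma> g f)"
proof -
  define w where "w = sphere_area TYPE('a)"
  have w: "0 < w" using measure_sphere_pos[where 'a = 'a] by (simp add: w_def)
  have f: "f \<in> L2 \<sigma>" using has_LB_derivativeD[OF fg] by auto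
  define q where "q t = (L2_dot \<sigma> f f - L2_dot \<sigma> (rim_mean t f) f) / complex_of_real (1 - t)" for t
  define \<phi> where "\<phi> k = \<theta> / real (Suc k)" for k
  have \<phi>: "0 < \<phi> k" "\<phi> k < pi" for k
  proof -
    show "0 < \<phi> k" using \<theta> by (simp add: \<phi>_def)
    have "\<phi> k \<le> \<theta>" using \<theta> by (simp add: \<phi>_def field_simps)
    then show "\<phi> k < pi" using \<theta> by simp
  qed
  have \<phi>_0: "\<phi> \<longlonglongrightarrow> 0"
    using tendsto_mult[OF tendsto_const[of \<theta>] LIMSEQ_inverse_real_of_nat] by (simp add:
        \<phi>_def[abs_def] field_class.field_divide_inverse)
  have cos_lt: "cos (\<phi> k) < 1" for k
    using \<phi>(1)[of k] less_imp_le[OF \<phi>(2)[of k]] cos_monotone_0_pi[of 0 "\<phi> k"] by simp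
  have "filterlim (\<lambda>k. cos (\<phi> k)) (at_left 1) sequentially"
    unfolding filterlim_at using cos_lt tendsto_cos[OF \<phi>_0] less_imp_neq[OF cos_lt] by auto
  from filterlim_compose[OF has_LB_derivative_dot[OF fg f] this]
  have "(\<lambda>k. q (cos (\<phi> k))) \<longlonglongrightarrow> L2_dot \<sigma> g f" by (simp add: q_def)
  then have lim: "(\<lambda>k. \<theta>\<^sup>2 / w * Re (q (cos (\<phi> k)))) \<longlonglongrightarrow> \<theta>\<^sup>2 / w * Re (L2_dot \<sigma> g f)"
    by (intro tendsto_mult tendsto_Re tendsto_const)
  have le: "energy f \<theta> \<le> \<theta>\<^sup>2 / w * Re (q (cos (\<phi> k)))" for k
  proof -
    define c where "c = 1 - cos (\<phi> k)"
    have c: "0 < c" "c \<le> (\<phi> k)\<^sup>2 / 2" using cos_lt[of k] one_minus_cos_le[of "\<phi> k"] by (auto simp: c_def)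
    have E: "energy f (\<phi> k) = 2 / w * (c * Re (q (cos (\<phi> k))))"
      using c energy_eq_rim_mean[OF dim \<phi> f, of k] by (simp add: w_def q_def c_def)
    moreover have "0 \<le> energy f (\<phi> k)" by (simp add: energy_def)
    \<comment> \<open>The sign allows \<open>c\<close> to be replaced by its upper bound
      \<open>(\<phi> k)\<^sup>2 / 2\<close> in the product.\<close>
    ultimately have q: "0 \<le> Re (q (cos (\<phi> k)))" using c w by (simp add:
        zero_le_mult_iff zero_le_divide_iff)
    have "energy f \<theta> = energy f (real (Suc k) * \<phi> k)" by (simp add: \<phi>_def)
    also have "\<dots> \<le> (real (Suc k))\<^sup>2 * energy f (\<phi> k)" by (rule energy_mult_le[OF dim f])
    also have "\<dots> \<le> (real (Suc k))\<^sup>2 * (2 / w * ((\<phi> k)\<^sup>2 / 2 * Re (q (cos (\<phi> k)))))"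
      unfolding E using c w q by (intro mult_left_mono mult_right_mono) auto
    also have "\<dots> = (real (Suc k) * \<phi> k)\<^sup>2 / w * Re (q (cos (\<phi> k)))"
      by (simp add: power_mult_distrib)
    also have "real (Suc k) * \<phi> k = \<theta>" by (simp add: \<phi>_def)
    finally show ?thesis .
  qed
  show ?thesis
    using LIMSEQ_le_const[OF lim, of "energy f \<theta>"] le by (auto simp: w_def)
qed

text \<open>Successive ratios increase, so the first one is at most each later one, and
  \<open>N\<close> of them are multiplied. Everything is cross-multiplied because terms may
  vanish.\<close>

lemma log_convex_first_ratio:
  fixes a :: "nat \<Rightarrow> real"
  assumes nonneg: "\<And>i. 0 \<le> a i" and conv: "\<And>i. Suc i < N \<Longrightarrow> (a (Suc i))\<^sup>2 \<le> a i * a (Suc (Suc i))"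
    and N: "1 \<le> N"
  shows "a 1 ^ N \<le> a 0 ^ (N - 1) * a N"
proof -
  have ratio: "a 1 * a k \<le> a 0 * a (Suc k)" if "k < N" for k
    using that
  proof (induction k)
    case (Suc k)
    show ?case
    proof (cases "a (Suc k) = 0")
      case False
      then have pos: "0 < a (Suc k)" using nonneg[of "Suc k"] by simp
      have "a (Suc k) * (a 1 * a (Suc k)) = a 1 * (a (Suc k))\<^sup>2" by (simp add: power2_eq_square)
      also have "\<dots> \<le> a 1 * (a k * a (Suc (Suc k)))" using Suc.prems nonneg
          by (intro mult_left_mono conv) auto
      also have "\<dots> = (a 1 * a k) * a (Suc (Suc k))" by simp
      also have "\<dots> \<le> (a 0 * a (Suc k)) * a (Suc (Suc k))" using Suc nonneg
          by (intro mult_right_mono) auto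
      also have "\<dots> = a (Suc k) * (a 0 * a (Suc (Suc k)))" by simp
      finally show ?thesis using pos by (simp only: mult_le_cancel_left_pos)
    qed (simp add: nonneg)
  qed simp
  have "a 1 ^ Suc k \<le> a 0 ^ k * a (Suc k)" if "Suc k \<le> N" for k
    using that
  proof (induction k)
    case (Suc k)
    have "a 1 ^ Suc (Suc k) \<le> a 1 * (a 0 ^ k * a (Suc k))"
      using Suc nonneg[of 1] by (simp add: mult_left_mono)
    also have "\<dots> = a 0 ^ k * (a 1 * a (Suc k))" by simp
    also have "\<dots> \<le> a 0 ^ k * (a 0 * a (Suc (Suc k)))" using Suc.prems nonneg
        by (intro mult_left_mono ratio) auto
    finally show ?case by (simp add: ac_simps)
  qed simp
  from this[of "N - 1"] N show ?thesis by simp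
qed

text \<open>Log-convexity turns the bound on the \<open>N\<close>-th derivative into one on the
  \<open>N\<close>-th power of the norm of the first, in which \<open>C\<close> enters only
  linearly. As \<open>N\<close> grows, the constant disappears and \<open>R\<close> stays.\<close>

lemma energy_LB_bounded:
  fixes f :: "'a \<Rightarrow> complex"
  assumes f: "f \<in> LB_bounded R" and R: "0 < R" and \<theta>: "0 < \<theta>" "\<theta> < pi"
  shows "energy f \<theta> \<le> \<theta>\<^sup>2 * R * L2_sq \<sigma> f / sphere_area TYPE('a)"
proof -
  define w where "w = sphere_area TYPE('a)"
  have w: "0 < w" using measure_sphere_pos[where 'a = 'a] by (simp add: w_def)
  define n where "n h = sqrt (L2_sq (\<sigma> :: 'a measure) h)" for h
  obtain C where C: "\<And>N. \<exists>g. (has_LB_derivative ^^ N) f g \<and> n g \<le> C * R ^ N"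
    using f by (auto simp: LB_bounded_def n_def)
  \<comment> \<open>By \<open>energy_le\<close>, \<open>b\<close> is at most the real part of the
    pairing of the first derivative with \<open>f\<close>.\<close>
  define b where "b = w * energy f \<theta> / \<theta>\<^sup>2"
  \<comment> \<open>\<open>y\<close> is the norm of a first derivative. Every \<open>N\<close> comes
    with its own chain of derivatives, so \<open>y\<close> is quantified inside, whereas
    \<open>b\<close> is the same for all \<open>N\<close>.\<close>
  have key: "\<exists>y. b \<le> y * n f \<and> 0 \<le> y \<and> y ^ N \<le> n f ^ (N - 1) * (C * R ^ N)" if N: "1 \<le> N" for N
  proof -
    obtain g where g: "(has_LB_derivative ^^ N) f g" "n g \<le> C * R ^ N" using C by blast
    obtain h where h: "h 0 = f" "h N = g" "\<And>i. i < N \<Longrightarrow> has_LB_derivative (h i) (h (Suc i))"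
      using g(1) unfolding relpowp_fun_conv by blast
    define a where "a i = n (h i)" for i
    have hL: "h i \<in> L2 \<sigma>" if "i \<le> N" for i
      using h(3)[of i] h(3)[of "i - 1"] has_LB_derivativeD that N by (cases "i = N") auto
    have sq: "(a i)\<^sup>2 = L2_sq \<sigma> (h i)" for i by (simp add: a_def n_def)
    have "(a (Suc i))\<^sup>2 \<le> a i * a (Suc (Suc i))" if "Suc i < N" for i
    proof -
      have "complex_of_real ((a (Suc i))\<^sup>2) = L2_dot \<sigma> (h (Suc i)) (h (Suc i))"
        by (simp add: sq L2_dot_self)
      also have "\<dots> = L2_dot \<sigma> (h i) (h (Suc (Suc i)))"
        using that by (intro has_LB_derivative_symmetric h(3)) auto
      finally have "(a (Suc i))\<^sup>2 = cmod (L2_dot \<sigma> (h i) (h (Suc (Suc i))))"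
        by (metis abs_of_nonneg norm_of_real zero_le_power2)
      also have "\<dots> \<le> a i * a (Suc (Suc i))"
        unfolding a_def n_def using that by (intro L2_dot_le hL) auto
      finally show ?thesis .
    qed
    then have "a 1 ^ N \<le> a 0 ^ (N - 1) * a N"
      by (intro log_convex_first_ratio N) (auto simp: a_def n_def)
    also have "\<dots> \<le> n f ^ (N - 1) * (C * R ^ N)"
      using g(2) by (intro mult_mono) (auto simp: a_def h n_def)
    finally have "a 1 ^ N \<le> n f ^ (N - 1) * (C * R ^ N)" .
    moreover have "b \<le> a 1 * n f"
    proof -
      have "energy f \<theta> \<le> \<theta>\<^sup>2 / w * Re (L2_dot \<sigma> (h 1) f)"
        unfolding w_def using h(3)[of 0] N h(1) by (intro energy_le \<theta>) auto
      then have "b \<le> Re (L2_dot \<sigma> (h 1) f)"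
        using w \<theta> by (simp add: b_def field_simps)
      also have "\<dots> \<le> cmod (L2_dot \<sigma> (h 1) f)" by (rule complex_Re_le_cmod)
      also have "\<dots> \<le> a 1 * n f"
        unfolding a_def n_def using f N by (intro L2_dot_le hL) (auto simp: LB_bounded_def)
      finally show ?thesis .
    qed
    ultimately show ?thesis by (intro exI[of _ "a 1"]) (auto simp: a_def n_def)
  qed
  have b0: "0 \<le> b" using w by (simp add: b_def energy_def)
  have "b \<le> R * (n f)\<^sup>2"
  proof (cases "n f = 0")
    case True
    then show ?thesis using key[of 1] by auto
  next
    case False
    then have nf: "0 < n f" by (simp add: n_def less_le)
    \<comment> \<open>The goal becomes \<open>r \<le> 1\<close>, and this holds once all powers of
      \<open>r\<close> are bounded by one number.\<close>
    define r where "r = b / (R * (n f)\<^sup>2)"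
    have r0: "0 \<le> r" using b0 R by (simp add: r_def)
    have pow: "r ^ N \<le> C / n f" if N: "1 \<le> N" for N
    proof -
      obtain y where y: "b \<le> y * n f" "0 \<le> y" "y ^ N \<le> n f ^ (N - 1) * (C * R ^ N)" using key[OF N]
          by blast
      have "r \<le> y / (R * n f)"
        using y(1) R nf by (simp add: r_def power2_eq_square field_simps)
      then have "r ^ N \<le> (y / (R * n f)) ^ N" using r0 by (intro power_mono)
      also have "\<dots> = y ^ N / (R ^ N * n f ^ N)" by (simp add: power_divide power_mult_distrib)
      also have "\<dots> \<le> n f ^ (N - 1) * (C * R ^ N) / (R ^ N * n f ^ N)"
        using y(3) R nf by (intro divide_right_mono) auto
      also have "n f ^ N = n f * n f ^ (N - 1)" using N by (cases N) auto
      also have "n f ^ (N - 1) * (C * R ^ N) / (R ^ N * (n f * n f ^ (N - 1))) = C / n f"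
        using R nf by (simp add: field_simps)
      finally show ?thesis .
    qed
    have "r \<le> 1"
    proof (rule ccontr)
      assume "\<not> r \<le> 1"
      then obtain N where "C / n f < r ^ N" using real_arch_pow[of r "C / n f"] by auto
      moreover have "r ^ N \<le> r ^ Suc N" using \<open>\<not> r \<le> 1\<close> by (intro power_increasing) auto
      ultimately show False using pow[of "Suc N"] by simp
    qed
    then show ?thesis using R nf by (simp add: r_def field_simps)
  qed
  then have "w * energy f \<theta> / \<theta>\<^sup>2 \<le> R * L2_sq \<sigma> f" by (simp add: b_def n_def)
  then show ?thesis using w \<theta> by (simp add: w_def field_simps)
qed

end

section \<open>Polar coordinates and averages over caps\<close>

text \<open>The norm of \<open>y\<close> belongs to the set because the requirement on
  \<open>perp\<close> in \<open>frame_source\<close> provides only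
  \<open>norm x = 1\<close>.\<close>

definition pairs_with_inner :: "real set \<Rightarrow> ('a::real_inner \<times> 'a) set" where
  "pairs_with_inner A = {(x, y). x \<bullet> y \<in> A \<and> norm y = 1}"

lemma borel_inner_pair: "(\<lambda>p. fst p \<bullet> snd p) \<in> borel_measurable (borel :: ('a::euclidean_space \<times> 'a)
    measure)"
  by (intro borel_measurable_continuous_onI continuous_intros)

lemma borel_pairs_with_inner:
  assumes "A \<in> sets borel"
  shows "(pairs_with_inner A :: ('a::euclidean_space \<times> 'a) set) \<in> sets borel"
proof -
  have "(\<lambda>p :: 'a \<times> 'a. fst p \<bullet> snd p) -` A \<inter> space borel \<in> sets borel"
    by (rule measurable_sets[OF borel_inner_pair assms])
  moreover have "closed {p :: 'a \<times> 'a. norm (snd p) = 1}"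
    by (intro closed_Collect_eq continuous_intros)
  ultimately have "((\<lambda>p :: 'a \<times> 'a. fst p \<bullet> snd p) -` A \<inter> space borel) \<inter> {p. norm (snd p) = 1}
      \<in> sets borel"
    by (rule sets.Int[OF _ borel_closed])
  moreover have "((\<lambda>p :: 'a \<times> 'a. fst p \<bullet> snd p) -` A \<inter> space borel) \<inter> {p. norm (snd p) = 1} =
      pairs_with_inner A"
    by (auto simp: pairs_with_inner_def)
  ultimately show ?thesis by simp
qed

text \<open>Excluding the inner products 1 and -1 removes the parallel pairs, at which
  \<open>gram_schmidt\<close> degenerates.\<close>

lemma frame_source_sphere:
  assumes A: "A \<in> sets borel" "A \<subseteq> {-1<..<1}"
  shows "frame_source (\<sigma> :: 'a::euclidean_space measure) (pairs_with_inner A)"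
proof (rule frame_source.intro)
  show "sigma_finite_measure (\<sigma> :: 'a measure)" by (rule sphere.sigma_finite_measure_axioms)
  show "(\<lambda>x. x) \<in> \<sigma> \<rightarrow>\<^sub>M (borel :: 'a measure)" by (rule id_sphere_borel)
  show "(pairs_with_inner A :: ('a \<times> 'a) set) \<in> sets borel" by (rule borel_pairs_with_inner[OF A(1)])
  show "perp x y \<noteq> 0" if "(x, y) \<in> pairs_with_inner A" "norm x = 1" for x y :: 'a
  proof
    assume "perp x y = 0"
    then have "(x \<bullet> y)\<^sup>2 = 1" using norm_perp_sq[OF that(2), of y] that by (simp add:
        pairs_with_inner_def)
    then show False using that A by (auto simp: pairs_with_inner_def power2_eq_1_iff)
  qed
  have "(\<integral>\<^sup>+x. \<integral>\<^sup>+y. indicator (pairs_with_inner A) (x :: 'a, y) \<partial>\<sigma> \<partial>\<sigma>)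
      \<le> (\<integral>\<^sup>+x. \<integral>\<^sup>+y. 1 \<partial>(\<sigma> :: 'a measure) \<partial>(\<sigma> :: 'a measure))"
    by (intro nn_integral_mono) (auto simp: indicator_def)
  also have "\<dots> < \<infinity>" by (simp add: sphere.emeasure_eq_measure ennreal_mult_less_top)
  finally show "(\<integral>\<^sup>+x. \<integral>\<^sup>+y. indicator (pairs_with_inner A) (x :: 'a, y) \<partial>\<sigma> \<partial>\<sigma>) < \<infinity>" .
qed (auto simp: nn_integral_sphere_orthogonal_transformation pairs_with_inner_def
    orthogonal_transformation_inner
    orthogonal_transformation_norm)

text \<open>Polar coordinates are inverted here: \<open>y\<close> is reached from \<open>x\<close>
  by following the direction towards \<open>y\<close> until the inner product is
  \<open>x \<bullet> y\<close>.\<close>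

lemma geodesic_point_polar:
  fixes x y :: "'a::euclidean_space"
  assumes "norm x = 1" "norm y = 1" "\<bar>x \<bullet> y\<bar> < 1"
  shows "geodesic_point (x \<bullet> y) (gram_schmidt (x, y)) = y"
proof -
  have n: "norm (perp x y) = sqrt (1 - (x \<bullet> y)\<^sup>2)"
    using norm_perp_sq[OF assms(1), of y] assms(2) by (metis norm_ge_zero one_power2 real_sqrt_unique)
  then have "norm (perp x y) \<noteq> 0" using sq_le_1_if_abs_less[OF assms(3)] by simp
  then have "sqrt (1 - (x \<bullet> y)\<^sup>2) *\<^sub>R sgn (perp x y) = perp x y"
    by (simp add: n[symmetric] sgn_div_norm)
  then show ?thesis by (simp add: geodesic_point_def gram_schmidt_def perp_def)
qed

definition cap_area :: "'a::euclidean_space itself \<Rightarrow> real \<Rightarrow> real" where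
  "cap_area _ t = measure \<sigma> {y \<in> sphere 0 1. (SOME b :: 'a. b \<in> Basis) \<bullet> y > t}"

context
  assumes dim: "2 \<le> DIM('a::euclidean_space)"
begin

text \<open>The inner product of two random points is independent of the frame they span.
  Restricting it to a set \<open>A\<close> still leaves an invariant law of frames, a multiple of
  the Liouville measure, and the multiple is the mass of \<open>A\<close> under the law of the inner
  product. So the joint law is a product measure, whatever the law of the inner product may
  be.\<close>

lemma polar_coordinates:
  fixes h :: "real \<times> 'a \<times> 'a \<Rightarrow> ennreal"
  assumes h: "h \<in> borel_measurable borel"
  defines "P \<equiv> density (\<sigma> \<Otimes>\<^sub>M \<sigma>) (indicator (pairs_with_inner {-1<..<1})) :: ('a \<times> 'a) measure"
  shows "(\<integral>\<^sup>+p. indicator (pairs_with_inner {-1<..<1}) p * h (fst p \<bullet> snd p, gram_schmidt p) \<partial>(\<sigma> \<Otimes>\<^sub>M \<sigma>)) =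
    (\<integral>\<^sup>+t. \<integral>\<^sup>+q. h (t, q) \<partial>liouville \<partial>distr P borel (\<lambda>p. fst p \<bullet> snd p))"
proof -
  define \<Sigma> where "\<Sigma> = (\<sigma> \<Otimes>\<^sub>M \<sigma> :: ('a \<times> 'a) measure)"
  define I where "I = (pairs_with_inner {-1<..<1} :: ('a \<times> 'a) set)"
  interpret I: frame_source "\<sigma> :: 'a measure" I
    unfolding I_def by (rule frame_source_sphere) auto
  define \<Lambda> where "\<Lambda> = distr P borel (\<lambda>p. fst p \<bullet> snd p)"
  define J where "J = distr P borel (\<lambda>p. (fst p \<bullet> snd p, gram_schmidt p))"
  have P: "P = density \<Sigma> (indicator I)" by (simp add: P_def \<Sigma>_def I_def)
  have indI: "(indicator I :: _ \<Rightarrow> ennreal) \<in> borel_measurable \<Sigma>"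
    unfolding \<Sigma>_def by (rule I.indicator_D)
  have Pm: "f \<in> P \<rightarrow>\<^sub>M K" if "f \<in> borel \<rightarrow>\<^sub>M K" for f :: "'a \<times> 'a \<Rightarrow> 'k" and K
    using I.measurable_pair[OF that] by (simp add: P \<Sigma>_def)
  have inner: "(\<lambda>p. fst p \<bullet> snd p) \<in> P \<rightarrow>\<^sub>M borel" by (rule Pm[OF borel_inner_pair])
  have map_borel: "(\<lambda>p. (fst p \<bullet> snd p, gram_schmidt p)) \<in> borel_measurable (borel :: ('a \<times> 'a) measure)"
    using measurable_Pair[OF borel_inner_pair borel_measurable_gram_schmidt] by (simp only: borel_prod)
  have map: "(\<lambda>p. (fst p \<bullet> snd p, gram_schmidt p)) \<in> P \<rightarrow>\<^sub>M borel" by (rule Pm[OF map_borel])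
  have nnP: "(\<integral>\<^sup>+p. g p \<partial>P) = (\<integral>\<^sup>+p. indicator I p * g p \<partial>\<Sigma>)" if "g \<in> borel_measurable borel" for g
    unfolding P by (rule nn_integral_density[OF indI]) (use I.measurable_pair[OF that] in \<open>simp add:
        \<Sigma>_def\<close>)
  have P_fin: "finite_measure P"
  proof
    have "emeasure P (space P) = (\<integral>\<^sup>+p. indicator I p \<partial>\<Sigma>)" using nnP[of "\<lambda>_. 1"] by simp
    also have "\<dots> = (\<integral>\<^sup>+x. \<integral>\<^sup>+y. indicator I (x, y) \<partial>\<sigma> \<partial>\<sigma>)"
      unfolding \<Sigma>_def using I.D_borel by (intro I.nn_integral_pair borel_measurable_indicator)
    also have "\<dots> < \<infinity>" by (rule I.D_finite)
    finally show "emeasure P (space P) \<noteq> \<infinity>" by simp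
  qed
  then have \<Lambda>_fin: "finite_measure \<Lambda>" unfolding \<Lambda>_def
      by (rule finite_measure.finite_measure_distr[OF _ inner])
  have L_fin: "finite_measure (liouville :: ('a \<times> 'a) measure)"
    by (rule finite_measureI) (simp add: emeasure_liouville[OF dim])
  have eq: "\<Lambda> \<Otimes>\<^sub>M liouville = J"
  proof (rule pair_measure_eqI)
    show "sigma_finite_measure \<Lambda>" "sigma_finite_measure (liouville :: ('a \<times> 'a) measure)"
      using \<Lambda>_fin L_fin by (simp_all add: finite_measure.axioms(1))
    have "sets (\<Lambda> \<Otimes>\<^sub>M (liouville :: ('a \<times> 'a) measure)) = sets (borel \<Otimes>\<^sub>M borel)"
      by (rule sets_pair_measure_cong) (simp_all add: \<Lambda>_def)
    then show "sets (\<Lambda> \<Otimes>\<^sub>M (liouville :: ('a \<times> 'a) measure)) = sets J" by (simp only: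
        J_def borel_prod sets_distr)
    fix A B assume "A \<in> sets \<Lambda>" "B \<in> sets (liouville :: ('a \<times> 'a) measure)"
    then have A: "A \<in> sets borel" and B: "B \<in> sets borel" by (simp_all add: \<Lambda>_def)
    \<comment> \<open>\<open>P\<close> charges only inner products strictly between -1 and 1, so
      cutting \<open>A\<close> down to \<open>A'\<close> changes neither side.\<close>
    define A' where "A' = A \<inter> {-1<..<1}"
    have A': "A' \<in> sets borel" "A' \<subseteq> {-1<..<1}" using A by (auto simp: A'_def)
    interpret A: frame_source "\<sigma> :: 'a measure" "pairs_with_inner A'"
      by (rule frame_source_sphere[OF A'])
    have AB: "A \<times> B \<in> sets (borel :: (real \<times> 'a \<times> 'a) measure)"
      using A B unfolding borel_prod[symmetric] by (rule pair_measureI)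
    have indA: "indicator I p * indicator A (fst p \<bullet> snd p) = (indicator (pairs_with_inner A') p ::
        ennreal)" for p
      by (cases p) (auto simp: indicator_def I_def pairs_with_inner_def A'_def)
    define \<mu> :: "('a \<times> 'a) measure" where "\<mu> = frame_law \<sigma> (pairs_with_inner A')"
    have inv: "frame_invariant \<mu>" unfolding \<mu>_def by (rule A.frame_invariant)
    have "emeasure J (A \<times> B) = (\<integral>\<^sup>+p. indicator (A \<times> B) (fst p \<bullet> snd p, gram_schmidt p) \<partial>P)"
      unfolding J_def using AB map by (simp add: nn_integral_indicator[symmetric] nn_integral_distr
          del: nn_integral_indicator)
    also have "\<dots> = (\<integral>\<^sup>+p. indicator I p * indicator (A \<times> B) (fst p \<bullet> snd p, gram_schmidt p) \<partial>\<Sigma>)"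
      by (intro nnP measurable_compose[OF map_borel] borel_measurable_indicator AB)
    also have "\<dots> = (\<integral>\<^sup>+p. indicator (pairs_with_inner A') p * indicator B (gram_schmidt p) \<partial>\<Sigma>)"
      by (simp add: indicator_times mult.assoc[symmetric] indA)
    also have "\<dots> = (\<integral>\<^sup>+p. indicator B p \<partial>\<mu>)"
      unfolding \<Sigma>_def \<mu>_def using B by (intro A.nn_integral_frame_law_pair[symmetric]
          borel_measurable_indicator)
    also have "\<dots> = emeasure (\<mu>) B"
      using B by (intro nn_integral_indicator) (simp add: \<mu>_def frame_law_def)
    also have "\<dots> = emeasure (\<mu>) UNIV * emeasure liouville B"
      by (subst frame_invariant_eq_liouville[OF dim inv]) simp
    also have "emeasure (\<mu>) UNIV = emeasure \<Lambda> A"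
    proof -
      have "emeasure \<Lambda> A = (\<integral>\<^sup>+p. indicator A (fst p \<bullet> snd p) \<partial>P)"
        unfolding \<Lambda>_def using A inner by (simp add: nn_integral_indicator[symmetric]
            nn_integral_distr del: nn_integral_indicator)
      also have "\<dots> = (\<integral>\<^sup>+p. indicator I p * indicator A (fst p \<bullet> snd p) \<partial>\<Sigma>)"
        by (intro nnP measurable_compose[OF borel_inner_pair] borel_measurable_indicator A)
      also have "\<dots> = (\<integral>\<^sup>+x. \<integral>\<^sup>+y. indicator (pairs_with_inner A') (x :: 'a, y) \<partial>\<sigma> \<partial>\<sigma>)"
        unfolding indA \<Sigma>_def by (rule A.nn_integral_pair[OF borel_measurable_indicator[OF A.D_borel]])
      finally show ?thesis by (simp add: \<mu>_def A.emeasure_frame_law)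
    qed
    finally show "emeasure \<Lambda> A * emeasure liouville B = emeasure J (A \<times> B)" by simp
  qed
  interpret L: sigma_finite_measure "liouville :: ('a \<times> 'a) measure"
      by (rule finite_measure.axioms(1)[OF L_fin])
  have hJ: "h \<in> borel_measurable (\<Lambda> \<Otimes>\<^sub>M liouville)" using h by (simp add: eq J_def)
  have "(\<integral>\<^sup>+p. indicator I p * h (fst p \<bullet> snd p, gram_schmidt p) \<partial>\<Sigma>) =
      (\<integral>\<^sup>+p. h (fst p \<bullet> snd p, gram_schmidt p) \<partial>P)"
    by (intro nnP[symmetric] measurable_compose[OF map_borel] h)
  also have "\<dots> = (\<integral>\<^sup>+u. h u \<partial>J)" unfolding J_def using map h by (simp add: nn_integral_distr)
  also have "\<dots> = (\<integral>\<^sup>+t. \<integral>\<^sup>+q. h (t, q) \<partial>liouville \<partial>\<Lambda>)"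
    unfolding eq[symmetric] by (rule L.nn_integral_fst[OF hJ, symmetric])
  finally show ?thesis by (simp add: I_def \<Sigma>_def \<Lambda>_def)
qed

lemma sets_cap: "{y \<in> sphere 0 1. x \<bullet> y > t} \<in> sets (\<sigma> :: 'a measure)"
proof -
  have "{y. t < x \<bullet> y} \<inter> sphere 0 1 \<in> sets (\<sigma> :: 'a measure)"
    by (intro sets_sphere_measureI borel_open open_Collect_less continuous_intros)
  then show ?thesis by (simp add: Int_def conj_commute)
qed

lemma nn_integral_cap:
  fixes x :: 'a
  assumes x: "norm x = 1"
  shows "(\<integral>\<^sup>+y. indicator {y. x \<bullet> y > t} y \<partial>\<sigma>) = ennreal (cap_area TYPE('a) t)"
proof -
  define b :: 'a where "b = (SOME b. b \<in> Basis)"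
  have "b \<in> Basis" unfolding b_def by (rule someI_ex) (use nonempty_Basis in blast)
  then have b: "norm b = 1" by simp
  have m: "indicator {y. z \<bullet> y > t} \<in> borel_measurable (borel :: 'a measure)" for z :: 'a
    by (intro borel_measurable_indicator borel_open open_Collect_less continuous_intros)
  obtain T :: "'a \<Rightarrow> 'a" where T: "orthogonal_transformation T" "T x = b"
    using orthogonal_transformation_transitive[of x b] x b by auto
  have "(\<integral>\<^sup>+y. indicator {y. x \<bullet> y > t} y \<partial>\<sigma>) = (\<integral>\<^sup>+y. indicator {y. b \<bullet> y > t} (T y) \<partial>\<sigma>)"
    using orthogonal_transformation_inner[OF T(1), of x] T(2) by (simp add: indicator_def)
  also have "\<dots> = (\<integral>\<^sup>+y. indicator {y. b \<bullet> y > t} y \<partial>\<sigma>)"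
    by (rule nn_integral_sphere_orthogonal_transformation[OF T(1) m])
  also have "\<dots> = (\<integral>\<^sup>+y. indicator {y \<in> sphere 0 1. b \<bullet> y > t} y \<partial>\<sigma>)"
    by (intro nn_integral_cong) (simp add: indicator_def)
  also have "\<dots> = ennreal (cap_area TYPE('a) t)"
    using sets_cap[of t b] by (simp add: sphere.emeasure_eq_measure cap_area_def b_def)
  finally show ?thesis .
qed

text \<open>The cone over the cap contains a neighbourhood of \<open>(1/2) *\<^sub>R x\<close>,
  where \<open>x\<close> is the centre of the cap.\<close>

lemma cap_area_pos:
  assumes t: "t < 1"
  shows "0 < cap_area TYPE('a) t"
proof -
  obtain x :: 'a where x: "norm x = 1" using norm_Basis nonempty_Basis by blast
  define U where "U = {z. 0 < norm z} \<inter> {z. norm z < 1} \<inter> {z. t * norm z < x \<bullet> z}"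
  have "open U" unfolding U_def by (intro open_Int open_Collect_less continuous_intros)
  moreover have "(1/2) *\<^sub>R x \<in> U" using x t by (auto simp: U_def dot_square_norm)
  ultimately obtain e where e: "0 < e" "ball ((1/2) *\<^sub>R x) e \<subseteq> U" by (meson open_contains_ball)
  have "U \<in> sets borel" using \<open>open U\<close> by simp
  have "0 < emeasure lborel (ball ((1/2) *\<^sub>R x) e)" using e by (simp add: emeasure_ball)
  also have "\<dots> \<le> emeasure lborel U" using e \<open>U \<in> sets borel\<close> by (intro emeasure_mono) auto
  also have "\<dots> = (\<integral>\<^sup>+z. indicator U z \<partial>lborel)" using \<open>U \<in> sets borel\<close> by simp
  also have "\<dots> \<le> (\<integral>\<^sup>+z. indicator {y. x \<bullet> y > t} (sgn z) * indicator (cball 0 1 - {0}) z \<partial>lborel)"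
    by (intro nn_integral_mono) (auto simp: indicator_def U_def sgn_div_norm field_simps)
  finally have pos: "0 < (\<integral>\<^sup>+z. indicator {y. x \<bullet> y > t} (sgn z) * indicator (cball 0 1 - {0}) z
      \<partial>lborel)" .
  have "indicator {y. x \<bullet> y > t} \<in> borel_measurable (borel :: 'a measure)"
    by (intro borel_measurable_indicator borel_open open_Collect_less continuous_intros)
  from nn_integral_sphere_measure[OF this] nn_integral_cap[OF x, of t]
  have "ennreal (cap_area TYPE('a) t) = of_nat DIM('a) *
      (\<integral>\<^sup>+z. indicator {y. x \<bullet> y > t} (sgn z) * indicator (cball 0 1 - {0}) z \<partial>lborel)" by simp
  also have "\<dots> > 0" using pos by (simp add: ennreal_zero_less_mult_iff)
  finally show ?thesis by simp
qed

text \<open>In polar coordinates the double integral is an integral over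
  \<open>t > cos \<theta>\<close> of the energy at distance \<open>arccos t\<close>. This distance
  is below \<open>\<theta>\<close>, so one bound serves for all \<open>t\<close>, and the mass of
  the range of \<open>t\<close> is at most the cap area times the area of the sphere.\<close>

lemma cap_oscillation_le:
  fixes f :: "'a \<Rightarrow> complex"
  assumes f: "f \<in> LB_bounded R" and R: "0 < R" and \<theta>: "0 < \<theta>" "\<theta> < pi"
  shows "(\<integral>\<^sup>+x. \<integral>\<^sup>+y. indicator {y. x \<bullet> y > cos \<theta>} y * ennreal ((cmod (f x - f y))\<^sup>2) \<partial>\<sigma> \<partial>\<sigma>)
    \<le> ennreal (cap_area TYPE('a) (cos \<theta>) * \<theta>\<^sup>2 * R * L2_sq \<sigma> f)"
proof -
  define F where "F = zero_extension f"
  define w where "w = sphere_area TYPE('a)"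
  have w: "0 < w" using measure_sphere_pos[where 'a = 'a] by (simp add: w_def)
  have fL: "f \<in> L2 \<sigma>" using f by (simp add: LB_bounded_def)
  have F: "F \<in> borel_measurable borel" unfolding F_def by (rule L2_sphere_borel[OF fL])
  define I where "I = (pairs_with_inner {-1<..<1} :: ('a \<times> 'a) set)"
  interpret I: frame_source "\<sigma> :: 'a measure" I
    unfolding I_def by (rule frame_source_sphere) auto
  define c where "c = cos \<theta>"
  have c: "-1 < c" "c < 1" using \<theta> cos_monotone_0_pi[of 0 \<theta>] cos_monotone_0_pi[of \<theta> pi] by (auto
      simp: c_def)
  define h where "h u = indicator {c<..} (fst u) * ennreal ((cmod (F (fst (snd u)) - F
      (geodesic_point (fst u) (snd u))))\<^sup>2)"
    for u :: "real \<times> 'a \<times> 'a"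
  have h: "h \<in> borel_measurable borel"
  proof -
    have gp: "(\<lambda>u :: real \<times> 'a \<times> 'a. geodesic_point (fst u) (snd u)) \<in> borel_measurable borel"
      unfolding geodesic_point_def by (intro borel_measurable_continuous_onI continuous_intros)
    have 1: "(\<lambda>u :: real \<times> 'a \<times> 'a. fst (snd u)) \<in> borel_measurable borel"
      "(fst :: real \<times> 'a \<times> 'a \<Rightarrow> real) \<in> borel_measurable borel"
      by (intro borel_measurable_continuous_onI continuous_intros)+
    have "(\<lambda>u. F (fst (snd u)) - F (geodesic_point (fst u) (snd u))) \<in> borel_measurable (borel ::
        (real \<times> 'a \<times> 'a) measure)"
      by (intro borel_measurable_diff measurable_compose[OF 1(1) F] measurable_compose[OF gp F])
    then show ?thesis unfolding h_def
      by (intro borel_measurable_times_ennreal measurable_compose[OF 1(2)]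
          borel_measurable_indicator) auto
  qed
  \<comment> \<open>The bound of \<open>energy_LB_bounded\<close> at the largest distance
    \<open>\<theta>\<close>.\<close>
  define B where "B = \<theta>\<^sup>2 * R * L2_sq \<sigma> f / w"
  have B: "0 \<le> B" using R w by (simp add: B_def)
  define \<Sigma> where "\<Sigma> = (\<sigma> \<Otimes>\<^sub>M \<sigma> :: ('a \<times> 'a) measure)"
  define P where "P = density \<Sigma> (indicator I)"
  define \<Lambda> where "\<Lambda> = distr P borel (\<lambda>p. fst p \<bullet> snd p)"
  define k where "k p = indicator {c<..} (fst p \<bullet> snd p) * ennreal ((cmod (F (fst p) - F (snd
      p)))\<^sup>2)" for p :: "'a \<times> 'a"
  have k: "k \<in> borel_measurable borel"
  proof -
    have "(\<lambda>p. F (fst p) - F (snd p)) \<in> borel_measurable (borel :: ('a \<times> 'a) measure)"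
      by (intro borel_measurable_diff measurable_compose[OF borel_fst F] measurable_compose[OF
          borel_snd F])
    then show ?thesis unfolding k_def
      by (intro borel_measurable_times_ennreal measurable_compose[OF borel_inner_pair]
          borel_measurable_indicator) auto
  qed
  have "(\<integral>\<^sup>+x. \<integral>\<^sup>+y. indicator {y. x \<bullet> y > cos \<theta>} y * ennreal ((cmod (f x - f y))\<^sup>2) \<partial>\<sigma> \<partial>\<sigma>)
      = (\<integral>\<^sup>+x. \<integral>\<^sup>+y. k (x, y) \<partial>\<sigma> \<partial>\<sigma>)"
    by (intro nn_integral_cong) (simp add: k_def F_def c_def indicator_def)
  also have "\<dots> = (\<integral>\<^sup>+p. k p \<partial>\<Sigma>)" unfolding \<Sigma>_def by (rule I.nn_integral_pair[OF k, symmetric])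
  also have "\<dots> = (\<integral>\<^sup>+p. indicator I p * h (fst p \<bullet> snd p, gram_schmidt p) \<partial>\<Sigma>)"
  proof (rule nn_integral_cong)
    fix p assume "p \<in> space \<Sigma>"
    then obtain x y where p: "p = (x, y)" and xy: "norm x = 1" "norm y = 1"
      by (auto simp: \<Sigma>_def space_pair_measure)
    show "k p = indicator I p * h (fst p \<bullet> snd p, gram_schmidt p)"
    \<comment> \<open>The diagonal lies outside the range of polar coordinates, but the difference
      vanishes there. Antipodal pairs do not occur in the cap because \<open>c > -1\<close>.\<close>
    proof (cases "x = y")
      case True
      then show ?thesis using xy by (simp add: p k_def I_def pairs_with_inner_def norm_eq_1)
    next
      case False
      have "x \<bullet> y \<noteq> 1"
      proof
        assume "x \<bullet> y = 1"
        then have "(norm (x - y))\<^sup>2 = 0" using xy by (simp add: power2_norm_eq_inner inner_diff_left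
            inner_diff_right inner_commute norm_eq_1)
        with False show False by simp
      qed
      moreover have "\<bar>x \<bullet> y\<bar> \<le> 1" using Cauchy_Schwarz_ineq2[of x y] xy by simp
      ultimately have 1: "x \<bullet> y < 1" by simp
      show ?thesis
      proof (cases "x \<bullet> y > c")
        case True
        then have "\<bar>x \<bullet> y\<bar> < 1" "-1 < x \<bullet> y" using 1 c by simp_all
        then show ?thesis
          using True xy geodesic_point_polar[OF xy]
            by (simp add: p k_def h_def I_def pairs_with_inner_def gram_schmidt_def indicator_def 1)
      next
        case False
        then show ?thesis by (simp add: p k_def h_def)
      qed
    qed
  qed
  also have "\<dots> = (\<integral>\<^sup>+t. \<integral>\<^sup>+q. h (t, q) \<partial>liouville \<partial>\<Lambda>)"
    unfolding \<Lambda>_def P_def \<Sigma>_def I_def by (rule polar_coordinates[OF h])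
  also have "\<dots> \<le> (\<integral>\<^sup>+t. ennreal B * indicator {c<..} t \<partial>\<Lambda>)"
  proof (rule nn_integral_mono_AE)
    have inner: "(\<lambda>p. fst p \<bullet> snd p) \<in> P \<rightarrow>\<^sub>M borel"
      using I.measurable_pair[OF borel_inner_pair] by (simp add: P_def \<Sigma>_def)
    have "fst p \<bullet> snd p < 1" if "0 < (indicator I p :: ennreal)" for p
      using that by (cases "p \<in> I") (auto simp: I_def pairs_with_inner_def)
    then have "AE p in P. fst p \<bullet> snd p < 1"
      unfolding P_def \<Sigma>_def AE_density[OF I.indicator_D] by simp
    then have "AE t in \<Lambda>. t < 1"
      unfolding \<Lambda>_def using inner by (subst AE_distr_iff) auto
    then show "AE t in \<Lambda>. (\<integral>\<^sup>+q. h (t, q) \<partial>liouville) \<le> ennreal B * indicator {c<..} t"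
    proof eventually_elim
      case (elim t)
      show ?case
      proof (cases "c < t")
        case True
        have t: "\<bar>t\<bar> < 1" using c(1) True elim by linarith
        define \<phi> where "\<phi> = arccos t"
        have \<phi>: "0 < \<phi>" "\<phi> < \<theta>" "cos \<phi> = t"
        proof -
          show "cos \<phi> = t" unfolding \<phi>_def using t by (intro cos_arccos) auto
          show "0 < \<phi>" using arccos_less_arccos[of t 1] t by (simp add: \<phi>_def)
          have "\<phi> < arccos c" unfolding \<phi>_def using c True t by (intro arccos_less_arccos) auto
          then show "\<phi> < \<theta>" using \<theta> by (simp add: c_def arccos_cos)
        qed
        have "sin \<phi> = sqrt (1 - t\<^sup>2)"
          using t by (simp add: \<phi>_def sin_arccos)
        then have gp: "fst (geodesic (cos \<phi>) (sin \<phi>) q) = geodesic_point t q" for q :: "'a \<times> 'a"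
          by (simp add: geodesic_point_eq \<phi>)
        have L: "(\<lambda>q. F (fst q) - F (geodesic_point t q)) \<in> L2 liouville"
          unfolding F_def by (intro L2_diff L2_liouville_fst L2_liouville_geodesic_point dim t fL)
        have "(\<integral>\<^sup>+q. h (t, q) \<partial>liouville) = ennreal (energy f \<phi>)"
          using True nn_integral_L2_sq[OF L] by (simp add: h_def energy_def gp F_def)
        also have "energy f \<phi> \<le> \<phi>\<^sup>2 * R * L2_sq \<sigma> f / w"
          unfolding w_def using \<phi> \<theta> by (intro energy_LB_bounded dim f R) auto
        also have "\<dots> \<le> B"
          unfolding B_def using \<phi> R w by (intro divide_right_mono mult_right_mono power_mono) auto
        finally show ?thesis using True by (simp add: ennreal_leI)
      qed (simp add: h_def)
    qed
  qed
  also have "\<dots> = ennreal B * (\<integral>\<^sup>+t. indicator {c<..} t \<partial>\<Lambda>)"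
    by (rule nn_integral_cmult) (simp add: \<Lambda>_def)
  also have "(\<integral>\<^sup>+t. indicator {c<..} t \<partial>\<Lambda>) \<le> ennreal (cap_area TYPE('a) c * w)"
  proof -
    have ind: "(\<lambda>p. indicator {c<..} (fst p \<bullet> snd p) :: ennreal) \<in> borel_measurable (borel ::
        ('a \<times> 'a) measure)"
      by (intro measurable_compose[OF borel_inner_pair] borel_measurable_indicator) auto
    have inner: "(\<lambda>p. fst p \<bullet> snd p) \<in> P \<rightarrow>\<^sub>M borel"
      using I.measurable_pair[OF borel_inner_pair] by (simp add: P_def \<Sigma>_def)
    have "(\<integral>\<^sup>+t. indicator {c<..} t \<partial>\<Lambda>) = (\<integral>\<^sup>+p. indicator {c<..} (fst p \<bullet> snd p) \<partial>P)"
      unfolding \<Lambda>_def using inner by (subst nn_integral_distr) auto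
    also have "\<dots> = (\<integral>\<^sup>+p. indicator I p * indicator {c<..} (fst p \<bullet> snd p) \<partial>\<Sigma>)"
      unfolding P_def \<Sigma>_def by (rule nn_integral_density[OF I.indicator_D I.measurable_pair[OF ind]])
    also have "\<dots> \<le> (\<integral>\<^sup>+p. indicator {c<..} (fst p \<bullet> snd p) \<partial>\<Sigma>)"
      by (intro nn_integral_mono) (simp add: indicator_def)
    also have "\<dots> = (\<integral>\<^sup>+x. \<integral>\<^sup>+y. indicator {y. x \<bullet> y > c} y \<partial>\<sigma> \<partial>(\<sigma> :: 'a measure))"
      unfolding \<Sigma>_def by (subst I.nn_integral_pair[OF ind]) (simp add: indicator_def[abs_def])
    also have "\<dots> = (\<integral>\<^sup>+x. ennreal (cap_area TYPE('a) c) \<partial>(\<sigma> :: 'a measure))"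
      by (intro nn_integral_cong) (simp add: nn_integral_cap)
    also have "\<dots> = ennreal (cap_area TYPE('a) c * w)"
      by (simp add: sphere.emeasure_eq_measure w_def ennreal_mult cap_area_def)
    finally show ?thesis .
  qed
  also have "ennreal B * ennreal (cap_area TYPE('a) c * w) = ennreal (cap_area TYPE('a) (cos \<theta>) * \<theta>\<^sup>2
      * R * L2_sq \<sigma> f)"
    using B w by (simp add: ennreal_mult[symmetric] cap_area_def) (simp add: B_def c_def field_simps)
  finally show ?thesis by (simp add: mult_left_mono)
qed

end

section \<open>Functions of exponential type form a finite-dimensional space\<close>

text \<open>Complex-valued so that it can be an element of \<open>L2\<close>; pairing
  \<open>f\<close> with it integrates \<open>f\<close> over the cap about \<open>x\<close>, which is
  the cap average without normalisation.\<close>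

definition cap_indicator :: "real \<Rightarrow> 'a::euclidean_space \<Rightarrow> 'a \<Rightarrow> complex" where
  "cap_indicator t x y = (if x \<bullet> y > t then 1 else 0)"

context
  assumes dim: "2 \<le> DIM('a::euclidean_space)"
begin

lemma borel_cap_indicator:
  "(\<lambda>p. cap_indicator t (fst p) (snd p)) \<in> borel_measurable (borel :: ('a \<times> 'a) measure)"
proof -
  have "{p :: 'a \<times> 'a. t < fst p \<bullet> snd p} \<in> sets borel"
    by (intro borel_open open_Collect_less continuous_intros)
  then show ?thesis
    unfolding cap_indicator_def by (intro measurable_If) (auto simp: pred_def)
qed

lemma cap_indicator_L2_mult:
  fixes x :: 'a
  assumes "f \<in> L2 \<sigma>"
  shows "(\<lambda>y. cap_indicator t x y * f y) \<in> L2 \<sigma>"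
proof -
  have "(\<lambda>y. (x, y)) \<in> borel \<rightarrow>\<^sub>M (borel :: ('a \<times> 'a) measure)" by (simp add: borel_prod[symmetric])
  from measurable_compose[OF this borel_cap_indicator[of t]]
  have "cap_indicator t x \<in> borel_measurable borel" by simp
  then have "cap_indicator t x \<in> borel_measurable \<sigma>" by (rule measurable_sphere_measureI)
  then have m: "(\<lambda>y. cap_indicator t x y * f y) \<in> borel_measurable \<sigma>"
    using assms by (auto simp: L2_def)
  have "integrable \<sigma> (\<lambda>y. (cmod (cap_indicator t x y * f y))\<^sup>2)"
  proof (rule Bochner_Integration.integrable_bound[OF L2_integrable_sq[OF assms]])
    show "(\<lambda>y. (cmod (cap_indicator t x y * f y))\<^sup>2) \<in> borel_measurable \<sigma>" using m by simp
    show "AE y in sphere_measure. norm ((cmod (cap_indicator t x y * f y))\<^sup>2) \<le> norm ((cmod (f y))\<^sup>2)"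
      by (simp add: cap_indicator_def)
  qed
  with m show ?thesis by (simp add: L2_def)
qed

lemma L2_const: "(\<lambda>_. c) \<in> L2 (\<sigma> :: 'a measure)"
  by (simp add: L2_def)

lemma cap_indicator_L2: "cap_indicator t (x :: 'a) \<in> L2 \<sigma>"
  using cap_indicator_L2_mult[OF L2_const[of 1], of t x] by simp

lemma L2_sq_cap_indicator:
  fixes x :: 'a
  assumes x: "norm x = 1"
  shows "L2_sq \<sigma> (cap_indicator t x) = cap_area TYPE('a) t"
proof -
  have "ennreal (L2_sq \<sigma> (cap_indicator t x)) = (\<integral>\<^sup>+y. indicator {y. x \<bullet> y > t} y \<partial>\<sigma>)"
    by (subst nn_integral_L2_sq[OF cap_indicator_L2, symmetric], intro nn_integral_cong) (simp add:
        cap_indicator_def)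
  then show ?thesis by (simp add: nn_integral_cap[OF dim x] cap_area_def)
qed

lemma measurable_L2_dot_cap_indicator:
  fixes f :: "'a \<Rightarrow> complex"
  assumes f: "f \<in> L2 \<sigma>"
  shows "(\<lambda>x. L2_dot \<sigma> f (cap_indicator t x)) \<in> borel_measurable \<sigma>"
proof -
  define F where "F = zero_extension f"
  have F: "F \<in> borel_measurable borel" unfolding F_def by (rule L2_sphere_borel[OF f])
  have "(\<lambda>p. F (snd p) * cnj (cap_indicator t (fst p) (snd p))) \<in> borel_measurable (\<sigma> \<Otimes>\<^sub>M \<sigma>)"
    by (intro measurable_pair_borelI[OF id_sphere_borel id_sphere_borel] borel_measurable_times
        borel_measurable_cnj
        measurable_compose[OF borel_snd F] borel_cap_indicator)
  then have "(\<lambda>x. LINT y|sphere_measure. F y * cnj (cap_indicator t x y)) \<in> borel_measurable \<sigma>"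
    by (intro sphere.borel_measurable_lebesgue_integral) (simp add: case_prod_unfold)
  moreover have "(\<lambda>x. LINT y|sphere_measure. F y * cnj (cap_indicator t x y)) =
      (\<lambda>x. L2_dot \<sigma> f (cap_indicator t x))"
    unfolding L2_dot_def by (intro ext Bochner_Integration.integral_cong) (auto simp: F_def)
  ultimately show ?thesis by simp
qed

text \<open>For fixed \<open>x\<close>, integrate over the cap: \<open>\<kappa> * f x\<close> is the
  integral of \<open>f\<close> plus the integral of \<open>f x - f y\<close>. The oscillation
  estimate makes the latter small enough to be absorbed.\<close>

lemma cap_average_lower_bound:
  fixes f :: "'a \<Rightarrow> complex"
  assumes f: "f \<in> LB_bounded R" and R: "0 < R" and \<theta>: "0 < \<theta>" "\<theta> < pi" "\<theta>\<^sup>2 * R \<le> 1 / 4"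
  defines "\<kappa> \<equiv> cap_area TYPE('a) (cos \<theta>)"
  shows "ennreal (\<kappa>\<^sup>2 / 4 * L2_sq \<sigma> f) \<le>
    (\<integral>\<^sup>+x. ennreal ((cmod (L2_dot \<sigma> f (cap_indicator (cos \<theta>) x)))\<^sup>2) \<partial>\<sigma>)"
proof -
  define t where "t = cos \<theta>"
  have \<kappa>: "0 \<le> \<kappa>" by (simp add: \<kappa>_def cap_area_def)
  have fL: "f \<in> L2 \<sigma>" using f by (simp add: LB_bounded_def)
  define F where "F = zero_extension f"
  have F: "F \<in> borel_measurable borel" unfolding F_def by (rule L2_sphere_borel[OF fL])
  define D where "D x = L2_dot \<sigma> f (cap_indicator t x)" for x
  define V where "V x = (\<integral>\<^sup>+y. indicator {y. x \<bullet> y > t} y * ennreal ((cmod (f x - f y))\<^sup>2) \<partial>\<sigma>)" for x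
  have id_sphere_borel: "(\<lambda>x. x) \<in> \<sigma> \<rightarrow>\<^sub>M (borel :: 'a measure)" by (rule measurable_sphere_measureI) simp
  have D_meas: "D \<in> borel_measurable \<sigma>"
    unfolding D_def by (rule measurable_L2_dot_cap_indicator[OF fL])
  have V_meas: "V \<in> borel_measurable \<sigma>"
  proof -
    have "indicator {p. t < fst p \<bullet> snd p} \<in> borel_measurable (borel :: ('a \<times> 'a) measure)"
      by (intro borel_measurable_indicator borel_open open_Collect_less continuous_intros)
    moreover have "(\<lambda>p. F (fst p) - F (snd p)) \<in> borel_measurable (borel :: ('a \<times> 'a) measure)"
      by (intro borel_measurable_diff measurable_compose[OF borel_fst F] measurable_compose[OF
          borel_snd F])
    ultimately have "(\<lambda>p. indicator {p. t < fst p \<bullet> snd p} p * ennreal ((cmod (F (fst p) - F (snd p)))\<^sup>2))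
        \<in> borel_measurable (borel :: ('a \<times> 'a) measure)"
      by (intro borel_measurable_times_ennreal) auto
    from measurable_pair_borelI[OF id_sphere_borel id_sphere_borel this]
    have "(\<lambda>x. \<integral>\<^sup>+y. indicator {y. t < x \<bullet> y} y * ennreal ((cmod (F x - F y))\<^sup>2) \<partial>\<sigma>) \<in> borel_measurable \<sigma>"
      by (intro sphere.borel_measurable_nn_integral) (simp add: case_prod_unfold indicator_def)
    then show ?thesis
      by (rule measurable_cong[THEN iffD1, rotated]) (auto simp: V_def F_def intro!: nn_integral_cong)
  qed
  have pointwise: "ennreal (\<kappa>\<^sup>2 * (cmod (f x))\<^sup>2) \<le> ennreal (2 * \<kappa>) * V x + 2 * ennreal ((cmod (D x))\<^sup>2)"
    if x: "norm x = 1" for x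
  proof -
    define u where "u y = cap_indicator t x y * (f x - f y)" for y
    have u: "u \<in> L2 \<sigma>"
      unfolding u_def by (intro cap_indicator_L2_mult L2_diff L2_const fL)
    have Vx: "V x = ennreal (L2_sq \<sigma> u)"
      unfolding V_def by (subst nn_integral_L2_sq[OF u, symmetric], intro nn_integral_cong)
        (simp add: u_def cap_indicator_def)
    have "L2_dot \<sigma> u (cap_indicator t x) = L2_dot \<sigma> (\<lambda>y. f x * 1 - f y) (cap_indicator t x)"
      unfolding L2_dot_def by (intro Bochner_Integration.integral_cong) (auto
          simp: u_def cap_indicator_def)
    also have "\<dots> = f x * L2_dot \<sigma> (\<lambda>_. 1) (cap_indicator t x) - D x"
      using L2_dot_diff[OF L2_const fL cap_indicator_L2, of "f x * 1" t x] L2_dot_scale[of \<sigma> "f x"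
          "\<lambda>_. 1" "cap_indicator t x"]
      by (simp add: D_def)
    also have "L2_dot \<sigma> (\<lambda>_. 1) (cap_indicator t x) = L2_dot \<sigma> (cap_indicator t x) (cap_indicator t x)"
      unfolding L2_dot_def by (intro Bochner_Integration.integral_cong) (auto simp: cap_indicator_def)
    also have "\<dots> = complex_of_real \<kappa>"
      by (simp add: L2_dot_self L2_sq_cap_indicator[OF x] \<kappa>_def t_def)
    finally have eq: "f x * complex_of_real \<kappa> = L2_dot \<sigma> u (cap_indicator t x) + D x" by simp
    have "\<kappa>\<^sup>2 * (cmod (f x))\<^sup>2 = (cmod (f x * complex_of_real \<kappa>))\<^sup>2"
      by (simp add: norm_mult power_mult_distrib)
    also have "\<dots> \<le> 2 * (cmod (L2_dot \<sigma> u (cap_indicator t x)))\<^sup>2 + 2 * (cmod (D x))\<^sup>2"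
      unfolding eq by (rule norm_add_sq_le)
    also have "(cmod (L2_dot \<sigma> u (cap_indicator t x)))\<^sup>2 \<le> L2_sq \<sigma> u * \<kappa>"
      using L2_cauchy_schwarz[OF u cap_indicator_L2, of t x] by (simp add: L2_sq_cap_indicator[OF x]
          \<kappa>_def t_def)
    finally have "\<kappa>\<^sup>2 * (cmod (f x))\<^sup>2 \<le> 2 * \<kappa> * L2_sq \<sigma> u + 2 * (cmod (D x))\<^sup>2" by (simp add: ac_simps)
    then have "ennreal (\<kappa>\<^sup>2 * (cmod (f x))\<^sup>2) \<le> ennreal (2 * \<kappa> * L2_sq \<sigma> u + 2 * (cmod (D x))\<^sup>2)"
      by (rule ennreal_leI)
    also have "\<dots> = ennreal (2 * \<kappa>) * V x + 2 * ennreal ((cmod (D x))\<^sup>2)"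
      using \<kappa> by (simp add: Vx ennreal_plus ennreal_mult)
    finally show ?thesis .
  qed
  define N where "N = (\<integral>\<^sup>+x. ennreal ((cmod (D x))\<^sup>2) \<partial>\<sigma>)"
  have "ennreal (\<kappa>\<^sup>2 * L2_sq \<sigma> f) = (\<integral>\<^sup>+x. ennreal (\<kappa>\<^sup>2 * (cmod (f x))\<^sup>2) \<partial>\<sigma>)"
    using L2_measurable[OF fL] by (simp add: ennreal_mult nn_integral_cmult nn_integral_L2_sq[OF fL])
  also have "\<dots> \<le> (\<integral>\<^sup>+x. ennreal (2 * \<kappa>) * V x + 2 * ennreal ((cmod (D x))\<^sup>2) \<partial>\<sigma>)"
    by (intro nn_integral_mono pointwise) simp
  also have "\<dots> = ennreal (2 * \<kappa>) * (\<integral>\<^sup>+x. V x \<partial>\<sigma>) + 2 * N"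
    using V_meas D_meas by (simp add: nn_integral_add nn_integral_cmult N_def)
  \<comment> \<open>The total oscillation is at most \<open>\<kappa> / 4\<close> times the square
    norm of \<open>f\<close>; with the factor \<open>2 * \<kappa>\<close> this is half of the left
    side.\<close>
  also have "\<dots> \<le> ennreal (\<kappa>\<^sup>2 / 2 * L2_sq \<sigma> f) + 2 * N"
  proof (intro add_right_mono)
    have "(\<integral>\<^sup>+x. V x \<partial>\<sigma>) \<le> ennreal (\<kappa> * \<theta>\<^sup>2 * R * L2_sq \<sigma> f)"
      unfolding V_def \<kappa>_def t_def by (rule cap_oscillation_le[OF dim f R \<theta>(1,2)])
    also have "\<dots> \<le> ennreal (\<kappa> * (1 / 4) * L2_sq \<sigma> f)"
    proof (rule ennreal_leI)
      have "\<kappa> * (\<theta>\<^sup>2 * R) * L2_sq \<sigma> f \<le> \<kappa> * (1 / 4) * L2_sq \<sigma> f"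
        using \<kappa> \<theta>(3) by (intro mult_right_mono mult_left_mono) auto
      then show "\<kappa> * \<theta>\<^sup>2 * R * L2_sq \<sigma> f \<le> \<kappa> * (1 / 4) * L2_sq \<sigma> f" by (simp add: mult.assoc)
    qed
    finally have "ennreal (2 * \<kappa>) * (\<integral>\<^sup>+x. V x \<partial>\<sigma>) \<le> ennreal (2 * \<kappa>) * ennreal (\<kappa> * (1 / 4) * L2_sq \<sigma> f)"
      by (rule mult_left_mono) simp
    also have "\<dots> = ennreal (\<kappa>\<^sup>2 / 2 * L2_sq \<sigma> f)"
      using \<kappa> by (subst ennreal_mult[symmetric]) (auto simp: power2_eq_square)
    finally show "ennreal (2 * \<kappa>) * (\<integral>\<^sup>+x. V x \<partial>\<sigma>) \<le> ennreal (\<kappa>\<^sup>2 / 2 * L2_sq \<sigma> f)" .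
  qed
  finally have main: "ennreal (\<kappa>\<^sup>2 * L2_sq \<sigma> f) \<le> ennreal (\<kappa>\<^sup>2 / 2 * L2_sq \<sigma> f) + 2 * N" .
  \<comment> \<open>After absorption half of the left side remains, and the factor 2 in front of
    \<open>N\<close> turns this half into a quarter. For infinite \<open>N\<close> no subtraction is
    possible, but then the claim is trivial.\<close>
  have "ennreal (\<kappa>\<^sup>2 / 4 * L2_sq \<sigma> f) \<le> N"
  proof (cases N)
    case (real n)
    have "ennreal (\<kappa>\<^sup>2 / 2 * L2_sq \<sigma> f) + 2 * N = ennreal (\<kappa>\<^sup>2 / 2 * L2_sq \<sigma> f + 2 * n)"
      using real by (simp add: ennreal_plus ennreal_mult)
    with main have "ennreal (\<kappa>\<^sup>2 * L2_sq \<sigma> f) \<le> ennreal (\<kappa>\<^sup>2 / 2 * L2_sq \<sigma> f + 2 * n)"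
      by simp
    then have "\<kappa>\<^sup>2 * L2_sq \<sigma> f \<le> \<kappa>\<^sup>2 / 2 * L2_sq \<sigma> f + 2 * n"
      using real by (subst (asm) ennreal_le_iff) auto
    then show ?thesis using real by (simp add: ennreal_leI)
  qed simp
  then show ?thesis by (simp add: N_def D_def t_def)
qed

text \<open>A Hilbert-Schmidt count. At each \<open>x\<close>, Bessel's inequality for the cap
  indicator bounds the sum of the squared cap integrals by \<open>\<kappa>\<close>, while each
  member of the family contributes at least \<open>\<kappa>\<^sup>2 / 4\<close> to the integral over
  \<open>x\<close>.\<close>

lemma orthonormal_family_bound:
  fixes e :: "nat \<Rightarrow> 'a \<Rightarrow> complex"
  assumes e: "orthonormal_family \<sigma> d e" and LB: "\<And>i. i < d \<Longrightarrow> e i \<in> LB_bounded R"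
    and R: "0 < R" and \<theta>: "0 < \<theta>" "\<theta> < pi" "\<theta>\<^sup>2 * R \<le> 1 / 4"
  defines "\<kappa> \<equiv> cap_area TYPE('a) (cos \<theta>)"
  shows "real d * (\<kappa> / 4) \<le> sphere_area TYPE('a)"
proof -
  have "cos \<theta> < 1" using \<theta> cos_monotone_0_pi[of 0 \<theta>] by simp
  then have \<kappa>: "0 < \<kappa>" unfolding \<kappa>_def by (rule cap_area_pos[OF dim])
  define D where "D i x = cmod (L2_dot \<sigma> (e i) (cap_indicator (cos \<theta>) x))" for i x
  have eL: "e i \<in> L2 \<sigma>" and e1: "L2_sq \<sigma> (e i) = 1" if "i < d" for i
    using e that L2_dot_self[of \<sigma> "e i"] by (auto simp: orthonormal_family_def)
  have "ennreal (real d * (\<kappa>\<^sup>2 / 4)) = ennreal (\<Sum>i<d. \<kappa>\<^sup>2 / 4 * L2_sq \<sigma> (e i))"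
    by (simp add: e1)
  also have "\<dots> = (\<Sum>i<d. ennreal (\<kappa>\<^sup>2 / 4 * L2_sq \<sigma> (e i)))"
    by (rule sum_ennreal[symmetric]) simp
  also have "\<dots> \<le> (\<Sum>i<d. \<integral>\<^sup>+x. ennreal ((D i x)\<^sup>2) \<partial>\<sigma>)"
    unfolding D_def \<kappa>_def by (intro sum_mono cap_average_lower_bound[OF LB R \<theta>]) auto
  also have "\<dots> = (\<integral>\<^sup>+x. (\<Sum>i<d. ennreal ((D i x)\<^sup>2)) \<partial>\<sigma>)"
  proof (rule nn_integral_sum[symmetric])
    fix i assume "i \<in> {..<d}"
    then show "(\<lambda>x. ennreal ((D i x)\<^sup>2)) \<in> borel_measurable \<sigma>"
      using measurable_L2_dot_cap_indicator[OF eL] by (simp add: D_def)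
  qed
  also have "\<dots> \<le> (\<integral>\<^sup>+x. ennreal \<kappa> \<partial>(\<sigma> :: 'a measure))"
  proof (rule nn_integral_mono)
    fix x :: 'a assume "x \<in> space \<sigma>"
    then have x: "norm x = 1" by simp
    have "(\<Sum>i<d. (D i x)\<^sup>2) = (\<Sum>i<d. (cmod (L2_dot \<sigma> (cap_indicator (cos \<theta>) x) (e i)))\<^sup>2)"
      unfolding D_def by (subst L2_dot_commute) (simp only: complex_mod_cnj)
    also have "\<dots> \<le> \<kappa>"
      using bessel[OF e cap_indicator_L2, of "cos \<theta>" x] by (simp add: L2_sq_cap_indicator[OF x] \<kappa>_def)
    finally show "(\<Sum>i<d. ennreal ((D i x)\<^sup>2)) \<le> ennreal \<kappa>" by (simp add: sum_ennreal ennreal_leI)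
  qed
  also have "\<dots> = ennreal (\<kappa> * sphere_area TYPE('a))"
    using \<kappa> by (simp add: sphere.emeasure_eq_measure ennreal_mult)
  finally have "real d * (\<kappa>\<^sup>2 / 4) \<le> \<kappa> * sphere_area TYPE('a)"
    using \<kappa> by (subst (asm) ennreal_le_iff) auto
  then have "\<kappa> * (real d * (\<kappa> / 4)) \<le> \<kappa> * sphere_area TYPE('a)" by (simp add: power2_eq_square ac_simps)
  then show ?thesis using \<kappa> by (simp only: mult_le_cancel_left_pos)
qed

text \<open>Only almost everywhere: on exceptional rims \<open>f\<close> or \<open>g\<close> may
  fail to be integrable, and the Bochner integral then takes the value 0. The difference
  \<open>d\<close> of the two sides is shown to be orthogonal to itself, using linearity on the unit
  tangent bundle.\<close>

lemma rim_mean_linear: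
  fixes f g :: "'a \<Rightarrow> complex"
  assumes t: "\<bar>t\<bar> < 1" and f: "f \<in> L2 \<sigma>" and g: "g \<in> L2 \<sigma>"
  shows "AE x in sphere_measure. rim_mean t (\<lambda>x. a * f x + b * g x) x =
      a * rim_mean t f x + b * rim_mean t g x"
proof -
  define k where "k = (\<lambda>x. a * f x + b * g x)"
  have k: "k \<in> L2 \<sigma>" unfolding k_def by (intro L2_add L2_scale f g)
  define d where "d = (\<lambda>x. rim_mean t k x - (a * rim_mean t f x + b * rim_mean t g x))"
  have S: "rim_mean t k \<in> L2 \<sigma>" "rim_mean t f \<in> L2 \<sigma>" "rim_mean t g \<in> L2 \<sigma>"
    by (intro L2_rim_mean dim t k f g)+
  have comb: "(\<lambda>x. a * rim_mean t f x + b * rim_mean t g x) \<in> L2 \<sigma>" by (intro L2_add L2_scale S)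
  have d: "d \<in> L2 \<sigma>" unfolding d_def by (intro L2_diff S comb)
  let ?L = "\<lambda>u. L2_dot liouville (\<lambda>p. zero_extension u (geodesic_point t p)) (\<lambda>p. zero_extension d
      (fst p))"
  have ext: "zero_extension k = (\<lambda>x. a * zero_extension f x + b * zero_extension g x)"
    by (simp add: zero_extension_def k_def fun_eq_iff)
  have L: "?L k = a * ?L f + b * ?L g"
    unfolding ext using L2_liouville_geodesic_point[OF dim t f] L2_liouville_geodesic_point[OF dim t
        g] L2_liouville_fst[OF dim d]
    by (simp add: L2_dot_add L2_scale L2_dot_scale)
  have "L2_dot \<sigma> d d = L2_dot \<sigma> (rim_mean t k) d -
      (a * L2_dot \<sigma> (rim_mean t f) d + b * L2_dot \<sigma> (rim_mean t g) d)"
    using L2_dot_diff[OF S(1) comb d] L2_dot_add[OF L2_scale[OF S(2)] L2_scale[OF S(3)] d, of a b]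
    by (simp add: d_def L2_dot_scale)
  also have "\<dots> = 0"
    by (simp add: L2_dot_rim_mean[OF dim t _ d] k f g L algebra_simps)
  finally have "L2_sq \<sigma> d = 0" by (simp add: L2_dot_self)
  then have "AE x in sphere_measure. d x = 0" using L2_sq_eq_0[OF d] by simp
  then show ?thesis by eventually_elim (simp add: d_def k_def)
qed

lemma L2_norm_sphere_tendsto_0:
  "((\<lambda>t. L2_norm (\<sigma> :: 'a measure) (Q t)) \<longlongrightarrow> 0) F \<longleftrightarrow> ((\<lambda>t. L2_sq \<sigma> (Q t)) \<longlongrightarrow> 0) F"
proof
  have w: "0 < sphere_area TYPE('a)" by (rule measure_sphere_pos)
  assume "((\<lambda>t. L2_norm (\<sigma> :: 'a measure) (Q t)) \<longlongrightarrow> 0) F"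
  then have "((\<lambda>t. sphere_area TYPE('a) * (L2_norm \<sigma> (Q t))\<^sup>2) \<longlongrightarrow> sphere_area TYPE('a) * 0\<^sup>2) F"
    by (intro tendsto_intros)
  then show "((\<lambda>t. L2_sq \<sigma> (Q t)) \<longlongrightarrow> 0) F"
    using w by (simp add: L2_norm_sphere)
next
  assume "((\<lambda>t. L2_sq (\<sigma> :: 'a measure) (Q t)) \<longlongrightarrow> 0) F"
  then have "((\<lambda>t. sqrt (L2_sq (\<sigma> :: 'a measure) (Q t) * inverse (sphere_area TYPE('a)))) \<longlongrightarrow>
      sqrt (0 * inverse (sphere_area TYPE('a)))) F"
    by (intro tendsto_intros)
  then show "((\<lambda>t. L2_norm (\<sigma> :: 'a measure) (Q t)) \<longlongrightarrow> 0) F"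
    by (simp add: L2_norm_sphere field_class.field_divide_inverse)
qed

text \<open>\<open>Q\<close> is the error of the difference quotient. The error of a combination is
  almost everywhere the combination of the errors, and the crude bound by twice the sum of squares
  still tends to 0.\<close>

lemma has_LB_derivative_linear:
  fixes f g f' g' :: "'a \<Rightarrow> complex"
  assumes fg: "has_LB_derivative f g" and fg': "has_LB_derivative f' g'"
  shows "has_LB_derivative (\<lambda>x. a * f x + b * f' x) (\<lambda>x. a * g x + b * g' x)"
proof -
  note L = has_LB_derivativeD[OF fg] has_LB_derivativeD[OF fg']
  define k where "k = (\<lambda>x. a * f x + b * f' x)"
  define l where "l = (\<lambda>x. a * g x + b * g' x)"
  have kl: "k \<in> L2 \<sigma>" "l \<in> L2 \<sigma>" unfolding k_def l_def by (intro L2_add L2_scale L)+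
  define Q where "Q f g t = (\<lambda>x. (f x - rim_mean t f x) / complex_of_real (1 - t) - g x)" for f g ::
      "'a \<Rightarrow> complex" and t :: real
  have QL: "Q f g t \<in> L2 \<sigma>" if "\<bar>t\<bar> < 1" "f \<in> L2 \<sigma>" "g \<in> L2 \<sigma>"
    for f g :: "'a \<Rightarrow> complex" and t
  proof -
    have "(\<lambda>x. inverse (complex_of_real (1 - t)) * (f x - rim_mean t f x) - g x) \<in> L2 \<sigma>"
      using that by (intro L2_diff L2_scale L2_rim_mean dim)
    then show ?thesis by (simp add: Q_def field_class.field_divide_inverse mult.commute)
  qed
  have lim: "((\<lambda>t. L2_sq \<sigma> (Q f g t)) \<longlongrightarrow> 0) (at_left 1)" "((\<lambda>t. L2_sq \<sigma> (Q f' g' t)) \<longlongrightarrow> 0) (at_left 1)"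
    using fg fg' unfolding has_LB_derivative_def Q_def L2_norm_sphere_tendsto_0[symmetric] by auto
  have bound: "L2_sq \<sigma> (Q k l t) \<le>
      2 * ((cmod a)\<^sup>2 * L2_sq \<sigma> (Q f g t)) + 2 * ((cmod b)\<^sup>2 * L2_sq \<sigma> (Q f' g' t))"
    if t: "\<bar>t\<bar> < 1" for t
  proof -
    note q = QL[OF t L(1,2)] QL[OF t L(3,4)] QL[OF t kl]
    have "AE x in sphere_measure. Q k l t x = a * Q f g t x + b * Q f' g' t x"
      using rim_mean_linear[OF t L(1,3), of a b]
      by eventually_elim (simp add: Q_def k_def l_def diff_divide_distrib add_divide_distrib
          algebra_simps)
    then have "AE x in sphere_measure. (cmod (Q k l t x))\<^sup>2 \<le> 2 * ((cmod a)\<^sup>2 * (cmod (Q f g t x))\<^sup>2) +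
        2 * ((cmod b)\<^sup>2 * (cmod (Q f' g' t x))\<^sup>2)"
    proof eventually_elim
      case (elim x)
      show ?case using norm_add_sq_le[of "a * Q f g t x" "b * Q f' g' t x"]
        by (simp add: elim norm_mult power_mult_distrib)
    qed
    then have "L2_sq \<sigma> (Q k l t) \<le>
        (LINT x|sphere_measure. 2 * ((cmod a)\<^sup>2 * (cmod (Q f g t x))\<^sup>2) + 2 * ((cmod b)\<^sup>2 * (cmod (Q f'
            g' t x))\<^sup>2))"
      unfolding L2_sq_def using L2_integrable_sq[OF q(1)] L2_integrable_sq[OF q(2)]
          L2_integrable_sq[OF q(3)]
      by (intro integral_mono_AE) auto
    also have "\<dots> = 2 * ((cmod a)\<^sup>2 * L2_sq \<sigma> (Q f g t)) + 2 * ((cmod b)\<^sup>2 * L2_sq \<sigma> (Q f' g' t))"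
      using q by (simp add: L2_sq_def L2_integrable_sq)
    finally show ?thesis .
  qed
  have "((\<lambda>t. 2 * ((cmod a)\<^sup>2 * L2_sq \<sigma> (Q f g t)) + 2 * ((cmod b)\<^sup>2 * L2_sq \<sigma> (Q f' g' t))) \<longlongrightarrow>
      2 * ((cmod a)\<^sup>2 * 0) + 2 * ((cmod b)\<^sup>2 * 0)) (at_left 1)"
    by (intro tendsto_intros lim)
  then have "((\<lambda>t. L2_sq \<sigma> (Q k l t)) \<longlongrightarrow> 0) (at_left 1)"
    using eventually_mono[OF eventually_at_left_1 bound]
    by (rule_tac tendsto_sandwich[OF always_eventually _ tendsto_const]) auto
  then have "has_LB_derivative k l"
    using kl unfolding has_LB_derivative_def Q_def L2_norm_sphere_tendsto_0[symmetric] by auto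
  then show ?thesis by (simp add: k_def l_def)
qed

lemma has_LB_derivative_power_linear:
  fixes f g f' g' :: "'a \<Rightarrow> complex"
  assumes "(has_LB_derivative ^^ N) f g" and "(has_LB_derivative ^^ N) f' g'"
  shows "(has_LB_derivative ^^ N) (\<lambda>x. a * f x + b * f' x) (\<lambda>x. a * g x + b * g' x)"
  using assms
proof (induction N arbitrary: g g')
  case (Suc N)
  obtain h h' where h: "(has_LB_derivative ^^ N) f h" "has_LB_derivative h g"
    "(has_LB_derivative ^^ N) f' h'" "has_LB_derivative h' g'"
    using Suc.prems by (auto elim!: relpowp_Suc_E)
  have "(has_LB_derivative ^^ N) (\<lambda>x. a * f x + b * f' x) (\<lambda>x. a * h x + b * h' x)"
    by (rule Suc.IH[OF h(1,3)])
  moreover have "has_LB_derivative (\<lambda>x. a * h x + b * h' x) (\<lambda>x. a * g x + b * g' x)"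
    by (rule has_LB_derivative_linear[OF h(2,4)])
  ultimately show ?case unfolding relpowp.simps(2) by (rule relcomppI[where b =
      "\<lambda>x. a * h x + b * h' x" and r = "has_LB_derivative ^^ N" and s = has_LB_derivative])
qed simp

lemma has_LB_derivative_power_L2:
  "(has_LB_derivative ^^ N) f g \<Longrightarrow> f \<in> L2 \<sigma> \<Longrightarrow> g \<in> L2 (\<sigma> :: 'a measure)"
  by (cases N) (auto elim!: relpowp_Suc_E dest: has_LB_derivativeD)

text \<open>A factor 2 takes the place of the triangle inequality; it is harmless because the
  constant in \<open>LB_bounded\<close> is arbitrary.\<close>

lemma L2_norm_linear_le:
  assumes "f \<in> L2 M" "g \<in> L2 M"
  shows "sqrt (L2_sq M (\<lambda>x. a * f x + b * g x)) \<le> 2 * (cmod a * sqrt (L2_sq M f) + cmod b * sqrt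
      (L2_sq M g))"
proof -
  let ?u = "cmod a * sqrt (L2_sq M f)" and ?v = "cmod b * sqrt (L2_sq M g)"
  have "L2_sq M (\<lambda>x. a * f x + b * g x) \<le> (LINT x|M. 2 * (cmod (a * f x))\<^sup>2 + 2 * (cmod (b * g x))\<^sup>2)"
    unfolding L2_sq_def using L2_integrable_sq[OF L2_add[OF L2_scale[OF assms(1)] L2_scale[OF assms(2)]]]
      L2_integrable_sq[OF L2_scale[OF assms(1)]] L2_integrable_sq[OF L2_scale[OF assms(2)]]
    by (intro integral_mono norm_add_sq_le) auto
  also have "\<dots> = 2 * L2_sq M (\<lambda>x. a * f x) + 2 * L2_sq M (\<lambda>x. b * g x)"
    using L2_integrable_sq[OF L2_scale[OF assms(1)]] L2_integrable_sq[OF L2_scale[OF assms(2)]]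
    by (simp add: L2_sq_def)
  also have "\<dots> = 2 * ?u\<^sup>2 + 2 * ?v\<^sup>2"
    by (simp add: L2_sq_scale power_mult_distrib)
  also have "\<dots> \<le> (2 * (?u + ?v))\<^sup>2"
    by (simp add: power_mult_distrib power2_sum)
  finally show ?thesis by (intro real_le_lsqrt) auto
qed

lemma LB_bounded_linear:
  fixes f g :: "'a \<Rightarrow> complex"
  assumes f: "f \<in> LB_bounded R" and g: "g \<in> LB_bounded R" and R: "0 < R"
  shows "(\<lambda>x. a * f x + b * g x) \<in> LB_bounded R"
proof -
  have L: "f \<in> L2 \<sigma>" "g \<in> L2 \<sigma>" using f g by (simp_all add: LB_bounded_def)
  obtain C C' where C: "\<And>N. \<exists>h. (has_LB_derivative ^^ N) f h \<and> sqrt (L2_sq \<sigma> h) \<le> C * R ^ N"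
    "\<And>N. \<exists>h. (has_LB_derivative ^^ N) g h \<and> sqrt (L2_sq \<sigma> h) \<le> C' * R ^ N"
    using f g by (auto simp: LB_bounded_def)
  have "\<exists>h. (has_LB_derivative ^^ N) (\<lambda>x. a * f x + b * g x) h \<and>
      sqrt (L2_sq \<sigma> h) \<le> (2 * (cmod a * C + cmod b * C')) * R ^ N" for N
  proof -
    obtain h h' where h: "(has_LB_derivative ^^ N) f h" "sqrt (L2_sq \<sigma> h) \<le> C * R ^ N"
      and h': "(has_LB_derivative ^^ N) g h'" "sqrt (L2_sq \<sigma> h') \<le> C' * R ^ N"
      using C by meson
    have hL: "h \<in> L2 \<sigma>" "h' \<in> L2 \<sigma>"
      using has_LB_derivative_power_L2 h h' L by blast+
    have "sqrt (L2_sq \<sigma> (\<lambda>x. a * h x + b * h' x)) \<le>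
        2 * (cmod a * sqrt (L2_sq \<sigma> h) + cmod b * sqrt (L2_sq \<sigma> h'))"
      by (rule L2_norm_linear_le[OF hL])
    also have "\<dots> \<le> 2 * (cmod a * (C * R ^ N) + cmod b * (C' * R ^ N))"
      using h h' by (intro mult_left_mono add_mono) auto
    also have "\<dots> = (2 * (cmod a * C + cmod b * C')) * R ^ N" by (simp add: algebra_simps)
    finally show ?thesis using has_LB_derivative_power_linear[OF h(1) h'(1)] by blast
  qed
  then show ?thesis using L by (auto simp: LB_bounded_def intro!: L2_add L2_scale)
qed

text \<open>Provides the empty partial sum of an orthogonal expansion.\<close>

lemma LB_bounded_zero: "(\<lambda>_ :: 'a. 0) \<in> LB_bounded R"
proof -
  have "rim_mean t (\<lambda>_. 0) = (\<lambda>_ :: 'a. 0)" for t by (simp add: rim_mean_def fun_eq_iff)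
  then have "has_LB_derivative (\<lambda>_ :: 'a. 0) (\<lambda>_. 0)"
    by (simp add: has_LB_derivative_def L2_norm_def)
  then have "(has_LB_derivative ^^ N) (\<lambda>_ :: 'a. 0) (\<lambda>_. 0)" for N
    by (induction N) (auto intro: relpowp_Suc_I)
  then have "\<exists>g. (has_LB_derivative ^^ N) (\<lambda>_ :: 'a. 0) g \<and> sqrt (L2_sq \<sigma> g) \<le> 0 * R ^ N" for N
    by (intro exI[of _ "\<lambda>_. 0"]) (simp add: L2_sq_def)
  then show "(\<lambda>_ :: 'a. 0) \<in> LB_bounded R"
    unfolding LB_bounded_def using L2_zero by blast
qed

text \<open>An orthonormal family of maximal size inside the space is a basis: the remainder of any
  member after projection lies in the space again, and if it were not null, its normalisation would
  extend the family. The size is bounded by the Hilbert-Schmidt count.\<close>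

lemma LB_bounded_finite_dimensional:
  assumes R: "0 < R"
  obtains d and e :: "nat \<Rightarrow> 'a \<Rightarrow> complex" where "orthonormal_family \<sigma> d e"
    and "\<And>f. f \<in> LB_bounded R \<Longrightarrow> AE x in sphere_measure. f x = (\<Sum>i<d. L2_dot \<sigma> f (e i) * e i x)"
proof -
  \<comment> \<open>Small enough for \<open>\<theta>\<^sup>2 * R \<le> 1 / 4\<close>, as the lower
    bound for cap averages demands; the minimum with 1 keeps it below \<open>pi\<close>.\<close>
  define \<theta> where "\<theta> = min 1 (1 / (2 * sqrt R))"
  have \<theta>: "0 < \<theta>" "\<theta> < pi" "\<theta>\<^sup>2 * R \<le> 1 / 4"
  proof -
    show "0 < \<theta>" "\<theta> < pi" using R pi_gt3 by (auto simp: \<theta>_def)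
    have "\<theta>\<^sup>2 \<le> (1 / (2 * sqrt R))\<^sup>2" using R by (intro power_mono) (auto simp: \<theta>_def)
    also have "\<dots> = 1 / (4 * R)" using R by (simp add: power_divide power_mult_distrib)
    finally show "\<theta>\<^sup>2 * R \<le> 1 / 4" using R by (simp add: field_simps)
  qed
  have "cos \<theta> < 1" using \<theta> cos_monotone_0_pi[of 0 \<theta>] by simp
  then have \<kappa>: "0 < cap_area TYPE('a) (cos \<theta>)" by (rule cap_area_pos[OF dim])
  define good where "good d \<longleftrightarrow> (\<exists>e :: nat \<Rightarrow> 'a \<Rightarrow> complex. orthonormal_family \<sigma> d e \<and> (\<forall>i<d. e i
      \<in> LB_bounded R))" for d
  obtain B where B: "4 * sphere_area TYPE('a) / cap_area TYPE('a) (cos \<theta>) \<le> real B"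
      using real_arch_simple by blast
  have bound: "d \<le> B" if "good d" for d
  proof -
    have "real d * (cap_area TYPE('a) (cos \<theta>) / 4) \<le> sphere_area TYPE('a)"
      using that orthonormal_family_bound[OF _ _ R \<theta>] unfolding good_def by blast
    then have "real d \<le> 4 * sphere_area TYPE('a) / cap_area TYPE('a) (cos \<theta>)" using \<kappa> by (simp add:
        field_simps)
    then show ?thesis using B by linarith
  qed
  have "good 0" by (simp add: good_def orthonormal_family_def)
  define d where "d = Max (Collect good)"
  have fin: "finite (Collect good)" using bound by (rule_tac finite_subset[of _ "{..B}"]) auto
  have "good d" using Max_in[OF fin] \<open>good 0\<close> unfolding d_def by blast
  have not_good: "\<not> good (Suc d)" using Max_ge[OF fin, of "Suc d"] by (auto simp: d_def)
  obtain e :: "nat \<Rightarrow> 'a \<Rightarrow> complex" where e: "orthonormal_family \<sigma> d e" "\<And>i. i < d \<Longrightarrow> e i \<in> LB_bounded R"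
    using \<open>good d\<close> unfolding good_def by blast
  show thesis
  proof (rule that[OF e(1)])
    fix f :: "'a \<Rightarrow> complex" assume f: "f \<in> LB_bounded R"
    have fL: "f \<in> L2 \<sigma>" using f by (simp add: LB_bounded_def)
    have eL: "e i \<in> L2 \<sigma>" if "i < d" for i using e that by (simp add: orthonormal_family_def)
    define S where "S k = (\<lambda>x. \<Sum>i<k. L2_dot \<sigma> f (e i) * e i x)" for k
    have SLB: "S k \<in> LB_bounded R" if "k \<le> d" for k
      using that
    proof (induction k)
      case 0
      then show ?case using LB_bounded_zero by (simp add: S_def)
    next
      case (Suc k)
      then have "(\<lambda>x. 1 * S k x + L2_dot \<sigma> f (e k) * e k x) \<in> LB_bounded R"
        by (intro LB_bounded_linear e R) auto
      then show ?case by (simp add: S_def)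
    qed
    define g where "g = (\<lambda>x. f x - S d x)"
    have gLB: "g \<in> LB_bounded R"
      using LB_bounded_linear[OF f SLB[OF order_refl] R, of 1 "-1"] by (simp add: g_def)
    have gL: "g \<in> L2 \<sigma>" using gLB by (simp add: LB_bounded_def)
    have ge: "L2_dot \<sigma> g (e j) = 0" if j: "j < d" for j
    proof -
      have "S d \<in> L2 \<sigma>" using SLB[of d] by (simp add: LB_bounded_def)
      then have "L2_dot \<sigma> g (e j) = L2_dot \<sigma> f (e j) - L2_dot \<sigma> (S d) (e j)"
        unfolding g_def by (intro L2_dot_diff fL eL j)
      also have "L2_dot \<sigma> (S d) (e j) = (\<Sum>i<d. L2_dot \<sigma> f (e i) * L2_dot \<sigma> (e i) (e j))"
        unfolding S_def by (intro L2_dot_sum eL j) auto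
      also have "\<dots> = (\<Sum>i<d. if i = j then L2_dot \<sigma> f (e i) else 0)"
        using e(1) j by (intro sum.cong) (auto simp: orthonormal_family_def)
      also have "\<dots> = L2_dot \<sigma> f (e j)" using j by simp
      finally show ?thesis by simp
    qed
    have "L2_sq \<sigma> g = 0"
    proof (rule ccontr)
      assume "L2_sq \<sigma> g \<noteq> 0"
      then have pos: "0 < L2_sq \<sigma> g" using L2_sq_nonneg[of \<sigma> g] by (simp add: less_le)
      define c where "c = complex_of_real (1 / sqrt (L2_sq \<sigma> g))"
      define u where "u = (\<lambda>x. c * g x)"
      define e' where "e' = e(d := u)"
      have uLB: "u \<in> LB_bounded R" using LB_bounded_linear[OF gLB gLB R, of c 0] by (simp add: u_def)
      have uL: "u \<in> L2 \<sigma>" using uLB by (simp add: LB_bounded_def)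
      have "L2_sq \<sigma> u = (cmod c)\<^sup>2 * L2_sq \<sigma> g"
        unfolding u_def by (rule L2_sq_scale)
      also have "(cmod c)\<^sup>2 = 1 / L2_sq \<sigma> g"
        using pos unfolding c_def norm_of_real by (simp add: power_divide)
      finally have "L2_sq \<sigma> u = 1" using pos by simp
      then have uu: "L2_dot \<sigma> u u = 1" by (simp add: L2_dot_self)
      have ue: "L2_dot \<sigma> u (e i) = 0" "L2_dot \<sigma> (e i) u = 0" if "i < d" for i
      proof -
        show "L2_dot \<sigma> u (e i) = 0" by (simp add: u_def L2_dot_scale ge[OF that])
        then show "L2_dot \<sigma> (e i) u = 0" by (subst L2_dot_commute) simp
      qed
      have "orthonormal_family \<sigma> (Suc d) e'"
        using e(1) uu ue uL by (auto simp: orthonormal_family_def e'_def less_Suc_eq)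
      moreover have "e' i \<in> LB_bounded R" if "i < Suc d" for i
        using that e(2) uLB by (auto simp: e'_def less_Suc_eq)
      ultimately have "good (Suc d)" unfolding good_def by blast
      with not_good show False by simp
    qed
    then have "AE x in sphere_measure. g x = 0" using L2_sq_eq_0[OF gL] by simp
    then show "AE x in sphere_measure. f x = (\<Sum>i<d. L2_dot \<sigma> f (e i) * e i x)"
      by eventually_elim (simp add: g_def S_def)
  qed
qed

end

section \<open>Singular values of finite-rank operators\<close>

text \<open>Gaussian elimination: an unknown that occurs in equation \<open>d\<close> is eliminated
  from the others. The index set is arbitrary because the unknowns will be indexed by pairs of an
  eigenvalue and a position in its eigenspace.\<close>

lemma homogeneous_system_nontrivial:
  fixes a :: "'i \<Rightarrow> nat \<Rightarrow> 'f::field"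
  assumes "finite I" "d < card I"
  obtains c where "\<exists>p\<in>I. c p \<noteq> 0" "\<And>j. j < d \<Longrightarrow> (\<Sum>p\<in>I. c p * a p j) = 0"
proof -
  have "\<exists>c. (\<exists>p\<in>I. c p \<noteq> 0) \<and> (\<forall>j<d. (\<Sum>p\<in>I. c p * a p j) = 0)"
    using assms
  proof (induction d arbitrary: I a)
    case 0
    then obtain p where "p \<in> I" by (metis card_gt_0_iff ex_in_conv)
    then show ?case by (intro exI[of _ "\<lambda>_. 1"]) auto
  next
    case (Suc d)
    show ?case
    proof (cases "\<forall>p\<in>I. a p d = 0")
      case True
      obtain c where "\<exists>p\<in>I. c p \<noteq> 0" "\<forall>j<d. (\<Sum>p\<in>I. c p * a p j) = 0"
        using Suc.IH[of I a] Suc.prems by auto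
      with True show ?thesis by (intro exI[of _ c]) (auto simp: less_Suc_eq)
    next
      case False
      then obtain q where q: "q \<in> I" "a q d \<noteq> 0" by auto
      define J where "J = I - {q}"
      have J: "finite J" "d < card J" using Suc.prems q by (auto simp: J_def)
      obtain c where c: "\<exists>p\<in>J. c p \<noteq> 0" "\<forall>j<d. (\<Sum>p\<in>J. c p * (a p j - a p d / a q d * a q j)) = 0"
        using Suc.IH[OF J, of "\<lambda>p j. a p j - a p d / a q d * a q j"] by auto
      \<comment> \<open>The value at \<open>q\<close> is the one that equation \<open>d\<close>
        forces.\<close>
      define c' where "c' = c(q := - (\<Sum>p\<in>J. c p * (a p d / a q d)))"
      have sum: "(\<Sum>p\<in>I. c' p * a p j) = (\<Sum>p\<in>J. c p * (a p j - a p d / a q d * a q j))" for j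
      proof -
        have "(\<Sum>p\<in>I. c' p * a p j) = c' q * a q j + (\<Sum>p\<in>J. c' p * a p j)"
          using Suc.prems q by (simp add: J_def sum.remove)
        also have "(\<Sum>p\<in>J. c' p * a p j) = (\<Sum>p\<in>J. c p * a p j)"
          by (intro sum.cong) (auto simp: c'_def J_def)
        also have "c' q * a q j = - (\<Sum>p\<in>J. c p * (a p d / a q d * a q j))"
          by (simp add: c'_def sum_distrib_right mult.assoc)
        finally show ?thesis by (simp add: right_diff_distrib sum_subtractf)
      qed
      have "\<exists>p\<in>I. c' p \<noteq> 0" using c(1) by (auto simp: c'_def J_def)
      moreover have "\<forall>j<Suc d. (\<Sum>p\<in>I. c' p * a p j) = 0"
        unfolding sum using c(2) q(2) by (auto simp: less_Suc_eq)
      ultimately show ?thesis by blast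
    qed
  qed
  then show ?thesis using that by blast
qed

lemma L2_dot_sum_right:
  assumes "\<And>i. i \<in> I \<Longrightarrow> f i \<in> L2 M" "h \<in> L2 M"
  shows "L2_dot M h (\<lambda>x. \<Sum>i\<in>I. c i * f i x) = (\<Sum>i\<in>I. cnj (c i) * L2_dot M h (f i))"
  using L2_dot_sum[of I f M h c] assms
  by (subst L2_dot_commute) (simp add: L2_dot_commute[of M h "f _"])

section \<open>Eigenfunctions of positive operators\<close>

lemma L2_inner_eq_dot: "L2_inner M f g = complex_of_real (1 / measure M (space M)) * L2_dot M f g"
  by (simp add: L2_inner_def L2_dot_def)

lemma L2_positive_symmetric:
  assumes "L2_positive M P" "f \<in> L2 M" "g \<in> L2 M" "0 < measure M (space M)"
  shows "L2_dot M (P f) g = L2_dot M f (P g)"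
  using assms by (auto simp: L2_positive_def L2_adjoint_def L2_inner_eq_dot)

lemma L2_positive_L2: "L2_positive M P \<Longrightarrow> f \<in> L2 M \<Longrightarrow> P f \<in> L2 M"
  by (auto simp: L2_positive_def L2_adjoint_def L2_operator_def)

text \<open>Symmetry moves \<open>P\<close> onto the eigenfunction, and the factor comes out without
  conjugation because \<open>l\<close> is real.\<close>

lemma L2_dot_eigenfunction:
  assumes P: "L2_positive M P" and M: "0 < measure M (space M)"
    and f: "f \<in> L2 M" and g: "g \<in> L2_eigenspace M P l"
  shows "L2_dot M (P f) g = complex_of_real l * L2_dot M f g"
proof -
  have gL: "g \<in> L2 M" and eig: "AE x in M. P g x = complex_of_real l * g x"
    using g by (auto simp: L2_eigenspace_def)
  have "L2_dot M (P f) g = L2_dot M f (P g)" by (rule L2_positive_symmetric[OF P f gL M])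
  also have "\<dots> = cnj (L2_dot M (P g) f)" by (rule L2_dot_commute)
  also have "L2_dot M (P g) f = L2_dot M (\<lambda>x. complex_of_real l * g x) f"
    using L2_measurable[OF L2_positive_L2[OF P gL]] L2_measurable[OF gL] L2_measurable[OF f] eig
    by (intro L2_dot_cong_AE) auto
  finally show ?thesis by (simp add: L2_dot_scale L2_dot_commute[of M f g])
qed

lemma L2_dot_eigenspaces_orthogonal:
  assumes P: "L2_positive M P" and M: "0 < measure M (space M)" and l: "l \<noteq> l'"
    and f: "f \<in> L2_eigenspace M P l" and g: "g \<in> L2_eigenspace M P l'"
  shows "L2_dot M f g = 0"
proof -
  have fL: "f \<in> L2 M" and eig: "AE x in M. P f x = complex_of_real l * f x" and gL: "g \<in> L2 M"
    using f g by (auto simp: L2_eigenspace_def)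
  have "complex_of_real l * L2_dot M f g = L2_dot M (P f) g"
    using L2_measurable[OF L2_positive_L2[OF P fL]] L2_measurable[OF gL] L2_measurable[OF fL] eig
    by (subst L2_dot_scale[symmetric], intro L2_dot_cong_AE) auto
  also have "\<dots> = complex_of_real l' * L2_dot M f g" by (rule L2_dot_eigenfunction[OF P M fL g])
  finally show ?thesis using l by simp
qed

lemma L2_dot_zero_AE: "f \<in> borel_measurable M \<Longrightarrow> h \<in> borel_measurable M \<Longrightarrow> AE x in M. f x = 0 \<Longrightarrow>
    L2_dot M f h = 0"
  using L2_dot_cong_AE[of f M "\<lambda>_. 0" h] by (simp add: L2_dot_def)

text \<open>Otherwise the first \<open>d + 1\<close> eigenfunctions of \<open>P = |A|\<close> would have a combination
  \<open>g \<noteq> 0\<close> with \<open>A g = 0\<close>, hence \<open>P (P g) = 0\<close>, which makes \<open>g\<close> orthogonal to all of them.\<close>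

lemma singular_values_finite_rank:
  assumes s: "has_singular_values M A s" and M: "0 < measure M (space M)"
    and h: "\<And>j. j < d \<Longrightarrow> h j \<in> L2 M"
    and A_meas: "\<And>f. f \<in> L2 M \<Longrightarrow> A f \<in> borel_measurable M"
    and A_zero: "\<And>f. f \<in> L2 M \<Longrightarrow> (\<And>j. j < d \<Longrightarrow> L2_dot M f (h j) = 0) \<Longrightarrow> AE x in M. A f x = 0"
    and n: "d < n"
  shows "s n = 0"
proof (rule ccontr)
  assume "s n \<noteq> 0"
  have mono: "\<And>n. n \<ge> 1 \<Longrightarrow> 0 \<le> s n \<and> s (Suc n) \<le> s n" using s by (auto simp: has_singular_values_def)
  have anti: "s k \<le> s j" if "1 \<le> j" "j \<le> k" for j k
    using that(2) by (induction k rule: dec_induct) (use mono that(1) in \<open>auto intro: order_trans\<close>)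
  have "0 < s n" using \<open>s n \<noteq> 0\<close> mono[of n] n by simp
  then have pos: "0 < s k" if "1 \<le> k" "k \<le> Suc d" for k using anti[of k n] that n by simp
  obtain P where P: "L2_abs M A P" and dims: "\<And>l. 0 < l \<Longrightarrow> finite {n. n \<ge> 1 \<and> s n = l} \<and>
      L2_has_dim M (L2_eigenspace M P l) (card {n. n \<ge> 1 \<and> s n = l})"
    using s by (auto simp: has_singular_values_def)
  have Ppos: "L2_positive M P" using P by (simp add: L2_abs_def)
  obtain B where B: "L2_adjoint M A B" and PP: "\<And>f. f \<in> L2 M \<Longrightarrow> AE x in M. P (P f) x = B (A f) x"
    using P by (auto simp: L2_abs_def)
  define N where "N l = {n. n \<ge> 1 \<and> s n = l}" for l
  \<comment> \<open>The distinct values among the first \<open>d + 1\<close> singular values, all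
    positive under the assumption to be refuted.\<close>
  define \<Lambda> where "\<Lambda> = s ` {1..Suc d}"
  have \<Lambda>: "0 < l" if "l \<in> \<Lambda>" for l using that pos by (auto simp: \<Lambda>_def)
  have "\<forall>l\<in>\<Lambda>. \<exists>\<phi>. (\<forall>i<card (N l). \<phi> i \<in> L2_eigenspace M P l) \<and>
      (\<forall>c. (AE x in M. (\<Sum>i<card (N l). c i * \<phi> i x) = 0) \<longrightarrow> (\<forall>i<card (N l). c i = 0))"
    using dims \<Lambda> unfolding N_def L2_has_dim_def by blast
  then obtain \<phi> where \<phi>: "\<And>l i. l \<in> \<Lambda> \<Longrightarrow> i < card (N l) \<Longrightarrow> \<phi> l i \<in> L2_eigenspace M P l"
    and indep: "\<And>l c i. l \<in> \<Lambda> \<Longrightarrow> AE x in M. (\<Sum>i<card (N l). c i * \<phi> l i x) = 0 \<Longrightarrow> i < card (N l) \<Longrightarrow> c i = 0"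
    unfolding bchoice_iff by blast
  have \<phi>L: "\<phi> l i \<in> L2 M" if "l \<in> \<Lambda>" "i < card (N l)" for l i
    using \<phi>[OF that] by (simp add: L2_eigenspace_def)
  define I where "I = Sigma \<Lambda> (\<lambda>l. {..<card (N l)})"
  have fin: "finite I" by (simp add: I_def \<Lambda>_def)
  \<comment> \<open>Counting with multiplicity: the indices from 1 to \<open>d + 1\<close> lie in
    the sets \<open>N l\<close>, and each \<open>N l\<close> has as many elements as there are
    chosen eigenfunctions for \<open>l\<close>.\<close>
  have "Suc d = card {1..Suc d}" by simp
  also have "\<dots> \<le> card (\<Union>l\<in>\<Lambda>. N l)"
    using dims \<Lambda> by (intro card_mono) (auto simp: N_def \<Lambda>_def)
  also have "\<dots> \<le> (\<Sum>l\<in>\<Lambda>. card (N l))" by (rule card_UN_le) (simp add: \<Lambda>_def)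
  also have "\<dots> = card I" by (simp add: I_def \<Lambda>_def card_SigmaI)
  finally have "d < card I" by simp
  then obtain c where c: "\<exists>p\<in>I. c p \<noteq> 0"
    "\<And>j. j < d \<Longrightarrow> (\<Sum>p\<in>I. c p * L2_dot M (\<phi> (fst p) (snd p)) (h j)) = 0"
    using homogeneous_system_nontrivial[OF fin, of d "\<lambda>p j. L2_dot M (\<phi> (fst p) (snd p)) (h j)"] by blast
  define F where "F p = \<phi> (fst p) (snd p)" for p
  have FE: "F p \<in> L2_eigenspace M P (fst p)" and FL: "F p \<in> L2 M" and Fpos: "0 < fst p" if "p \<in> I" for p
    using that \<phi> \<phi>L \<Lambda> by (auto simp: F_def I_def)
  define g where "g = (\<lambda>x. \<Sum>p\<in>I. c p * F p x)"
  have gL: "g \<in> L2 M" unfolding g_def by (intro L2_sum L2_scale FL)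
  have "L2_dot M g (h j) = 0" if "j < d" for j
  proof -
    have "L2_dot M g (h j) = (\<Sum>p\<in>I. c p * L2_dot M (F p) (h j))"
      unfolding g_def by (intro L2_dot_sum FL h that)
    then show ?thesis using c(2)[OF that] by (simp add: F_def)
  qed
  then have Ag: "AE x in M. A g x = 0" by (intro A_zero gL)
  have AgL: "A g \<in> L2 M"
  proof -
    have "integrable M (\<lambda>x. (cmod (A g x))\<^sup>2) \<longleftrightarrow> integrable M (\<lambda>_. 0 :: real)"
      using A_meas[OF gL] Ag by (intro integrable_cong_AE) auto
    then show ?thesis using A_meas[OF gL] by (simp add: L2_def)
  qed
  \<comment> \<open>That \<open>B\<close> sends the null function \<open>A g\<close> to a null
    function comes from its norm bound.\<close>
  have "L2_operator M B" using B by (simp add: L2_adjoint_def)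
  then have BL: "B (A g) \<in> L2 M" and "\<exists>C. \<forall>f\<in>L2 M. L2_norm M (B f) \<le> C * L2_norm M f"
    using AgL by (simp_all add: L2_operator_def)
  then obtain C where C: "\<And>f. f \<in> L2 M \<Longrightarrow> L2_norm M (B f) \<le> C * L2_norm M f" by blast
  have "L2_sq M (A g) = 0" using L2_sq_eq_0[OF AgL] Ag by simp
  then have "L2_norm M (B (A g)) \<le> 0" using C[OF AgL] by (simp add: L2_norm_def L2_sq_def[symmetric])
  then have "L2_sq M (B (A g)) \<le> 0"
    using M by (simp add: L2_norm_def L2_sq_def[symmetric] divide_le_0_iff)
  then have "AE x in M. B (A g) x = 0" using L2_sq_eq_0[OF BL] L2_sq_nonneg[of M "B (A g)"] by simp
  then have PPg: "AE x in M. P (P g) x = 0" using PP[OF gL] by eventually_elim simp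
  have PgL: "P g \<in> L2 M" "P (P g) \<in> L2 M" using L2_positive_L2[OF Ppos] gL by auto
  \<comment> \<open>Moving \<open>P\<close> across twice gives the square of the eigenvalue
    \<open>fst p\<close> as a factor, and it is not 0.\<close>
  have gF: "L2_dot M g (F p) = 0" if p: "p \<in> I" for p
  proof -
    have "L2_dot M (P (P g)) (F p) = 0"
      using PPg by (intro L2_dot_zero_AE L2_measurable PgL FL p)
    then show ?thesis
      using Fpos[OF p] by (simp add: L2_dot_eigenfunction[OF Ppos M _ FE[OF p]] PgL gL)
  qed
  have "L2_dot M g g = (\<Sum>p\<in>I. cnj (c p) * L2_dot M g (F p))"
    using L2_dot_sum_right[OF FL gL, where c = c] by (simp add: g_def)
  then have "L2_sq M g = 0" by (simp add: gF L2_dot_self)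
  then have g0: "AE x in M. g x = 0" using L2_sq_eq_0[OF gL] by simp
  \<comment> \<open>\<open>indep\<close> concerns one eigenvalue at a time. Orthogonality of
    different eigenspaces isolates the part \<open>G\<close> of \<open>g\<close> that belongs to
    \<open>l\<close>; it is orthogonal to each function it is composed of, hence null.\<close>
  have "c (l, i) = 0" if l: "l \<in> \<Lambda>" and i: "i < card (N l)" for l i
  proof -
    define G where "G = (\<lambda>x. \<Sum>i<card (N l). c (l, i) * \<phi> l i x)"
    have GL: "G \<in> L2 M" unfolding G_def by (intro L2_sum L2_scale \<phi>L l) simp
    have "L2_dot M G (\<phi> l k) = 0" if k: "k < card (N l)" for k
    proof -
      have "0 = L2_dot M g (\<phi> l k)" using g0 by (intro L2_dot_zero_AE[symmetric] L2_measurable gL \<phi>L l k)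
      also have "\<dots> = (\<Sum>p\<in>I. c p * L2_dot M (F p) (\<phi> l k))"
        unfolding g_def by (intro L2_dot_sum FL \<phi>L l k)
      also have "\<dots> = (\<Sum>l'\<in>\<Lambda>. \<Sum>i<card (N l'). c (l', i) * L2_dot M (\<phi> l' i) (\<phi> l k))"
        unfolding I_def F_def by (subst sum.Sigma) (auto simp: \<Lambda>_def case_prod_unfold)
      also have "\<dots> = (\<Sum>l'\<in>\<Lambda>. if l' = l then (\<Sum>i<card (N l). c (l, i) * L2_dot M (\<phi> l i) (\<phi> l k)) else 0)"
        using L2_dot_eigenspaces_orthogonal[OF Ppos M _ \<phi> \<phi>[OF l k]]
        by (intro sum.cong) (auto intro!: sum.neutral)
      also have "\<dots> = (\<Sum>i<card (N l). c (l, i) * L2_dot M (\<phi> l i) (\<phi> l k))"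
        using l by (simp add: \<Lambda>_def)
      also have "\<dots> = L2_dot M G (\<phi> l k)"
        unfolding G_def by (intro L2_dot_sum[symmetric] \<phi>L l k) simp
      finally show ?thesis by simp
    qed
    then have "L2_dot M G G = 0"
      using L2_dot_sum_right[of "{..<card (N l)}" "\<phi> l" M G "\<lambda>i. c (l, i)"] \<phi>L[OF l] GL
          by (simp add: G_def)
    then have "AE x in M. G x = 0" using L2_sq_eq_0[OF GL] by (simp add: L2_dot_self)
    then show ?thesis using indep[OF l _ i, of "\<lambda>i. c (l, i)"] by (simp add: G_def)
  qed
  then show False using c(1) by (auto simp: I_def)
qed

section \<open>The kernel has finite rank\<close>

text \<open>The square norms of the derivatives of a section, divided by the squares of
  \<open>(2 * R) ^ r\<close>, have integrals over \<open>x\<close> dominated by a convergent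
  geometric series; doubling \<open>R\<close> produces the convergence. So their sum over all orders
  is finite for almost every \<open>x\<close>, and it bounds each single term.\<close>

lemma kernel_section_LB_bounded:
  fixes K :: "'a::euclidean_space \<Rightarrow> 'a \<Rightarrow> complex"
  assumes dim: "2 \<le> DIM('a)" and KW: "kernel_W2_infinity K"
    and deriv: "\<And>r. r \<ge> 1 \<Longrightarrow> has_LB_derivative_snd r K (K0 r)"
    and R: "0 < R" and bound: "\<And>r. r \<ge> 1 \<Longrightarrow> kernel_norm (K0 r) \<le> C0 * R ^ r"
  shows "AE x in sphere_measure. K x \<in> LB_bounded (2 * R)"
proof -
  define w where "w = sphere_area TYPE('a)"
  have w: "0 < w" using measure_sphere_pos[where 'a = 'a] by (simp add: w_def)
  define \<Sigma> where "\<Sigma> = (\<sigma> \<Otimes>\<^sub>M \<sigma> :: ('a \<times> 'a) measure)"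
  have \<Sigma>: "measure \<Sigma> (space \<Sigma>) = w * w"
  proof -
    have "emeasure \<Sigma> (space \<Sigma>) = ennreal w * ennreal w"
      unfolding \<Sigma>_def space_pair_measure
      by (subst sphere.emeasure_pair_measure_Times) (use sets.top[of \<sigma>] in \<open>auto
          simp: sphere.emeasure_eq_measure w_def\<close>)
    then show ?thesis using w by (simp add: measure_def ennreal_mult[symmetric])
  qed
  define u where "u r x = (\<integral>\<^sup>+y. ennreal ((cmod (K0 r x y))\<^sup>2) \<partial>\<sigma>)" for r x
  have L2K: "case_prod (K0 r) \<in> L2 \<Sigma>" if "r \<ge> 1" for r
    using deriv[OF that] by (simp add: has_LB_derivative_snd_def L2_kernel_def \<Sigma>_def)
  have u_meas: "u r \<in> borel_measurable \<sigma>" if "r \<ge> 1" for r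
  proof -
    have "(\<lambda>(x, y). ennreal ((cmod (K0 r x y))\<^sup>2)) \<in> borel_measurable \<Sigma>"
      using L2_measurable[OF L2K[OF that]] by (simp add: case_prod_unfold)
    then show ?thesis unfolding u_def \<Sigma>_def by (intro sphere.borel_measurable_nn_integral)
  qed
  have u_int: "(\<integral>\<^sup>+x. u r x \<partial>\<sigma>) \<le> ennreal ((w * C0 * R ^ r)\<^sup>2)" if "r \<ge> 1" for r
  proof -
    have "(\<integral>\<^sup>+x. u r x \<partial>\<sigma>) = (\<integral>\<^sup>+p. ennreal ((cmod (case_prod (K0 r) p))\<^sup>2) \<partial>\<Sigma>)"
      unfolding u_def \<Sigma>_def
      using sphere.nn_integral_fst[of "\<lambda>p. ennreal ((cmod (case_prod (K0 r) p))\<^sup>2)" \<sigma>]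
        L2_measurable[OF L2K[OF that]] by (simp add: \<Sigma>_def)
    also have "\<dots> = ennreal (L2_sq \<Sigma> (case_prod (K0 r)))" by (rule nn_integral_L2_sq[OF L2K[OF that]])
    also have "L2_sq \<Sigma> (case_prod (K0 r)) = (w * kernel_norm (K0 r))\<^sup>2"
    proof -
      have "kernel_norm (K0 r) = sqrt (L2_sq \<Sigma> (case_prod (K0 r)) / (w * w))"
        by (simp add: kernel_norm_def L2_norm_def L2_sq_def[symmetric] \<Sigma>[symmetric] \<Sigma>_def)
      then have "(kernel_norm (K0 r))\<^sup>2 = L2_sq \<Sigma> (case_prod (K0 r)) / (w * w)"
        by (simp del: real_sqrt_divide real_sqrt_mult)
      then show ?thesis using w by (simp add: power_mult_distrib power2_eq_square[of w])
    qed
    also have "\<dots> \<le> (w * C0 * R ^ r)\<^sup>2"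
    proof (rule power_mono)
      show "w * kernel_norm (K0 r) \<le> w * C0 * R ^ r" using bound[OF that] w by (simp add: mult.assoc)
      show "0 \<le> w * kernel_norm (K0 r)" using w by (simp add: kernel_norm_def L2_norm_def)
    qed
    finally show ?thesis by (simp add: ennreal_leI)
  qed
  \<comment> \<open>Shifted by one, since the derivatives are given for orders from 1 on; order 0 is
    the section itself.\<close>
  define v where "v k x = ennreal (1 / ((2 * R) ^ Suc k)\<^sup>2) * u (Suc k) x" for k x
  have v_meas: "v k \<in> borel_measurable \<sigma>" for k
    unfolding v_def by (intro borel_measurable_times_ennreal u_meas) auto
  have v_int: "(\<integral>\<^sup>+x. v k x \<partial>\<sigma>) \<le> ennreal ((w * C0)\<^sup>2 * (1 / 4) ^ k)" for k
  proof -
    have "(\<integral>\<^sup>+x. v k x \<partial>\<sigma>) = ennreal (1 / ((2 * R) ^ Suc k)\<^sup>2) * (\<integral>\<^sup>+x. u (Suc k) x \<partial>\<sigma>)"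
      unfolding v_def by (rule nn_integral_cmult[OF u_meas]) simp
    also have "\<dots> \<le> ennreal (1 / ((2 * R) ^ Suc k)\<^sup>2) * ennreal ((w * C0 * R ^ Suc k)\<^sup>2)"
      by (intro mult_left_mono u_int) auto
    also have "\<dots> = ennreal (1 / ((2 * R) ^ Suc k)\<^sup>2 * (w * C0 * R ^ Suc k)\<^sup>2)"
      by (rule ennreal_mult[symmetric]) auto
    also have "1 / ((2 * R) ^ Suc k)\<^sup>2 * (w * C0 * R ^ Suc k)\<^sup>2 = (w * C0)\<^sup>2 * (1 / 4) ^ Suc k"
    proof -
      have "((2 :: real) ^ Suc k)\<^sup>2 = 4 ^ Suc k"
        by (metis mult.commute num_double numeral_times_numeral power2_eq_square power_mult)
      moreover have "R ^ Suc k \<noteq> 0" using R by simp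
      ultimately show ?thesis
        by (simp only: power_mult_distrib power_divide power_one) (simp del: power_Suc)
    qed
    also have "\<dots> \<le> (w * C0)\<^sup>2 * (1 / 4) ^ k" by (intro mult_left_mono) auto
    finally show ?thesis by (simp add: ennreal_leI)
  qed
  have "(\<integral>\<^sup>+x. (\<Sum>k. v k x) \<partial>\<sigma>) = (\<Sum>k. \<integral>\<^sup>+x. v k x \<partial>\<sigma>)"
    by (rule nn_integral_suminf[OF v_meas])
  also have "\<dots> \<le> (\<Sum>k. ennreal ((w * C0)\<^sup>2 * (1 / 4) ^ k))"
    by (intro suminf_le v_int) auto
  also have "\<dots> = ennreal (\<Sum>k. (w * C0)\<^sup>2 * (1 / 4) ^ k)"
    by (intro suminf_ennreal2 summable_mult summable_geometric) auto
  also have "\<dots> < \<infinity>" by simp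
  finally have fin: "AE x in sphere_measure. (\<Sum>k. v k x) \<noteq> \<infinity>"
    using v_meas by (intro nn_integral_PInf_AE) auto
  \<comment> \<open>Countably many exceptional null sets are united, so that a single
    \<open>x\<close> serves all orders.\<close>
  have "AE x in sphere_measure. \<forall>k. (has_LB_derivative ^^ Suc k) (K x) (K0 (Suc k) x)"
    unfolding AE_all_countable using deriv by (auto simp: has_LB_derivative_snd_def simp del:
        relpowp.simps)
  moreover have "AE x in sphere_measure. K x \<in> L2 \<sigma>"
    using KW unfolding kernel_W2_infinity_def W2_infinity_def by eventually_elim simp
  ultimately show ?thesis
    using fin
  proof eventually_elim
    case (elim x)
    obtain S where S: "(\<Sum>k. v k x) = ennreal S" "0 \<le> S" using elim(3) by (cases "\<Sum>k. v k x") auto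
    \<comment> \<open>The first entry serves the orders from 1 on, the second one order 0.\<close>
    define C where "C = max (sqrt S) (sqrt (L2_sq \<sigma> (K x)))"
    have "\<exists>g. (has_LB_derivative ^^ N) (K x) g \<and> sqrt (L2_sq \<sigma> g) \<le> C * (2 * R) ^ N" for N
    proof (cases N)
      case 0
      then show ?thesis by (intro exI[of _ "K x"]) (simp add: C_def)
    next
      case (Suc k)
      have D: "(has_LB_derivative ^^ Suc k) (K x) (K0 (Suc k) x)" using elim(1) by blast
      have L: "K0 (Suc k) x \<in> L2 \<sigma>" by (rule has_LB_derivative_power_L2[OF dim D elim(2)])
      have "v k x \<le> (\<Sum>k. v k x)"
        using sum_le_suminf[of "\<lambda>k. v k x" "{k}"] by simp
      moreover have "v k x = ennreal (1 / ((2 * R) ^ Suc k)\<^sup>2 * L2_sq \<sigma> (K0 (Suc k) x))"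
        unfolding v_def u_def nn_integral_L2_sq[OF L] by (rule ennreal_mult[symmetric]) simp_all
      ultimately have "ennreal (1 / ((2 * R) ^ Suc k)\<^sup>2 * L2_sq \<sigma> (K0 (Suc k) x)) \<le> ennreal S"
        by (simp only: S(1))
      then have "1 / ((2 * R) ^ Suc k)\<^sup>2 * L2_sq \<sigma> (K0 (Suc k) x) \<le> S"
        using S(2) by (simp del: power_Suc)
      then have "L2_sq \<sigma> (K0 (Suc k) x) \<le> S * ((2 * R) ^ Suc k)\<^sup>2"
        using R by (simp add: field_simps del: power_Suc)
      then have "sqrt (L2_sq \<sigma> (K0 (Suc k) x)) \<le> sqrt (S * ((2 * R) ^ Suc k)\<^sup>2)" by simp
      also have "\<dots> = sqrt S * (2 * R) ^ Suc k" using R by (simp add: real_sqrt_mult del: power_Suc)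
      also have "\<dots> \<le> C * (2 * R) ^ Suc k" using R unfolding C_def by (intro mult_right_mono) auto
      finally show ?thesis using D Suc by blast
    qed
    then show ?case using elim(2) unfolding LB_bounded_def by blast
  qed
qed

theorem theorem2p1:
  fixes m :: nat
    and K :: "'a::euclidean_space \<Rightarrow> 'a \<Rightarrow> complex"
    and K0 :: "nat \<Rightarrow> 'a \<Rightarrow> 'a \<Rightarrow> complex"
    and M R :: real
    and s \<alpha> :: "nat \<Rightarrow> real"
  assumes "m \<ge> 2" and "DIM('a) = m + 1"
    and "L2_kernel K"
    and "kernel_W2_infinity K"
    and "\<And>r. r \<ge> 1 \<Longrightarrow> has_LB_derivative_snd r K (K0 r)"
    and "M > 0" and "R > 1"
    and "\<And>r. r \<ge> 1 \<Longrightarrow> kernel_norm (K0 r) \<le> M * R ^ r"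
    and "has_singular_values sphere_measure (kernel_operator K) s"
    and "\<And>n. n \<ge> 1 \<Longrightarrow> \<alpha> n > 0"
    and "\<alpha> \<in> o(\<lambda>n. root m (real n))"
  shows "s \<in> o(\<lambda>n. real n powr
           (- (root m (real n) / ((if m = 2 then 2 else 1) * real m)) - \<alpha> n))"
proof -
  have dim: "2 \<le> DIM('a)" using assms(1,2) by simp
  have R: "0 < 2 * R" using assms(7) by simp
  obtain d and e :: "nat \<Rightarrow> 'a \<Rightarrow> complex" where e: "orthonormal_family \<sigma> d e"
    and span: "\<And>f. f \<in> LB_bounded (2 * R) \<Longrightarrow> AE y in sphere_measure. f y = (\<Sum>i<d. L2_dot \<sigma> f (e i) *
        e i y)"
    using LB_bounded_finite_dimensional[OF dim R] by blast
  have eL: "e i \<in> L2 \<sigma>" if "i < d" for i using e that by (simp add: orthonormal_family_def)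
  have LB: "AE x in sphere_measure. K x \<in> LB_bounded (2 * R)"
    using assms(7) by (intro kernel_section_LB_bounded[OF dim assms(4,5) _ assms(8)]) auto
  have K_meas: "case_prod K \<in> borel_measurable (\<sigma> \<Otimes>\<^sub>M \<sigma>)"
    using assms(3) by (simp add: L2_kernel_def L2_def)
  have "s n = 0" if "d < n" for n
  \<comment> \<open>The test functions are conjugated because \<open>kernel_operator\<close> pairs
    \<open>K x\<close> with \<open>f\<close> without conjugation, while \<open>L2_dot\<close>
    conjugates its second argument.\<close>
  proof (rule singular_values_finite_rank[OF assms(9), where d = d and h = "\<lambda>i y. cnj (e i y)"])
    show "0 < measure \<sigma> (space (\<sigma> :: 'a measure))"
      using measure_sphere_pos[where 'a = 'a] by simp
    show "(\<lambda>y. cnj (e j y)) \<in> L2 \<sigma>" if "j < d" for j by (intro L2_cnj eL that)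
    show "d < n" by fact
    show "kernel_operator K f \<in> borel_measurable \<sigma>" if f: "f \<in> L2 \<sigma>" for f
    proof -
      have "(\<lambda>p. f (snd p)) \<in> borel_measurable (\<sigma> \<Otimes>\<^sub>M \<sigma>)"
        by (rule measurable_compose[OF measurable_snd L2_measurable[OF f]])
      then have "(\<lambda>(x, y). K x y * f y) \<in> borel_measurable (\<sigma> \<Otimes>\<^sub>M \<sigma>)"
        using borel_measurable_times[OF K_meas] by (simp add: case_prod_unfold)
      then show ?thesis
        unfolding kernel_operator_def by (rule sphere.borel_measurable_lebesgue_integral)
    qed
    show "AE x in sphere_measure. kernel_operator K f x = 0"
      if f: "f \<in> L2 \<sigma>" and orth: "\<And>j. j < d \<Longrightarrow> L2_dot \<sigma> f (\<lambda>y. cnj (e j y)) = 0" for f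
      using LB
    proof eventually_elim
      case (elim x)
      define a where "a i = L2_dot \<sigma> (K x) (e i)" for i
      have KxL: "K x \<in> L2 \<sigma>" using elim by (simp add: LB_bounded_def)
      have sumL: "(\<lambda>y. \<Sum>i<d. a i * e i y) \<in> L2 \<sigma>" by (intro L2_sum L2_scale eL) simp
      \<comment> \<open>For almost every \<open>x\<close> the value is a combination of the pairings
        of \<open>f\<close> with the \<open>d\<close> test functions, with coefficients depending on
        \<open>x\<close>, and so vanishes with them.\<close>
      have "kernel_operator K f x = L2_dot \<sigma> (K x) (\<lambda>y. cnj (f y))"
        by (simp add: kernel_operator_def L2_dot_def)
      also have "\<dots> = L2_dot \<sigma> (\<lambda>y. \<Sum>i<d. a i * e i y) (\<lambda>y. cnj (f y))"
        using span[OF elim] unfolding a_def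
        by (intro L2_dot_cong_AE L2_measurable KxL sumL[unfolded a_def] L2_cnj f)
      also have "\<dots> = (\<Sum>i<d. a i * L2_dot \<sigma> (e i) (\<lambda>y. cnj (f y)))"
        by (intro L2_dot_sum eL L2_cnj f) simp
      also have "\<dots> = 0"
      proof (intro sum.neutral ballI)
        fix i assume "i \<in> {..<d}"
        then have "L2_dot \<sigma> f (\<lambda>y. cnj (e i y)) = 0" using orth by simp
        then have "L2_dot \<sigma> (e i) (\<lambda>y. cnj (f y)) = 0" by (simp add: L2_dot_def mult.commute)
        then show "a i * L2_dot \<sigma> (e i) (\<lambda>y. cnj (f y)) = 0" by simp
      qed
      finally show ?case .
    qed
  qed
  then have "\<forall>\<^sub>F n in sequentially. s n = 0"
    by (intro eventually_mono[OF eventually_gt_at_top[of d]])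
  then show ?thesis by (auto simp: smallo_def elim!: eventually_mono)
qed

end
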